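(* Let $I^\alpha$ be a genuinely nonlinear backward sector and let $V$ be admissible. Then $V=V_S+V_L$ (here $V$ is the full function of $\xi\in\mathbb R$, not its restriction to $I^\alpha$), where $V_L$ is Lipschitz, with a Lipschitz constant independent of $V$. In particular $V$ is of bounded variation.
   Context: Setting. $f^x,f^y$ are smooth $\mathbb R^m$-valued functions on an open subset of $\mathbb R^m$, $\overline U$ is a state in it with $f^x_U(\overline U)$ invertible, and $(\eta,\psi^x,\psi^y)$ is a smooth entropy-flux pair, i.e. $\psi^x_U=\eta_Uf^x_U$, $\psi^y_U=\eta_Uf^y_U$, with $\eta$ uniformly convex. Near $\overline U$ the map $f^x$ is a diffeomorphism; set $V=f^x(U)$, $\overline V=f^x(\overline U)$, $f=f^y\circ(f^x)^{-1}$, $e=\psi^x\circ(f^x)^{-1}$, $q=\psi^y\circ(f^x)^{-1}$ (then $q_V=e_Vf_V$), and $\mathcal P_\epsilon=\{V:|V-\overline V|\le\epsilon\}$, where $\epsilon>0$ is fixed sufficiently small depending only on the system and $\overline V$. Strict hyperbolicity is assumed: $f_V(\overline V)$ has $m$ distinct real eigenvalues. Let $\hat A(V^+,V^-)=\int_0^1f_V((1-s)V^-+sV^+)\,ds$; for $V^\pm\in\mathcal P_\epsilon$ it has real, uniformly separated eigenvalues $\hat\lambda^1(V^+,V^-)<\dots<\hat\lambda^m(V^+,V^-)$, smooth in $V^\pm$. Put $\lambda^\alpha(V)=\hat\lambda^\alpha(V,V)$ and let $r^\alpha(V)$ be a unit right eigenvector of $f_V(V)$ for $\lambda^\alpha(V)$,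 smooth in $V$. For each $\alpha$, $(r^\alpha)^Te_{VV}r^\alpha\ne0$ on $\mathcal P_\epsilon$, hence has constant sign. Solutions. $V:\mathbb R\to\mathcal P_\epsilon$ is (a representative of) a steady self-similar weak solution of $f^x(U)_x+f^y(U)_y=0$ in the half-plane $\tau x>0$, $\tau\in\{1,-1\}$, as a function of $\xi=y/x$: $V$ is measurable and for all $\xi_1,\xi_2$: $f(V(\xi_2))-\xi_2V(\xi_2)-f(V(\xi_1))+\xi_1V(\xi_1)=-\int_{\xi_1}^{\xi_2}V\,d\xi$. $V$ is admissible if also $\tau\big(q(V)-\xi e(V)\big)\big|_{\xi_1}^{\xi_2}\le-\tau\int_{\xi_1}^{\xi_2}e(V)\,d\xi$ for all $\xi_1<\xi_2$. Sectors. $I^\alpha=(\lambda^\alpha(\overline V)-\delta^\alpha,\lambda^\alpha(\overline V)+\delta^\alpha)$, where $\delta^\alpha>0$ depends only on $\epsilon$ (and the system), $\delta^\alpha\downarrow0$ as $\epsilon\downarrow0$; $\hat\lambda^\alpha(V^+,V^-)\in I^\alpha$ for all $V^\pm\in\mathcal P_\epsilon$, the closures of $I^1,\dots,I^m$ are pairwise disjoint, and $V$ is constant on each component of $\mathbb R\setminus\bigcup_\alpha I^\alpha$. $I^\alpha$ is genuinely nonlinear if $\lambda^\alpha_V(V)r^\alpha(V)>0$ for all $V\in\mathcal P_\epsilon$ (after choice of sign of $r^\alpha$). $I^\alpha$ is a forward sector if $\tau\,(r^\alpha)^Te_{VV}r^\alpha>0$ and a backward sector if $\tau\,(r^\alpha)^Te_{VV}r^\alpha<0$.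 Saltus part. $\mathcal S$ is the set of discontinuity points of $V$ in $I^\alpha$. For admissible $V$ and a genuinely nonlinear backward sector $I^\alpha$, $\mathcal S$ is discrete and $V$ has left and right limits $V(\eta\pm)$ at each $\eta\in\mathcal S$; $V$ is modified on $\mathcal S$ so that $V(\eta)=V(\eta+)$. Finally $V_S(\xi)=\sum_{\eta\in\mathcal S,\ \eta\le\xi}\big(V(\eta+)-V(\eta-)\big)$, an absolutely convergent sum defining a right-continuous saltus function.
   Formalization: V = V_S + V_L holds on all of ℝ, but "V_L is Lipschitz" and "V is of bounded variation" are claimed only on ℝ minus the other sectors I^β (β ≠ α), since V_S records jumps in I^α only and shocks in another sector would make V_L discontinuous. *)

theory Defs
  imports "HOL-Analysis.Analysis"
begin

(* C^k on an open set S, through iterated directional derivatives; k = 0 is continuity *)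
primrec Ck_on :: "nat \<Rightarrow> 'a::real_normed_vector set \<Rightarrow> ('a \<Rightarrow> 'b::real_normed_vector) \<Rightarrow> bool" where
  "Ck_on 0 S g \<longleftrightarrow> continuous_on S g"
| "Ck_on (Suc k) S g \<longleftrightarrow> (\<forall>x\<in>S. g differentiable at x) \<and>
     (\<forall>v. Ck_on k S (\<lambda>x. frechet_derivative g (at x) v))"

definition smooth_on :: "'a::real_normed_vector set \<Rightarrow> ('a \<Rightarrow> 'b::real_normed_vector) \<Rightarrow> bool" where
  "smooth_on S g \<longleftrightarrow> (\<forall>k. Ck_on k S g)"

definition diffeomorphic_on :: "'a::real_normed_vector set \<Rightarrow> ('a \<Rightarrow> 'b::real_normed_vector) \<Rightarrow> bool" where
  "diffeomorphic_on W g \<longleftrightarrow> open W \<and> open (g ` W) \<and> inj_on g W \<and>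
     smooth_on W g \<and> smooth_on (g ` W) (the_inv_into W g)"

(* v^T g_{VV}(V) w *)
definition hessian :: "('a::real_normed_vector \<Rightarrow> real) \<Rightarrow> 'a \<Rightarrow> 'a \<Rightarrow> 'a \<Rightarrow> real" where
  "hessian g V v w = frechet_derivative (\<lambda>X. frechet_derivative g (at X) v) (at V) w"

definition uniformly_convex_on :: "'a::real_normed_vector set \<Rightarrow> ('a \<Rightarrow> real) \<Rightarrow> bool" where
  "uniformly_convex_on S g \<longleftrightarrow> (\<exists>c>0. \<forall>V\<in>S. \<forall>w. c * (norm w)\<^sup>2 \<le> hessian g V w w)"

definition entropy_flux_pair ::
  "(real^'m) set \<Rightarrow> (real^'m \<Rightarrow> real^'m) \<Rightarrow> (real^'m \<Rightarrow> real^'m) \<Rightarrow>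
   (real^'m \<Rightarrow> real) \<Rightarrow> (real^'m \<Rightarrow> real) \<Rightarrow> (real^'m \<Rightarrow> real) \<Rightarrow> bool" where
  "entropy_flux_pair D fx fy \<eta> \<psi>x \<psi>y \<longleftrightarrow>
     smooth_on D \<eta> \<and> smooth_on D \<psi>x \<and> smooth_on D \<psi>y \<and>
     (\<forall>U\<in>D. \<forall>v.
        frechet_derivative \<psi>x (at U) v
          = frechet_derivative \<eta> (at U) (frechet_derivative fx (at U) v) \<and>
        frechet_derivative \<psi>y (at U) v
          = frechet_derivative \<eta> (at U) (frechet_derivative fy (at U) v))"

definition real_eigenvalues :: "real^'m^'m \<Rightarrow> real set" where
  "real_eigenvalues A = {l. \<exists>v. v \<noteq> 0 \<and> A *v v = l *\<^sub>R v}"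

(* the k-th smallest real eigenvalue, k = 1, ..., m *)
definition eigenvalue_nth :: "real^'m^'m \<Rightarrow> nat \<Rightarrow> real" where
  "eigenvalue_nth A k = sorted_list_of_set (real_eigenvalues A) ! (k - 1)"

definition A_hat :: "(real^'m \<Rightarrow> real^'m) \<Rightarrow> real^'m \<Rightarrow> real^'m \<Rightarrow> real^'m^'m" where
  "A_hat f Vp Vm = integral {0..1} (\<lambda>s. jacobian f (at ((1 - s) *\<^sub>R Vm + s *\<^sub>R Vp)))"

definition lambda_hat :: "(real^'m \<Rightarrow> real^'m) \<Rightarrow> nat \<Rightarrow> real^'m \<Rightarrow> real^'m \<Rightarrow> real" where
  "lambda_hat f \<alpha> Vp Vm = eigenvalue_nth (A_hat f Vp Vm) \<alpha>"

definition lambda :: "(real^'m \<Rightarrow> real^'m) \<Rightarrow> nat \<Rightarrow> real^'m \<Rightarrow> real" where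
  "lambda f \<alpha> V = lambda_hat f \<alpha> V V"

definition strictly_hyperbolic_at :: "(real^'m \<Rightarrow> real^'m) \<Rightarrow> real^'m \<Rightarrow> bool" where
  "strictly_hyperbolic_at f V \<longleftrightarrow> card (real_eigenvalues (jacobian f (at V))) = CARD('m)"

definition unit_eigenvector_fields ::
  "(real^'m \<Rightarrow> real^'m) \<Rightarrow> real^'m \<Rightarrow> (nat \<Rightarrow> real^'m \<Rightarrow> real^'m) \<Rightarrow> bool" where
  "unit_eigenvector_fields f Vbar r \<longleftrightarrow>
     (\<exists>\<rho>>0. \<forall>\<alpha>\<in>{1..CARD('m)}. smooth_on (ball Vbar \<rho>) (r \<alpha>) \<and>
        (\<forall>V\<in>ball Vbar \<rho>. norm (r \<alpha> V) = 1 \<and>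
           jacobian f (at V) *v r \<alpha> V = lambda f \<alpha> V *\<^sub>R r \<alpha> V))"

(* For xi1 > xi2 the equation is the one for the swapped pair multiplied by -1. The side tau
   of the half-plane enters only the entropy inequality. *)
definition weak_solution ::
  "(real^'m \<Rightarrow> real^'m) \<Rightarrow> real^'m \<Rightarrow> real \<Rightarrow> (real \<Rightarrow> real^'m) \<Rightarrow> bool" where
  "weak_solution f Vbar \<epsilon> V \<longleftrightarrow>
     V \<in> borel_measurable lebesgue \<and> (\<forall>\<xi>. V \<xi> \<in> cball Vbar \<epsilon>) \<and>
     (\<forall>\<xi>1 \<xi>2. \<xi>1 \<le> \<xi>2 \<longrightarrow>
        f (V \<xi>2) - \<xi>2 *\<^sub>R V \<xi>2 - f (V \<xi>1) + \<xi>1 *\<^sub>R V \<xi>1 = - integral {\<xi>1..\<xi>2} V)"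

definition admissible ::
  "(real^'m \<Rightarrow> real^'m) \<Rightarrow> (real^'m \<Rightarrow> real) \<Rightarrow> (real^'m \<Rightarrow> real) \<Rightarrow> real^'m \<Rightarrow> real \<Rightarrow> real \<Rightarrow>
   (real \<Rightarrow> real^'m) \<Rightarrow> bool" where
  "admissible f e q Vbar \<epsilon> \<tau> V \<longleftrightarrow> weak_solution f Vbar \<epsilon> V \<and>
     (\<forall>\<xi>1 \<xi>2. \<xi>1 < \<xi>2 \<longrightarrow>
        \<tau> * ((q (V \<xi>2) - \<xi>2 * e (V \<xi>2)) - (q (V \<xi>1) - \<xi>1 * e (V \<xi>1)))
          \<le> - \<tau> * integral {\<xi>1..\<xi>2} (\<lambda>\<xi>. e (V \<xi>)))"

definition sector ::
  "(real^'m \<Rightarrow> real^'m) \<Rightarrow> real^'m \<Rightarrow> (real \<Rightarrow> nat \<Rightarrow> real) \<Rightarrow> real \<Rightarrow> nat \<Rightarrow> real set" where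
  "sector f Vbar \<delta> \<epsilon> \<alpha> = {lambda f \<alpha> Vbar - \<delta> \<epsilon> \<alpha> <..< lambda f \<alpha> Vbar + \<delta> \<epsilon> \<alpha>}"

definition sector_widths ::
  "(real^'m \<Rightarrow> real^'m) \<Rightarrow> real^'m \<Rightarrow> (real \<Rightarrow> nat \<Rightarrow> real) \<Rightarrow> bool" where
  "sector_widths f Vbar \<delta> \<longleftrightarrow>
     (\<forall>\<alpha>\<in>{1..CARD('m)}. ((\<lambda>\<epsilon>. \<delta> \<epsilon> \<alpha>) \<longlongrightarrow> 0) (at_right 0)) \<and>
     (\<exists>\<epsilon>1>0.
        (\<forall>\<alpha>\<in>{1..CARD('m)}. mono_on {0<..<\<epsilon>1} (\<lambda>\<epsilon>. \<delta> \<epsilon> \<alpha>)) \<and>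
        (\<forall>\<epsilon>\<in>{0<..<\<epsilon>1}.
           (\<forall>\<alpha>\<in>{1..CARD('m)}. 0 < \<delta> \<epsilon> \<alpha> \<and>
              (\<forall>Vp\<in>cball Vbar \<epsilon>. \<forall>Vm\<in>cball Vbar \<epsilon>.
                 lambda_hat f \<alpha> Vp Vm \<in> sector f Vbar \<delta> \<epsilon> \<alpha>)) \<and>
           disjoint_family_on (\<lambda>\<alpha>. closure (sector f Vbar \<delta> \<epsilon> \<alpha>)) {1..CARD('m)} \<and>
           (\<forall>V. weak_solution f Vbar \<epsilon> V \<longrightarrow>
              (\<forall>C\<in>components (UNIV - (\<Union>\<alpha>\<in>{1..CARD('m)}. sector f Vbar \<delta> \<epsilon> \<alpha>)).
                 V constant_on C))))"

(* s fixes the sign of the eigenvector field *)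
definition genuinely_nonlinear ::
  "(real^'m \<Rightarrow> real^'m) \<Rightarrow> (nat \<Rightarrow> real^'m \<Rightarrow> real^'m) \<Rightarrow> real^'m \<Rightarrow> real \<Rightarrow> nat \<Rightarrow> bool" where
  "genuinely_nonlinear f r Vbar \<epsilon> \<alpha> \<longleftrightarrow>
     (\<exists>s\<in>{1, -1}. \<forall>V\<in>cball Vbar \<epsilon>.
        0 < frechet_derivative (lambda f \<alpha>) (at V) (s *\<^sub>R r \<alpha> V))"

definition backward_sector ::
  "(real^'m \<Rightarrow> real) \<Rightarrow> (nat \<Rightarrow> real^'m \<Rightarrow> real^'m) \<Rightarrow> real^'m \<Rightarrow> real \<Rightarrow> real \<Rightarrow> nat \<Rightarrow> bool" where
  "backward_sector e r Vbar \<epsilon> \<tau> \<alpha> \<longleftrightarrow>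
     (\<forall>V\<in>cball Vbar \<epsilon>. \<tau> * hessian e V (r \<alpha> V) (r \<alpha> V) < 0)"

definition jump_set :: "(real \<Rightarrow> 'b::real_normed_vector) \<Rightarrow> real set \<Rightarrow> real set" where
  "jump_set V I = {\<xi>\<in>I. \<not> isCont V \<xi>}"

definition jump :: "(real \<Rightarrow> 'b::real_normed_vector) \<Rightarrow> real \<Rightarrow> 'b" where
  "jump V \<xi> = Lim (at_right \<xi>) V - Lim (at_left \<xi>) V"

definition right_modification ::
  "(real \<Rightarrow> 'b::real_normed_vector) \<Rightarrow> real set \<Rightarrow> real \<Rightarrow> 'b" where
  "right_modification V S \<xi> = (if \<xi> \<in> S then Lim (at_right \<xi>) V else V \<xi>)"

definition saltus :: "(real \<Rightarrow> 'b::real_normed_vector) \<Rightarrow> real set \<Rightarrow> real \<Rightarrow> 'b" where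
  "saltus V S \<xi> = infsum (jump V) {x\<in>S. x \<le> \<xi>}"

(* what makes right_modification and saltus meaningful, since Lim and infsum are total *)
definition saltus_well_defined :: "(real \<Rightarrow> 'b::real_normed_vector) \<Rightarrow> real set \<Rightarrow> bool" where
  "saltus_well_defined V S \<longleftrightarrow> discrete S \<and>
     (\<forall>\<xi>\<in>S. (\<exists>l. (V \<longlongrightarrow> l) (at_right \<xi>)) \<and> (\<exists>l. (V \<longlongrightarrow> l) (at_left \<xi>))) \<and>
     (\<lambda>\<xi>. norm (jump V \<xi>)) summable_on S"

definition bounded_variation_on :: "real set \<Rightarrow> (real \<Rightarrow> 'b::real_normed_vector) \<Rightarrow> bool" where
  "bounded_variation_on T V \<longleftrightarrow>
     (\<exists>M. \<forall>n t. (\<forall>i\<le>n. t i \<in> T) \<and> mono_on {..n} t \<longrightarrow>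
        (\<Sum>i<n. norm (V (t (Suc i)) - V (t i))) \<le> M)"

(* Waves of the other families (e.g. shocks in forward sectors) lie in the other sectors and are
   not recorded by the saltus part belonging to I^alpha. So regularity of V and of its remainder
   is a statement about the rest of the real line: it contains I^alpha, and is all of R if m = 1. *)
definition off_other_sectors ::
  "(real^'m \<Rightarrow> real^'m) \<Rightarrow> real^'m \<Rightarrow> (real \<Rightarrow> nat \<Rightarrow> real) \<Rightarrow> real \<Rightarrow> nat \<Rightarrow> real set" where
  "off_other_sectors f Vbar \<delta> \<epsilon> \<alpha>
     = UNIV - (\<Union>\<beta>\<in>{1..CARD('m)} - {\<alpha>}. sector f Vbar \<delta> \<epsilon> \<beta>)"

end

theory Submission
  imports Defs
begin

text \<open>
  The mechanism is already visible for one scalar unknown that is its own characteristic speed. In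
  a backward sector the entropy condition lets such a solution jump only upwards, from a value
  below \<open>\<xi>\<close> to a value above \<open>\<xi>\<close>. Away from jumps the solution can vary only where its speed equals
  \<open>\<xi>\<close>. So after a jump it stays constant until \<open>\<xi>\<close> has caught up with the new, larger speed, which
  takes a length comparable to the height of the jump. These intervals of constancy are disjoint.
  Therefore the jumps are isolated and absolutely summable, and the jumps to the left of a point at
  which the speed equals \<open>\<xi>\<close>, back to any earlier point, add up to at most a multiple of the length
  in between. After subtracting the jumps, a function remains that is locally constant where the
  speed differs from \<open>\<xi>\<close>, and Lipschitz on the set where the two agree. Such a function is Lipschitz.

  For a system the same argument works with the speed \<open>\<lambda>(V)\<close> of the family in question, given three
  facts about states near \<open>Vbar\<close> and \<open>\<xi>\<close> near \<open>\<lambda>(Vbar)\<close>.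

  \<^item> An increment of \<open>V\<close> is controlled by the increments of \<open>\<lambda>(V)\<close> and of \<open>f(V) - \<xi> V\<close>
    (\<open>secant_controlled_by_speed\<close>). The second increment controls the component transversal to the
    eigenvector \<open>r\<close>, as \<open>\<lambda>(Vbar)\<close> is a simple eigenvalue; the first one controls the component along
    \<open>r\<close>, by genuine nonlinearity.

  \<^item> Where \<open>\<lambda>(V)\<close> differs from \<open>\<xi>\<close>, the matrix \<open>f\<^sub>V(V) - \<xi>\<close> is invertible, and the integral equation
    forces \<open>V\<close> to be locally constant (\<open>constant_where_noncharacteristic\<close>).

  \<^item> An entropic jump from \<open>X\<close> to \<open>Y\<close> at \<open>\<xi>\<close> satisfies \<open>\<lambda>(X) < \<xi> < \<lambda>(Y)\<close>, with both differences at
    least a fixed multiple of \<open>|Y - X|\<close> (\<open>backward_shock_expansive\<close>). For a jump of signed strength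
    \<open>s\<close> along \<open>r\<close> the entropy production is \<open>(r\<^sup>T e\<^sub>V\<^sub>V r) (\<lambda>\<^sub>V r) s^3 / 12\<close> to leading order, so that its
    sign decides the sign of \<open>s\<close>. The row vector \<open>r\<^sup>T e\<^sub>V\<^sub>V\<close> is a left eigenvector of \<open>f\<^sub>V\<close>, because
    \<open>e\<^sub>V\<^sub>V f\<^sub>V\<close> is symmetric, and it carries the jump condition over to the speed \<open>\<lambda>\<close>.

  These facts are proved in the locale \<open>nonlinear_characteristic_field\<close> from expansions at \<open>Vbar\<close>
  whose relative errors are below a fixed small \<open>\<kappa>\<close>, and used in the locale \<open>compressive_sector\<close>.
  One-sided limits of the merely measurable \<open>V\<close> exist because two different cluster values at one
  side of \<open>\<xi>\<close> would be joined by entropic jumps in both directions. On the whole line, \<open>V\<close> is constant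
  off the sectors, and the components of the set under consideration are a positive distance apart.
\<close>

section \<open>Smooth maps and expansions to second order\<close>

lemma Ck_on_subset: "Ck_on k S g \<Longrightarrow> T \<subseteq> S \<Longrightarrow> Ck_on k T g"
proof (induction k arbitrary: g)
  case 0
  then show ?case by (auto intro: continuous_on_subset)
next
  case (Suc k)
  then show ?case by auto
qed

lemma Ck_on_cong_open:
  assumes "open S" and "\<And>x. x \<in> S \<Longrightarrow> g x = h x" and "Ck_on k S g"
  shows "Ck_on k S h"
  using assms(2,3)
proof (induction k arbitrary: g h)
  case 0
  then show ?case by (metis Ck_on.simps(1) continuous_on_cong)
next
  case (Suc k)
  have der: "(h has_derivative frechet_derivative g (at x)) (at x)" if "x \<in> S" for x
    using Suc.prems that \<open>open S\<close>
    by (metis Ck_on.simps(2) frechet_derivative_works has_derivative_transform_within_open)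
  have "frechet_derivative h (at x) = frechet_derivative g (at x)" if "x \<in> S" for x
    using der[OF that] frechet_derivative_at by metis
  then have "Ck_on k S (\<lambda>x. frechet_derivative h (at x) v)" for v
    using Suc.IH[of "\<lambda>x. frechet_derivative g (at x) v" "\<lambda>x. frechet_derivative h (at x) v"] Suc.prems
    by simp
  moreover have "h differentiable at x" if "x \<in> S" for x
    using der[OF that] differentiable_def by blast
  ultimately show ?case by simp
qed

lemma Ck_on_Suc_imp: "Ck_on (Suc k) S g \<Longrightarrow> Ck_on k S g"
proof (induction k arbitrary: g)
  case 0
  then show ?case
    by (auto intro!: continuous_at_imp_continuous_on differentiable_imp_continuous_within)
next
  case (Suc k)
  then show ?case by (metis Ck_on.simps(2))
qed

lemma smooth_on_imp_differentiable: "smooth_on S g \<Longrightarrow> x \<in> S \<Longrightarrow> g differentiable at x"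
  unfolding smooth_on_def by (metis Ck_on.simps(2))

lemma smooth_on_has_derivative:
  "smooth_on S g \<Longrightarrow> x \<in> S \<Longrightarrow> (g has_derivative frechet_derivative g (at x)) (at x)"
  using smooth_on_imp_differentiable frechet_derivative_works by blast

lemma smooth_on_directional_derivative:
  "smooth_on S g \<Longrightarrow> smooth_on S (\<lambda>x. frechet_derivative g (at x) v)"
  unfolding smooth_on_def by (metis Ck_on.simps(2))

lemma smooth_on_continuous_on: "smooth_on S g \<Longrightarrow> continuous_on S g"
  unfolding smooth_on_def by (metis Ck_on.simps(1))

lemma smooth_on_subset: "smooth_on S g \<Longrightarrow> T \<subseteq> S \<Longrightarrow> smooth_on T g"
  unfolding smooth_on_def using Ck_on_subset by blast

lemma smooth_on_cong_open:
  "smooth_on S g \<Longrightarrow> open S \<Longrightarrow> (\<And>x. x \<in> S \<Longrightarrow> g x = h x) \<Longrightarrow> smooth_on S h"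
  unfolding smooth_on_def using Ck_on_cong_open by metis

lemma Ck_on_const: "Ck_on k S (\<lambda>x. c)"
  by (induction k arbitrary: c) (auto simp: frechet_derivative_const)

lemma Ck_on_add:
  assumes "open S"
  shows "Ck_on k S g \<Longrightarrow> Ck_on k S h \<Longrightarrow> Ck_on k S (\<lambda>x. g x + h x)"
proof (induction k arbitrary: g h)
  case 0
  then show ?case by (auto intro: continuous_intros)
next
  case (Suc k)
  have "frechet_derivative (\<lambda>x. g x + h x) (at x) v
      = frechet_derivative g (at x) v + frechet_derivative h (at x) v" if "x \<in> S" for x v
  proof -
    have "((\<lambda>x. g x + h x) has_derivative
        (\<lambda>v. frechet_derivative g (at x) v + frechet_derivative h (at x) v)) (at x)"
      using Suc.prems that by (intro has_derivative_add) (auto simp: frechet_derivative_works[symmetric])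
    then show ?thesis by (metis frechet_derivative_at)
  qed
  then have "Ck_on k S (\<lambda>x. frechet_derivative (\<lambda>x. g x + h x) (at x) v)" for v
    using Suc Ck_on_cong_open[OF assms, of "\<lambda>x. frechet_derivative g (at x) v + frechet_derivative h (at x) v"]
    by simp
  then show ?case using Suc.prems by auto
qed

lemma Ck_on_sum:
  assumes "open S" and "\<And>i. i \<in> I \<Longrightarrow> Ck_on k S (g i)"
  shows "Ck_on k S (\<lambda>x. \<Sum>i\<in>I. g i x)"
  using assms(2)
  by (induction I rule: infinite_finite_induct) (auto intro: Ck_on_const Ck_on_add[OF assms(1)])

lemma Ck_on_bilinear:
  assumes bil: "bounded_bilinear bil" and "open S"
  shows "Ck_on k S g \<Longrightarrow> Ck_on k S h \<Longrightarrow> Ck_on k S (\<lambda>x. bil (g x) (h x))"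
proof (induction k arbitrary: g h)
  case 0
  then show ?case by (auto intro: bounded_bilinear.continuous_on[OF bil])
next
  case (Suc k)
  have "frechet_derivative (\<lambda>x. bil (g x) (h x)) (at x) v
      = bil (g x) (frechet_derivative h (at x) v) + bil (frechet_derivative g (at x) v) (h x)"
    if "x \<in> S" for x v
  proof -
    have "((\<lambda>x. bil (g x) (h x)) has_derivative
        (\<lambda>v. bil (g x) (frechet_derivative h (at x) v) + bil (frechet_derivative g (at x) v) (h x))) (at x)"
      using Suc.prems that by (intro bounded_bilinear.FDERIV[OF bil]) (auto simp: frechet_derivative_works[symmetric])
    then show ?thesis by (metis frechet_derivative_at)
  qed
  moreover have "Ck_on k S (\<lambda>x. bil (g x) (frechet_derivative h (at x) v)
      + bil (frechet_derivative g (at x) v) (h x))" for v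
    using Suc.prems Ck_on_Suc_imp[OF Suc.prems(1)] Ck_on_Suc_imp[OF Suc.prems(2)]
    by (intro Ck_on_add assms(2) Suc.IH) simp_all
  ultimately have "Ck_on k S (\<lambda>x. frechet_derivative (\<lambda>x. bil (g x) (h x)) (at x) v)" for v
    using Ck_on_cong_open[OF assms(2), of "\<lambda>x. bil (g x) (frechet_derivative h (at x) v)
      + bil (frechet_derivative g (at x) v) (h x)"] by simp
  moreover have "(\<lambda>x. bil (g x) (h x)) differentiable at x" if "x \<in> S" for x
    using Suc.prems that unfolding differentiable_def by (metis Ck_on.simps(2) bounded_bilinear.FDERIV[OF bil] differentiable_def)
  ultimately show ?case by simp
qed

lemma linear_euclidean_representation:
  fixes L :: "'a::euclidean_space \<Rightarrow> 'b::real_vector"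
  assumes "linear L"
  shows "L x = (\<Sum>b\<in>Basis. (x \<bullet> b) *\<^sub>R L b)"
  by (metis (no_types, lifting) assms euclidean_representation linear_sum linear_cmul sum.cong)

lemma Ck_on_linear:
  assumes "bounded_linear L" and "open S" and "Ck_on k S g"
  shows "Ck_on k S (\<lambda>x. L (g x))"
  using assms(3)
proof (induction k arbitrary: g)
  case 0
  then show ?case using bounded_linear.continuous_on[OF assms(1)] by auto
next
  case (Suc k)
  have der: "((\<lambda>x. L (g x)) has_derivative (\<lambda>v. L (frechet_derivative g (at x) v))) (at x)"
    if "x \<in> S" for x
    using Suc.prems that
    by (intro bounded_linear.has_derivative[OF assms(1)]) (auto simp: frechet_derivative_works[symmetric])
  have "frechet_derivative (\<lambda>x. L (g x)) (at x) v = L (frechet_derivative g (at x) v)"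
    if "x \<in> S" for x v
    using der[OF that] by (metis frechet_derivative_at)
  then have "Ck_on k S (\<lambda>x. frechet_derivative (\<lambda>x. L (g x)) (at x) v)" for v
    using Suc Ck_on_cong_open[OF assms(2), of "\<lambda>x. L (frechet_derivative g (at x) v)"] by simp
  moreover have "(\<lambda>x. L (g x)) differentiable at x" if "x \<in> S" for x
    using der[OF that] by (rule differentiableI)
  ultimately show ?case by simp
qed

text \<open>
  By the chain rule a directional derivative of the composition is the sum, over a basis, of
  coordinates of the derivative of \<open>g\<close> times directional derivatives of \<open>h\<close> composed with \<open>g\<close>. The
  induction hypothesis covers the latter; this is why the induction leaves \<open>h\<close> arbitrary.
\<close>

lemma Ck_on_compose:
  fixes g :: "'a::real_normed_vector \<Rightarrow> 'b::euclidean_space"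
    and h :: "'b \<Rightarrow> 'c::real_normed_vector"
  assumes "open S" and "open T" and "g ` S \<subseteq> T"
  shows "Ck_on k S g \<Longrightarrow> Ck_on k T h \<Longrightarrow> Ck_on k S (h \<circ> g)"
proof (induction k arbitrary: h)
  case 0
  then show ?case by (metis Ck_on.simps(1) assms(3) continuous_on_compose continuous_on_subset)
next
  case (Suc k)
  have der: "((h \<circ> g) has_derivative
      (frechet_derivative h (at (g x)) \<circ> frechet_derivative g (at x))) (at x)" if "x \<in> S" for x
    using Suc.prems that assms(3)
    by (intro diff_chain_at) (auto simp: frechet_derivative_works[symmetric])
  have "frechet_derivative (h \<circ> g) (at x) v = (\<Sum>b\<in>Basis.
      (frechet_derivative g (at x) v \<bullet> b) *\<^sub>R ((\<lambda>y. frechet_derivative h (at y) b) \<circ> g) x)"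
    if "x \<in> S" for x v
  proof -
    have "linear (frechet_derivative h (at (g x)))"
      using Suc.prems that assms(3)
      by (intro linear_frechet_derivative) auto
    then show ?thesis
      using linear_euclidean_representation[of "frechet_derivative h (at (g x))"
          "frechet_derivative g (at x) v"]
        fun_cong[OF frechet_derivative_at[OF der[OF that]], of v] by simp
  qed
  moreover have "Ck_on k S (\<lambda>x. \<Sum>b\<in>Basis.
      (frechet_derivative g (at x) v \<bullet> b) *\<^sub>R ((\<lambda>y. frechet_derivative h (at y) b) \<circ> g) x)" for v
    using Suc
    by (intro Ck_on_sum Ck_on_bilinear[OF bounded_bilinear_scaleR] assms(1)
        Suc.IH Ck_on_linear[OF bounded_linear_inner_left])
      (auto intro: Ck_on_Suc_imp)
  ultimately have "Ck_on k S (\<lambda>x. frechet_derivative (h \<circ> g) (at x) v)" for v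
    using Ck_on_cong_open[OF assms(1), of "\<lambda>x. \<Sum>b\<in>Basis.
      (frechet_derivative g (at x) v \<bullet> b) *\<^sub>R ((\<lambda>y. frechet_derivative h (at y) b) \<circ> g) x"] by simp
  moreover have "(h \<circ> g) differentiable at x" if "x \<in> S" for x
    using der[OF that] by (rule differentiableI)
  ultimately show ?case by (simp only: Ck_on.simps) blast
qed

lemma smooth_on_compose:
  fixes g :: "'a::real_normed_vector \<Rightarrow> 'b::euclidean_space"
  assumes "open S" and "open T" and "g ` S \<subseteq> T" and "smooth_on S g" and "smooth_on T h"
  shows "smooth_on S (h \<circ> g)"
  using assms Ck_on_compose unfolding smooth_on_def by blast

lemma smooth_on_inner:
  fixes g h :: "'a::real_normed_vector \<Rightarrow> 'b::real_inner"
  assumes "open S" and "smooth_on S g" and "smooth_on S h"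
  shows "smooth_on S (\<lambda>x. g x \<bullet> h x)"
  using assms Ck_on_bilinear[OF bounded_bilinear_inner]
  unfolding smooth_on_def by blast

text \<open>
  Smoothness is formulated with fixed directions. Expanding the moving direction in the basis
  reduces to those.
\<close>

lemma smooth_on_derivative_along:
  fixes g :: "'a::euclidean_space \<Rightarrow> 'b::real_normed_vector"
  assumes "open S" and "smooth_on S g" and "smooth_on S v"
  shows "smooth_on S (\<lambda>x. frechet_derivative g (at x) (v x))"
proof -
  have "Ck_on k S g" "Ck_on k S v" "Ck_on k S (\<lambda>x. frechet_derivative g (at x) b)" for k b
    using assms(2,3) smooth_on_directional_derivative[OF assms(2), of b]
    by (simp_all add: smooth_on_def)
  then have "Ck_on k S (\<lambda>x. (v x \<bullet> b) *\<^sub>R frechet_derivative g (at x) b)" for k b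
    using Ck_on_bilinear[OF bounded_bilinear_scaleR assms(1)]
      Ck_on_linear[OF bounded_linear_inner_left assms(1)] by blast
  then have "smooth_on S (\<lambda>x. \<Sum>b\<in>Basis. (v x \<bullet> b) *\<^sub>R frechet_derivative g (at x) b)"
    unfolding smooth_on_def by (intro allI Ck_on_sum assms(1))
  then show ?thesis
    by (rule smooth_on_cong_open[OF _ assms(1)])
      (metis assms(2) linear_euclidean_representation linear_frechet_derivative
        smooth_on_imp_differentiable)
qed

lemma eventually_nhds_imp_eventually_cball:
  assumes "\<forall>\<^sub>F x in nhds x0. Q x"
  shows "\<forall>\<^sub>F \<epsilon> in at_right 0. \<forall>x\<in>cball (x0::'a::metric_space) \<epsilon>. Q x"
proof -
  obtain d where d: "d > 0" "\<And>x. dist x x0 < d \<Longrightarrow> Q x"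
    using assms unfolding eventually_nhds_metric by blast
  show ?thesis
    unfolding eventually_at_right_field
    by (intro exI[of _ d]) (use d in \<open>auto simp: dist_commute\<close>)
qed

text \<open>
  In finite dimension it suffices to control the finitely many basis vectors.
\<close>

lemma linear_family_continuous:
  fixes F :: "'a::metric_space \<Rightarrow> 'b::euclidean_space \<Rightarrow> 'c::real_normed_vector"
  assumes "open S" and "x0 \<in> S" and lin: "\<And>x. x \<in> S \<Longrightarrow> linear (F x)"
    and cont: "\<And>b. continuous_on S (\<lambda>x. F x b)" and "\<kappa> > 0"
  shows "\<forall>\<^sub>F x in nhds x0. \<forall>u. norm (F x u - F x0 u) \<le> \<kappa> * norm u"
proof -
  define \<kappa>' where "\<kappa>' = \<kappa> / DIM('b)"
  have \<kappa>': "\<kappa>' > 0" using assms(5) by (simp add: \<kappa>'_def)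
  have "\<forall>\<^sub>F x in nhds x0. norm (F x b - F x0 b) \<le> \<kappa>'" for b
  proof -
    have "isCont (\<lambda>x. F x b) x0"
      using cont assms(1,2) by (metis continuous_on_eq_continuous_at)
    then have "\<forall>\<^sub>F x in nhds x0. dist (F x b) (F x0 b) < \<kappa>'"
      using \<kappa>' tendsto_at_iff_tendsto_nhds[of "\<lambda>x. F x b" x0]
      by (simp add: isCont_def tendsto_iff)
    then show ?thesis by eventually_elim (simp add: dist_norm)
  qed
  then have "\<forall>\<^sub>F x in nhds x0. \<forall>b\<in>Basis. norm (F x b - F x0 b) \<le> \<kappa>'"
    by (intro eventually_ball_finite) auto
  moreover have "\<forall>\<^sub>F x in nhds x0. x \<in> S"
    using assms by (simp add: eventually_nhds_in_open)
  ultimately show ?thesis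
  proof eventually_elim
    case (elim x)
    show ?case
    proof
      fix u :: 'b
      have "linear (\<lambda>u. F x u - F x0 u)"
        using elim assms(2) lin by (intro linear_compose_sub) blast+
      then have "norm (F x u - F x0 u) = norm (\<Sum>b\<in>Basis. (u \<bullet> b) *\<^sub>R (F x b - F x0 b))"
        using linear_euclidean_representation[of "\<lambda>u. F x u - F x0 u" u] by simp
      also have "\<dots> \<le> (\<Sum>b\<in>(Basis::'b set). norm u * \<kappa>')"
        using elim by (intro sum_norm_le) (auto intro!: mult_mono Basis_le_norm)
      also have "\<dots> = \<kappa> * norm u" by (simp add: \<kappa>'_def)
      finally show "norm (F x u - F x0 u) \<le> \<kappa> * norm u" .
    qed
  qed
qed

lemma derivative_continuous_norm:
  fixes g :: "'a::euclidean_space \<Rightarrow> 'b::real_normed_vector"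
  assumes "open S" and "smooth_on S g" and "x0 \<in> S" and "\<kappa> > 0"
  shows "\<forall>\<^sub>F x in nhds x0. \<forall>u. norm (frechet_derivative g (at x) u - frechet_derivative g (at x0) u)
    \<le> \<kappa> * norm u"
proof (rule linear_family_continuous[OF assms(1,3) _ _ assms(4)])
  show "linear (frechet_derivative g (at x))" if "x \<in> S" for x
    using that assms(2) smooth_on_imp_differentiable linear_frechet_derivative by blast
  show "continuous_on S (\<lambda>x. frechet_derivative g (at x) b)" for b
    by (rule smooth_on_continuous_on[OF smooth_on_directional_derivative[OF assms(2)]])
qed

text \<open>
  The derivative of \<open>g\<close> minus its linearisation at \<open>x0\<close> is small near \<open>x0\<close>, and balls are convex.
  All later estimates compare two arbitrary nearby states, neither of which is \<open>x0\<close>.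
\<close>

lemma strictly_differentiable:
  fixes g :: "'a::euclidean_space \<Rightarrow> 'b::real_normed_vector"
  assumes "open S" and "smooth_on S g" and "x0 \<in> S" and "\<kappa> > 0"
  shows "\<forall>\<^sub>F \<epsilon> in at_right 0. \<forall>x\<in>cball x0 \<epsilon>. \<forall>y\<in>cball x0 \<epsilon>.
    norm (g y - g x - frechet_derivative g (at x0) (y - x)) \<le> \<kappa> * norm (y - x)"
proof -
  let ?D = "\<lambda>x. frechet_derivative g (at x)"
  have "\<forall>\<^sub>F x in nhds x0. x \<in> S \<and> (\<forall>u. norm (?D x u - ?D x0 u) \<le> \<kappa> * norm u)"
    using derivative_continuous_norm[OF assms] assms
    by (intro eventually_conj) (simp_all add: eventually_nhds_in_open)
  then obtain d where d: "d > 0"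
      "\<And>x. dist x x0 < d \<Longrightarrow> x \<in> S \<and> (\<forall>u. norm (?D x u - ?D x0 u) \<le> \<kappa> * norm u)"
    unfolding eventually_nhds_metric by blast
  show ?thesis
    unfolding eventually_at_right_field
  proof (intro exI[of _ d] conjI allI impI ballI)
    fix \<epsilon> x y assume "0 < \<epsilon>" "\<epsilon> < d" and xy: "x \<in> cball x0 \<epsilon>" "y \<in> cball x0 \<epsilon>"
    have in_d: "dist z x0 < d" if "z \<in> cball x0 \<epsilon>" for z
      using that \<open>\<epsilon> < d\<close> by (simp add: dist_commute)
    have lin: "bounded_linear (?D x0)"
      using assms smooth_on_has_derivative has_derivative_bounded_linear by blast
    have der: "((\<lambda>x. g x - ?D x0 x) has_derivative (\<lambda>u. ?D z u - ?D x0 u)) (at z within cball x0 \<epsilon>)"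
      if "z \<in> cball x0 \<epsilon>" for z
      using d(2)[OF in_d[OF that]] assms(2)
      by (intro has_derivative_diff has_derivative_at_withinI[OF smooth_on_has_derivative]
          bounded_linear_imp_has_derivative[OF lin]) auto
    have "norm ((g y - ?D x0 y) - (g x - ?D x0 x)) \<le> \<kappa> * norm (y - x)"
    proof (rule differentiable_bound[OF convex_cball der _ xy(2,1)])
      show "onorm (\<lambda>u. ?D z u - ?D x0 u) \<le> \<kappa>" if "z \<in> cball x0 \<epsilon>" for z
        using d(2)[OF in_d[OF that]] assms(4) by (intro onorm_le) auto
    qed
    then show "norm (g y - g x - ?D x0 (y - x)) \<le> \<kappa> * norm (y - x)"
      by (simp add: linear_diff[OF bounded_linear.linear[OF lin]] algebra_simps)
  qed (use d in auto)
qed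

text \<open>
  A mean value estimate for curves. It stands in for the integrals along segments by which averaged
  matrices such as \<open>A_hat\<close> are defined.
\<close>

lemma increment_near_constant_derivative:
  fixes \<phi> :: "real \<Rightarrow> 'a::real_normed_vector"
  assumes "0 \<le> t"
    and der: "\<And>s. s \<in> {0..t} \<Longrightarrow> (\<phi> has_vector_derivative \<phi>' s) (at s within {0..t})"
    and bound: "\<And>s. s \<in> {0..t} \<Longrightarrow> norm (\<phi>' s - c) \<le> M"
  shows "norm (\<phi> t - \<phi> 0 - t *\<^sub>R c) \<le> t * M"
proof -
  have M: "0 \<le> M" using order_trans[OF norm_ge_zero bound[of 0]] \<open>0 \<le> t\<close> by simp
  have "norm ((\<phi> t - t *\<^sub>R c) - (\<phi> 0 - 0 *\<^sub>R c)) \<le> M * norm (t - 0)"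
  proof (rule differentiable_bound)
    show "((\<lambda>s. \<phi> s - s *\<^sub>R c) has_derivative (\<lambda>h. h *\<^sub>R (\<phi>' s - c))) (at s within {0..t})"
      if "s \<in> {0..t}" for s
      using has_vector_derivative_diff[OF der[OF that]
          has_vector_derivative_scaleR[OF DERIV_ident has_vector_derivative_const[of c]]]
      by (simp add: has_vector_derivative_def)
    show "onorm (\<lambda>h. h *\<^sub>R (\<phi>' s - c)) \<le> M" if "s \<in> {0..t}" for s
      using mult_left_mono[OF bound[OF that] abs_ge_zero]
      by (intro onorm_le) (simp add: mult.commute[of M])
  qed (use \<open>0 \<le> t\<close> in auto)
  then show ?thesis using \<open>0 \<le> t\<close> by (simp add: algebra_simps)
qed

text \<open>
  Both mixed derivatives are limits of the same second difference, divided by the square of the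
  step.
\<close>

lemma second_derivative_symmetric:
  fixes g :: "'a::euclidean_space \<Rightarrow> 'b::real_normed_vector"
  assumes "open S" and "smooth_on S g" and "x \<in> S"
  shows "frechet_derivative (\<lambda>X. frechet_derivative g (at X) u) (at x) v
    = frechet_derivative (\<lambda>X. frechet_derivative g (at X) v) (at x) u"
proof -
  let ?D2 = "\<lambda>u v. frechet_derivative (\<lambda>X. frechet_derivative g (at X) u) (at x) v"
  let ?\<Delta> = "\<lambda>t u v. g (x + t *\<^sub>R u + t *\<^sub>R v) - g (x + t *\<^sub>R u) - g (x + t *\<^sub>R v) + g x"
  have second_difference: "\<forall>\<^sub>F t in at_right 0.
      norm (?\<Delta> t u v - (t * t) *\<^sub>R ?D2 u v) \<le> t * t * (\<kappa> * norm v)" if "\<kappa> > 0" for \<kappa> u v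
  proof -
    let ?h = "\<lambda>X. frechet_derivative g (at X) u"
    have "\<forall>\<^sub>F \<epsilon> in at_right 0. cball x \<epsilon> \<subseteq> S"
      using assms(1,3) open_contains_cball[of S] unfolding eventually_at_right_field
      by (metis dual_order.strict_implies_order subset_cball subset_trans)
    moreover note strictly_differentiable[OF assms(1)
        smooth_on_directional_derivative[OF assms(2), of u] assms(3) that]
    ultimately have "\<forall>\<^sub>F \<epsilon> in at_right 0. cball x \<epsilon> \<subseteq> S \<and> (\<forall>X\<in>cball x \<epsilon>. \<forall>Y\<in>cball x \<epsilon>.
        norm (?h Y - ?h X - ?D2 u (Y - X)) \<le> \<kappa> * norm (Y - X))"
      by (rule eventually_conj)
    then obtain \<epsilon> where \<epsilon>: "\<epsilon> > 0" "cball x \<epsilon> \<subseteq> S"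
      "\<And>X Y. X \<in> cball x \<epsilon> \<Longrightarrow> Y \<in> cball x \<epsilon> \<Longrightarrow>
        norm (?h Y - ?h X - ?D2 u (Y - X)) \<le> \<kappa> * norm (Y - X)"
      unfolding eventually_at_right_field by (metis dense)
    have "norm (?\<Delta> t u v - (t * t) *\<^sub>R ?D2 u v) \<le> t * t * (\<kappa> * norm v)"
      if t: "0 < t" "t < \<epsilon> / (norm u + norm v + 1)" for t
    proof -
      have small: "t * (norm u + norm v) \<le> \<epsilon>"
      proof -
        have "t * (norm u + norm v + 1) < \<epsilon>"
          using t(2) by (simp add: pos_less_divide_eq add_nonneg_pos)
        then show ?thesis using t(1) by (simp add: algebra_simps)
      qed
      have inball: "x + s *\<^sub>R u + s' *\<^sub>R v \<in> cball x \<epsilon>" if "s \<in> {0..t}" "s' \<in> {0..t}" for s s'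
      proof -
        have "norm (s *\<^sub>R u + s' *\<^sub>R v) \<le> t * norm u + t * norm v"
          using that by (intro norm_triangle_le add_mono) (auto intro: mult_right_mono)
        then show ?thesis using small by (simp add: dist_norm algebra_simps norm_minus_commute[of _ x])
            (metis add_uminus_conv_diff minus_add_distrib norm_minus_cancel order_trans)
      qed
      have in0: "x + s *\<^sub>R u \<in> cball x \<epsilon>" if "s \<in> {0..t}" for s
        using inball[OF that, of 0] t by simp
      have "bounded_linear (?D2 u)"
        using assms smooth_on_directional_derivative smooth_on_has_derivative
          has_derivative_bounded_linear by blast
      then have lin: "?D2 u (t *\<^sub>R v) = t *\<^sub>R ?D2 u v"
        using linear_cmul bounded_linear.linear by blast
      have path: "((\<lambda>s. g (x + s *\<^sub>R u + w)) has_vector_derivative ?h (x + s *\<^sub>R u + w))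
          (at s within {0..t})" if "x + s *\<^sub>R u + w \<in> S" for s w
      proof -
        have "((\<lambda>s. x + s *\<^sub>R u + w) has_derivative (\<lambda>h. h *\<^sub>R u)) (at s within {0..t})"
          by (auto intro!: derivative_eq_intros)
        then have "((\<lambda>s. g (x + s *\<^sub>R u + w)) has_derivative
            (\<lambda>h. frechet_derivative g (at (x + s *\<^sub>R u + w)) (h *\<^sub>R u))) (at s within {0..t})"
          using has_derivative_compose smooth_on_has_derivative[OF assms(2) that] by blast
        then show ?thesis
          using smooth_on_imp_differentiable[OF assms(2) that] linear_frechet_derivative
          by (fastforce simp: has_vector_derivative_def linear_cmul)
      qed
      have "norm ((g (x + t *\<^sub>R u + t *\<^sub>R v) - g (x + t *\<^sub>R u + 0))
          - (g (x + 0 *\<^sub>R u + t *\<^sub>R v) - g (x + 0 *\<^sub>R u + 0)) - t *\<^sub>R ?D2 u (t *\<^sub>R v))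
        \<le> t * (\<kappa> * norm (t *\<^sub>R v))"
      proof (rule increment_near_constant_derivative)
        fix s assume s: "s \<in> {0..t}"
        show "((\<lambda>s. g (x + s *\<^sub>R u + t *\<^sub>R v) - g (x + s *\<^sub>R u + 0)) has_vector_derivative
            ?h (x + s *\<^sub>R u + t *\<^sub>R v) - ?h (x + s *\<^sub>R u + 0)) (at s within {0..t})"
          using s t \<epsilon>(2) inball in0 by (intro has_vector_derivative_diff path) auto
        show "norm (?h (x + s *\<^sub>R u + t *\<^sub>R v) - ?h (x + s *\<^sub>R u + 0) - ?D2 u (t *\<^sub>R v))
            \<le> \<kappa> * norm (t *\<^sub>R v)"
          using \<epsilon>(3)[OF in0[OF s] inball[OF s, of t]] t by simp
      qed (use t in simp)
      then show ?thesis using t by (simp add: lin algebra_simps)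
    qed
    then show ?thesis
      unfolding eventually_at_right_field using \<epsilon>(1)
      by (intro exI[of _ "\<epsilon> / (norm u + norm v + 1)"]) (simp add: add_nonneg_pos)
  qed
  have "norm (?D2 u v - ?D2 v u) \<le> \<kappa> * (norm u + norm v)" if "\<kappa> > 0" for \<kappa>
  proof -
    have "\<forall>\<^sub>F t in at_right (0::real). t > 0" by (simp add: eventually_at_right_less)
    then have "\<forall>\<^sub>F t in at_right 0. t > 0 \<and>
        norm (?\<Delta> t u v - (t * t) *\<^sub>R ?D2 u v) \<le> t * t * (\<kappa> * norm v) \<and>
        norm (?\<Delta> t v u - (t * t) *\<^sub>R ?D2 v u) \<le> t * t * (\<kappa> * norm u)"
      using second_difference[OF that, of u v] second_difference[OF that, of v u]
      by eventually_elim blast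
    then obtain t where t: "t > 0"
        "norm (?\<Delta> t u v - (t * t) *\<^sub>R ?D2 u v) \<le> t * t * (\<kappa> * norm v)"
        "norm (?\<Delta> t v u - (t * t) *\<^sub>R ?D2 v u) \<le> t * t * (\<kappa> * norm u)"
      using eventually_happens'[OF trivial_limit_at_right_real] by blast
    have "?\<Delta> t v u = ?\<Delta> t u v" by (simp add: algebra_simps)
    then have "(t * t) *\<^sub>R (?D2 u v - ?D2 v u)
      = (?\<Delta> t v u - (t * t) *\<^sub>R ?D2 v u) - (?\<Delta> t u v - (t * t) *\<^sub>R ?D2 u v)"
      by (simp add: algebra_simps)
    moreover have "norm ((?\<Delta> t v u - (t * t) *\<^sub>R ?D2 v u) - (?\<Delta> t u v - (t * t) *\<^sub>R ?D2 u v))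
        \<le> t * t * (\<kappa> * norm u) + t * t * (\<kappa> * norm v)"
      by (rule order_trans[OF norm_triangle_ineq4 add_mono[OF t(3,2)]])
    ultimately have "norm ((t * t) *\<^sub>R (?D2 u v - ?D2 v u))
        \<le> t * t * (\<kappa> * norm u) + t * t * (\<kappa> * norm v)"
      by (simp only:)
    then have "(t * t) * norm (?D2 u v - ?D2 v u)
        \<le> t * t * (\<kappa> * norm u) + t * t * (\<kappa> * norm v)"
      by (simp only: norm_scaleR abs_mult_self_eq abs_mult)
    also have "\<dots> = (t * t) * (\<kappa> * (norm u + norm v))" by (simp add: algebra_simps)
    finally have "(t * t) * norm (?D2 u v - ?D2 v u) \<le> (t * t) * (\<kappa> * (norm u + norm v))" .
    then show ?thesis using t(1) by (simp add: mult_le_cancel_left)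
  qed
  note small = this
  have "norm (?D2 u v - ?D2 v u) \<le> 0 + e" if "e > 0" for e
  proof -
    have pos: "norm u + norm v + 1 > 0" by (simp add: add_nonneg_pos)
    have "e / (norm u + norm v + 1) * (norm u + norm v) \<le> e / (norm u + norm v + 1) * (norm u + norm v + 1)"
      using that pos by (intro mult_left_mono) auto
    then show ?thesis using small[of "e / (norm u + norm v + 1)"] that pos by simp
  qed
  then have "norm (?D2 u v - ?D2 v u) \<le> 0" by (rule field_le_epsilon)
  then show ?thesis by simp
qed

section \<open>Weak shocks of a genuinely nonlinear field\<close>

text \<open>
  A genuinely nonlinear, simple characteristic field on a convex set \<open>P\<close> of states that is small
  compared with the nonlinearity. \<open>A\<close>, \<open>H\<close>, \<open>B\<close> and \<open>G\<close> stand for the derivative and the second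
  derivative of the flux, the Hessian of the entropy and the derivative of the speed, all taken at the
  centre, where \<open>r\<close> is the eigenvector for the eigenvalue \<open>lbar\<close>. The functional \<open>l\<close> is
  \<open>B r / (B r r)\<close>, and \<open>ell X\<close> is its analogue at \<open>X\<close>, hence a left eigenvector. \<open>M\<close> bounds all
  multilinear maps, and \<open>\<sigma> = 2 \<kappa> / k\<close> is the relative error after inverting \<open>A - lbar\<close> on the
  kernel of \<open>l\<close>.
\<close>

locale nonlinear_characteristic_field =
  fixes f :: "'a::euclidean_space \<Rightarrow> 'a" and Df :: "'a \<Rightarrow> 'a \<Rightarrow> 'a"
    and e q :: "'a \<Rightarrow> real" and De :: "'a \<Rightarrow> 'a \<Rightarrow> real"
    and ell :: "'a \<Rightarrow> 'a \<Rightarrow> real" and lam :: "'a \<Rightarrow> real" and P :: "'a set"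
    and A :: "'a \<Rightarrow> 'a" and H :: "'a \<Rightarrow> 'a \<Rightarrow> 'a" and B :: "'a \<Rightarrow> 'a \<Rightarrow> real"
    and l :: "'a \<Rightarrow> real" and r :: 'a and G :: "'a \<Rightarrow> real"
    and lbar \<beta> \<gamma> M k \<sigma> \<kappa> :: real
  assumes convex_P: "convex P"
    and f_deriv: "X \<in> P \<Longrightarrow> (f has_derivative Df X) (at X within P)"
    and e_deriv: "X \<in> P \<Longrightarrow> (e has_derivative De X) (at X within P)"
    and q_deriv: "X \<in> P \<Longrightarrow> (q has_derivative (\<lambda>v. De X (Df X v))) (at X within P)"
    and linear_ell: "X \<in> P \<Longrightarrow> linear (ell X)"
    and left_eigen: "X \<in> P \<Longrightarrow> ell X (Df X w) = lam X * ell X w"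
    and linear_A: "linear A" and linear_l: "linear l" and linear_G: "linear G"
    and bilinear_H: "bounded_bilinear H" and bilinear_B: "bounded_bilinear B"
    and norm_r: "norm r = 1" and A_r: "A r = lbar *\<^sub>R r" and l_r: "l r = 1"
    and l_bound: "\<bar>l w\<bar> \<le> M * norm w" and G_bound: "\<bar>G w\<bar> \<le> M * norm w"
    and H_bound: "norm (H u v) \<le> M * (norm u * norm v)"
    and B_bound: "\<bar>B u v\<bar> \<le> M * (norm u * norm v)" and M_ge_1: "1 \<le> M"
    and spectral_gap: "l w = 0 \<Longrightarrow> k * norm w \<le> norm (A w - lbar *\<^sub>R w)" and k: "0 < k" "k \<le> 1"
    and l_H: "l (H r r) = \<gamma>" and G_r: "G r = \<gamma>" and \<gamma>_pos: "0 < \<gamma>"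
    and B_r: "B u r = \<beta> * l u"
    and Df_close: "X \<in> P \<Longrightarrow> norm (Df X u - A u) \<le> \<kappa> * norm u"
    and Df_expand: "X \<in> P \<Longrightarrow> Y \<in> P \<Longrightarrow>
      norm (Df Y u - Df X u - H (Y - X) u) \<le> \<kappa> * (norm (Y - X) * norm u)"
    and De_expand: "X \<in> P \<Longrightarrow> Y \<in> P \<Longrightarrow>
      \<bar>De Y u - De X u - B u (Y - X)\<bar> \<le> \<kappa> * (norm (Y - X) * norm u)"
    and ell_close: "X \<in> P \<Longrightarrow> \<bar>ell X w - l w\<bar> \<le> \<kappa> * norm w"
    and lam_expand: "X \<in> P \<Longrightarrow> Y \<in> P \<Longrightarrow> \<bar>lam Y - lam X - G (Y - X)\<bar> \<le> \<kappa> * norm (Y - X)"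
    and \<kappa>_pos: "0 < \<kappa>" and \<sigma>_def: "\<sigma> * k = 2 * \<kappa>"
    and small: "\<sigma> \<le> 1 / 4" "48 * M\<^sup>2 * \<sigma> \<le> \<gamma>" "384 * M ^ 3 * \<sigma> \<le> \<bar>\<beta>\<bar> * \<gamma>"
begin

lemma \<sigma>_pos: "0 < \<sigma>" and \<kappa>_le: "2 * \<kappa> \<le> \<sigma>"
proof -
  show "0 < \<sigma>" using \<sigma>_def \<kappa>_pos k(1) by (metis mult_pos_pos zero_less_mult_pos2 zero_less_numeral)
  then show "2 * \<kappa> \<le> \<sigma>" using \<sigma>_def k(2) by (metis less_eq_real_def mult_left_le)
qed

lemma segment_in_P: "X \<in> P \<Longrightarrow> Y \<in> P \<Longrightarrow> \<theta> \<in> {0..1} \<Longrightarrow> X + \<theta> *\<^sub>R (Y - X) \<in> P"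
  using convex_P convex_alt[of P] by (simp add: algebra_simps)

lemma deriv_along_segment:
  fixes g :: "'a \<Rightarrow> 'b::real_normed_vector"
  assumes "X \<in> P" "Y \<in> P" "\<theta> \<in> {0..1}"
    and "(g has_derivative g') (at (X + \<theta> *\<^sub>R (Y - X)) within P)"
  shows "((\<lambda>\<theta>. g (X + \<theta> *\<^sub>R (Y - X))) has_vector_derivative g' (Y - X)) (at \<theta> within {0..1})"
proof -
  have "((\<lambda>\<theta>. X + \<theta> *\<^sub>R (Y - X)) has_derivative (\<lambda>h. h *\<^sub>R (Y - X))) (at \<theta> within {0..1})"
    by (auto intro!: derivative_eq_intros)
  then have "((\<lambda>\<theta>. g (X + \<theta> *\<^sub>R (Y - X))) has_derivative (\<lambda>h. g' (h *\<^sub>R (Y - X)))) (at \<theta> within {0..1})"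
    by (rule has_derivative_in_compose[where f = "\<lambda>\<theta>. X + \<theta> *\<^sub>R (Y - X)" and g = g and g' = g',
          OF _ has_derivative_subset[where t = "(\<lambda>\<theta>. X + \<theta> *\<^sub>R (Y - X)) ` {0..1}", OF assms(4)]])
      (use segment_in_P[OF assms(1,2)] in auto)
  moreover have "g' (h *\<^sub>R (Y - X)) = h *\<^sub>R g' (Y - X)" for h
    using assms(4) has_derivative_linear linear_cmul by blast
  ultimately show ?thesis by (simp add: has_vector_derivative_def)
qed

lemma increment_f:
  assumes "X \<in> P" "Y \<in> P"
  shows "norm (f Y - f X - A (Y - X)) \<le> \<kappa> * norm (Y - X)"
proof -
  have "norm (f (X + 1 *\<^sub>R (Y - X)) - f (X + 0 *\<^sub>R (Y - X)) - 1 *\<^sub>R A (Y - X)) \<le> 1 * (\<kappa> * norm (Y - X))"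
    by (rule increment_near_constant_derivative[OF _ deriv_along_segment[OF assms _ f_deriv]])
      (use assms segment_in_P Df_close in auto)
  then show ?thesis by simp
qed

text \<open>
  Subtracting \<open>l w\<close> times \<open>r\<close> does not change \<open>A w - lbar w\<close> and leads into the kernel of \<open>l\<close>, where
  \<open>A - lbar\<close> is bounded below.
\<close>

lemma transversal_bound:
  assumes "norm (A w - lbar *\<^sub>R w) \<le> R + 2 * \<kappa> * norm w"
  shows "norm (w - l w *\<^sub>R r) \<le> R / k + \<sigma> * norm w"
proof -
  have "l (w - l w *\<^sub>R r) = 0"
    using linear_l l_r by (simp add: linear_diff linear_cmul)
  then have "k * norm (w - l w *\<^sub>R r) \<le> norm (A (w - l w *\<^sub>R r) - lbar *\<^sub>R (w - l w *\<^sub>R r))"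
    by (rule spectral_gap)
  also have "A (w - l w *\<^sub>R r) - lbar *\<^sub>R (w - l w *\<^sub>R r) = A w - lbar *\<^sub>R w"
    using linear_A by (simp add: linear_diff linear_cmul A_r algebra_simps)
  finally have "k * norm (w - l w *\<^sub>R r) \<le> R + (\<sigma> * k) * norm w" using assms \<sigma>_def by simp
  then show ?thesis using k by (simp add: field_simps)
qed

lemma transversal_secant_bound:
  assumes "X \<in> P" "Y \<in> P" "\<bar>\<xi> - lbar\<bar> \<le> \<kappa>"
  shows "norm (Y - X - l (Y - X) *\<^sub>R r) \<le> norm (f Y - f X - \<xi> *\<^sub>R (Y - X)) / k + \<sigma> * norm (Y - X)"
proof (rule transversal_bound)
  have "A (Y - X) - lbar *\<^sub>R (Y - X)
    = (f Y - f X - \<xi> *\<^sub>R (Y - X)) - (f Y - f X - A (Y - X)) + (\<xi> - lbar) *\<^sub>R (Y - X)"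
    by (simp add: algebra_simps)
  also have "norm \<dots> \<le> norm (f Y - f X - \<xi> *\<^sub>R (Y - X)) + norm (f Y - f X - A (Y - X))
      + norm ((\<xi> - lbar) *\<^sub>R (Y - X))"
    by (rule order_trans[OF norm_triangle_ineq add_right_mono[OF norm_triangle_ineq4]])
  also have "\<dots> \<le> norm (f Y - f X - \<xi> *\<^sub>R (Y - X)) + \<kappa> * norm (Y - X) + \<kappa> * norm (Y - X)"
    using increment_f[OF assms(1,2)] mult_right_mono[OF assms(3) norm_ge_zero]
    unfolding norm_scaleR by (intro add_mono order_refl) auto
  finally show "norm (A (Y - X) - lbar *\<^sub>R (Y - X))
    \<le> norm (f Y - f X - \<xi> *\<^sub>R (Y - X)) + 2 * \<kappa> * norm (Y - X)" by (simp add: algebra_simps)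
qed

text \<open>
  A null vector \<open>w\<close> of \<open>Df X - \<xi>\<close> is nearly parallel to \<open>r\<close> by \<open>transversal_bound\<close>, and it is annihilated by
  the left eigenvector at \<open>X\<close>, which nearly is \<open>l\<close>. As \<open>l r = 1\<close>, both hold only for \<open>w = 0\<close>.
\<close>

lemma noncharacteristic_injective:
  assumes X: "X \<in> P" and "\<bar>\<xi> - lbar\<bar> \<le> \<kappa>" and "lam X \<noteq> \<xi>" and w: "Df X w = \<xi> *\<^sub>R w"
  shows "w = 0"
proof -
  have "A w - lbar *\<^sub>R w = (\<xi> - lbar) *\<^sub>R w - (Df X w - A w)"
    using w by (simp add: algebra_simps)
  also have "norm \<dots> \<le> norm ((\<xi> - lbar) *\<^sub>R w) + norm (Df X w - A w)"
    by (rule norm_triangle_ineq4)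
  also have "\<dots> \<le> \<kappa> * norm w + \<kappa> * norm w"
    using Df_close[OF X, of w] mult_right_mono[OF assms(2) norm_ge_zero]
    unfolding norm_scaleR by (intro add_mono) auto
  finally have "norm (A w - lbar *\<^sub>R w) \<le> 0 + 2 * \<kappa> * norm w" by simp
  then have "norm (w - l w *\<^sub>R r) \<le> 0 / k + \<sigma> * norm w" by (rule transversal_bound)
  also have "\<dots> \<le> 1 / 4 * norm w" using mult_right_mono[OF small(1) norm_ge_zero[of w]] by simp
  finally have perp: "norm (w - l w *\<^sub>R r) \<le> 1 / 4 * norm w" .
  have "ell X (Df X w) = \<xi> * ell X w"
    using w linear_ell[OF X] by (simp add: linear_cmul)
  then have "lam X * ell X w = \<xi> * ell X w" by (simp only: left_eigen[OF X])
  then have "ell X w = 0" using assms(3) by auto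
  then have "\<bar>l w\<bar> \<le> \<kappa> * norm w" using ell_close[OF X, of w] by simp
  also have "\<dots> \<le> 1 / 4 * norm w" using small(1) \<kappa>_le by (intro mult_right_mono) auto
  finally have "\<bar>l w\<bar> \<le> 1 / 4 * norm w" .
  moreover have "norm w \<le> norm (l w *\<^sub>R r) + norm (w - l w *\<^sub>R r)" by (rule norm_triangle_sub)
  ultimately have "norm w \<le> 1 / 4 * norm w + 1 / 4 * norm w" 
    using perp by (simp only: norm_scaleR norm_r mult_1_right)
  then show ?thesis by simp
qed

text \<open>
  Decompose the increment into its component along \<open>r\<close> and the rest. The rest is bounded by the
  defect \<open>f Y - f X - \<xi> (Y - X)\<close>; along \<open>r\<close> the speed grows at rate \<open>\<gamma>\<close>. The remaining multiples of
  the increment itself have a small factor and are absorbed.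
\<close>

lemma secant_controlled_by_speed:
  assumes "X \<in> P" "Y \<in> P" "\<bar>\<xi> - lbar\<bar> \<le> \<kappa>"
  shows "norm (Y - X) \<le> 2 / \<gamma> * \<bar>lam Y - lam X\<bar>
    + 2 * (M / \<gamma> + 1) / k * norm (f Y - f X - \<xi> *\<^sub>R (Y - X))"
proof -
  define w where "w = Y - X"
  define s where "s = l w"
  define p where "p = w - s *\<^sub>R r"
  define \<Delta> where "\<Delta> = \<bar>lam Y - lam X\<bar>"
  define R where "R = norm (f Y - f X - \<xi> *\<^sub>R w)"
  have p: "norm p \<le> R / k + \<sigma> * norm w"
    using transversal_secant_bound[OF assms] by (simp add: p_def s_def w_def R_def)
  have "G w = G (s *\<^sub>R r) + G p" unfolding p_def using linear_G by (metis add.commute diff_add_cancel linear_add)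
  then have "G w = \<gamma> * s + G p" using linear_G by (simp add: linear_cmul G_r mult.commute)
  then have "\<gamma> * \<bar>s\<bar> \<le> \<Delta> + \<kappa> * norm w + M * norm p"
    using lam_expand[OF assms(1,2)] G_bound[of p] \<gamma>_pos
    unfolding \<Delta>_def w_def[symmetric] by (cases "s \<ge> 0") (auto simp: abs_if split: if_splits)
  then have "\<bar>s\<bar> \<le> (\<Delta> + \<kappa> * norm w + M * norm p) / \<gamma>" using \<gamma>_pos by (simp add: field_simps)
  moreover have "norm w \<le> \<bar>s\<bar> + norm p"
    using norm_triangle_sub[of w "s *\<^sub>R r"] norm_r by (simp add: p_def)
  ultimately have "norm w \<le> \<Delta> / \<gamma> + \<kappa> / \<gamma> * norm w + (M / \<gamma> + 1) * norm p"
    by (simp add: algebra_simps add_divide_distrib)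
  also have "\<dots> \<le> \<Delta> / \<gamma> + \<kappa> / \<gamma> * norm w + (M / \<gamma> + 1) * (R / k + \<sigma> * norm w)"
    using p \<gamma>_pos M_ge_1 by (intro add_left_mono mult_left_mono) auto
  also have "\<dots> = \<Delta> / \<gamma> + (M / \<gamma> + 1) / k * R + (\<kappa> / \<gamma> + M * \<sigma> / \<gamma> + \<sigma>) * norm w"
    by (simp add: algebra_simps add_divide_distrib)
  also have "\<dots> \<le> \<Delta> / \<gamma> + (M / \<gamma> + 1) / k * R + 1 / 2 * norm w"
  proof -
    have "48 * (M * \<sigma>) \<le> 48 * (M * M * \<sigma>)"
      using M_ge_1 \<sigma>_pos by simp
    then have "M * \<sigma> \<le> \<gamma> / 48" using small(2) by (simp add: power2_eq_square)
    moreover have "\<sigma> \<le> M * \<sigma>" using M_ge_1 \<sigma>_pos by simp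
    ultimately have "\<kappa> + M * \<sigma> \<le> \<gamma> * (1 / 4)" using \<kappa>_le \<gamma>_pos by linarith
    then have "(\<kappa> + M * \<sigma>) / \<gamma> \<le> 1 / 4" using \<gamma>_pos by (simp add: divide_le_eq mult.commute)
    then have "\<kappa> / \<gamma> + M * \<sigma> / \<gamma> + \<sigma> \<le> 1 / 2" using small(1) by (simp only: add_divide_distrib)
    then show ?thesis by (intro add_left_mono mult_right_mono) auto
  qed
  finally have "norm w \<le> 2 * (\<Delta> / \<gamma>) + 2 * ((M / \<gamma> + 1) / k * R)" by linarith
  moreover have "2 / \<gamma> * \<Delta> = 2 * (\<Delta> / \<gamma>)" by simp
  moreover have "2 * (M / \<gamma> + 1) / k * R = 2 * ((M / \<gamma> + 1) / k * R)"
    by (simp only: times_divide_eq_left times_divide_eq_right mult.assoc)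
  ultimately have "norm w \<le> 2 / \<gamma> * \<Delta> + 2 * (M / \<gamma> + 1) / k * R" by linarith
  then show ?thesis by (simp only: w_def \<Delta>_def R_def)
qed

lemma shock_direction:
  assumes "X \<in> P" "Y \<in> P" "\<bar>\<xi> - lbar\<bar> \<le> \<kappa>" and RH: "f Y - f X = \<xi> *\<^sub>R (Y - X)"
  shows "norm (Y - X - l (Y - X) *\<^sub>R r) \<le> \<sigma> * norm (Y - X)"
    and "norm (Y - X) \<le> 2 * \<bar>l (Y - X)\<bar>" and "\<bar>l (Y - X)\<bar> \<le> 3 / 2 * norm (Y - X)"
proof -
  let ?w = "Y - X"
  show p: "norm (?w - l ?w *\<^sub>R r) \<le> \<sigma> * norm ?w"
    using transversal_secant_bound[OF assms(1-3)] RH by simp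
  have half: "\<sigma> * norm ?w \<le> 1 / 4 * norm ?w" using small(1) by (rule mult_right_mono) simp
  show "norm ?w \<le> 2 * \<bar>l ?w\<bar>"
    using norm_triangle_sub[of ?w "l ?w *\<^sub>R r"] p half norm_r by simp
  show "\<bar>l ?w\<bar> \<le> 3 / 2 * norm ?w"
    using norm_triangle_sub[of "l ?w *\<^sub>R r" ?w] p half norm_r by (simp add: norm_minus_commute)
qed

text \<open>
  The function \<open>f - \<xi>\<close> takes the same value at both ends of the segment from \<open>X\<close> to \<open>Y\<close> and has
  nearly the constant second derivative \<open>H w w\<close> along it. Hence its first derivative is nearly the one
  of the parabola that vanishes at both ends.
\<close>

lemma shock_profile:
  assumes "X \<in> P" "Y \<in> P" and RH: "f Y - f X = \<xi> *\<^sub>R (Y - X)" and "\<theta> \<in> {0..1}"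
  defines "w \<equiv> Y - X"
  defines "D \<equiv> Df (X + \<theta> *\<^sub>R w) w - \<xi> *\<^sub>R w"
  shows "norm (D - (\<theta> - 1 / 2) *\<^sub>R H w w) \<le> 2 * \<kappa> * (norm w)\<^sup>2"
    and "norm D \<le> M * (norm w)\<^sup>2"
proof -
  define V where "V = (\<lambda>\<theta>. X + \<theta> *\<^sub>R w)"
  define g' where "g' = (\<lambda>\<theta>. Df (V \<theta>) w - \<xi> *\<^sub>R w)"
  have V: "V t \<in> P" if "t \<in> {0..1}" for t
    using segment_in_P[OF assms(1,2) that] by (simp add: V_def w_def)
  have linear_H: "linear (\<lambda>v. H v w)"
    by (rule bounded_linear.linear[OF bounded_bilinear.bounded_linear_left[OF bilinear_H]])
  have g': "norm (g' t - g' 0 - t *\<^sub>R H w w) \<le> \<kappa> * (norm w)\<^sup>2" if t: "t \<in> {0..1}" for t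
  proof -
    have "norm (Df (V t) w - Df (V 0) w - H (V t - V 0) w) \<le> \<kappa> * (norm (V t - V 0) * norm w)"
      by (rule Df_expand) (use V t in auto)
    also have "\<dots> = \<kappa> * (\<bar>t\<bar> * (norm w * norm w))" by (simp add: V_def)
    also have "\<dots> \<le> \<kappa> * (1 * (norm w * norm w))"
      using t \<kappa>_pos by (intro mult_left_mono mult_right_mono) auto
    finally show ?thesis
      using linear_cmul[OF linear_H] by (simp add: g'_def V_def power2_eq_square)
  qed
  have "norm ((f (V 1) - \<xi> *\<^sub>R V 1 - (1\<^sup>2 / 2) *\<^sub>R H w w) - (f (V 0) - \<xi> *\<^sub>R V 0 - (0\<^sup>2 / 2) *\<^sub>R H w w)
      - 1 *\<^sub>R g' 0) \<le> 1 * (\<kappa> * (norm w)\<^sup>2)"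
  proof (rule increment_near_constant_derivative)
    fix t :: real assume t: "t \<in> {0..1}"
    have df: "((\<lambda>t. f (V t)) has_vector_derivative Df (V t) w) (at t within {0..1})"
      using deriv_along_segment[OF assms(1,2) t f_deriv] V[OF t] by (simp add: V_def w_def)
    show "((\<lambda>t. f (V t) - \<xi> *\<^sub>R V t - (t\<^sup>2 / 2) *\<^sub>R H w w) has_vector_derivative
        Df (V t) w - \<xi> *\<^sub>R w - t *\<^sub>R H w w) (at t within {0..1})"
      unfolding V_def
      by (intro has_vector_derivative_diff df[unfolded V_def])
        (auto intro!: derivative_eq_intros simp: has_vector_derivative_def)
    show "norm (Df (V t) w - \<xi> *\<^sub>R w - t *\<^sub>R H w w - g' 0) \<le> \<kappa> * (norm w)\<^sup>2"
      using g'[OF t] by (simp add: g'_def algebra_simps)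
  qed simp
  moreover have "f (V 1) - \<xi> *\<^sub>R V 1 - (f (V 0) - \<xi> *\<^sub>R V 0) = 0"
    using RH by (simp add: V_def w_def algebra_simps)
  then have "(f (V 1) - \<xi> *\<^sub>R V 1 - (1\<^sup>2 / 2) *\<^sub>R H w w) - (f (V 0) - \<xi> *\<^sub>R V 0 - (0\<^sup>2 / 2) *\<^sub>R H w w)
      - 1 *\<^sub>R g' 0 = - ((1 / 2) *\<^sub>R H w w + g' 0)"
    by (simp add: algebra_simps)
  ultimately have half: "norm ((1 / 2) *\<^sub>R H w w + g' 0) \<le> \<kappa> * (norm w)\<^sup>2" by (simp only: norm_minus_cancel mult_1)
  have "D - (\<theta> - 1 / 2) *\<^sub>R H w w = (g' \<theta> - g' 0 - \<theta> *\<^sub>R H w w) + ((1 / 2) *\<^sub>R H w w + g' 0)"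
    by (simp add: D_def g'_def V_def algebra_simps)
  also have "norm \<dots> \<le> \<kappa> * (norm w)\<^sup>2 + \<kappa> * (norm w)\<^sup>2"
    by (rule order_trans[OF norm_triangle_ineq add_mono[OF g'[OF assms(4)] half]])
  finally show D: "norm (D - (\<theta> - 1 / 2) *\<^sub>R H w w) \<le> 2 * \<kappa> * (norm w)\<^sup>2" by simp
  have "norm D \<le> norm ((\<theta> - 1 / 2) *\<^sub>R H w w) + norm (D - (\<theta> - 1 / 2) *\<^sub>R H w w)"
    by (rule norm_triangle_sub)
  also have "norm ((\<theta> - 1 / 2) *\<^sub>R H w w) \<le> 1 / 2 * (M * (norm w * norm w))"
    using assms(4) H_bound[of w w] M_ge_1 unfolding norm_scaleR by (intro mult_mono) (auto simp: abs_if)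
  also note D
  also have "1 / 2 * (M * (norm w * norm w)) + 2 * \<kappa> * (norm w)\<^sup>2 = (M / 2 + 2 * \<kappa>) * (norm w)\<^sup>2"
    by (simp add: power2_eq_square algebra_simps)
  also have "\<dots> \<le> M * (norm w)\<^sup>2"
    using \<kappa>_le small(1) M_ge_1 by (intro mult_right_mono) auto
  finally show "norm D \<le> M * (norm w)\<^sup>2" by simp
qed

lemma shock_curvature:
  assumes "X \<in> P" "Y \<in> P" "\<bar>\<xi> - lbar\<bar> \<le> \<kappa>" and RH: "f Y - f X = \<xi> *\<^sub>R (Y - X)"
  defines "w \<equiv> Y - X"
  shows "\<bar>l (H w w) - \<gamma> * (l w)\<^sup>2\<bar> \<le> 3 * M\<^sup>2 * \<sigma> * (norm w)\<^sup>2"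
proof -
  interpret H: bounded_bilinear H by (rule bilinear_H)
  define s where "s = l w"
  define p where "p = w - s *\<^sub>R r"
  note dir = shock_direction[OF assms(1-3) RH, folded w_def, folded s_def, folded p_def]
  have w: "w = s *\<^sub>R r + p" by (simp add: p_def)
  have "H w w = H (s *\<^sub>R r) (s *\<^sub>R r) + (H p w + H (s *\<^sub>R r) p)"
    by (subst (1 2) w) (simp only: H.add_left H.add_right w add_ac)
  then have eq: "l (H w w) - \<gamma> * s\<^sup>2 = l (H p w + H (s *\<^sub>R r) p)"
    using linear_l by (simp add: linear_add linear_cmul H.scaleR_left H.scaleR_right l_H power2_eq_square)
  have "norm (H p w + H (s *\<^sub>R r) p) \<le> M * (norm p * norm w) + M * (norm (s *\<^sub>R r) * norm p)"
    by (intro order_trans[OF norm_triangle_ineq] add_mono H_bound)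
  also have "\<dots> = M * norm p * (norm w + \<bar>s\<bar>)" by (simp add: norm_r algebra_simps)
  also have "\<dots> \<le> M * (\<sigma> * norm w) * (3 * norm w)"
    using dir M_ge_1 \<sigma>_pos by (intro mult_mono) auto
  finally have "M * norm (H p w + H (s *\<^sub>R r) p) \<le> M * (M * (\<sigma> * norm w) * (3 * norm w))"
    using M_ge_1 by (intro mult_left_mono) auto
  then show ?thesis
    using l_bound[of "H p w + H (s *\<^sub>R r) p"] eq by (simp add: s_def power2_eq_square algebra_simps)
qed

text \<open>
  Apply the left eigenvector at an end state to \<open>shock_profile\<close> with \<open>\<theta> = 0\<close> or \<open>\<theta> = 1\<close>: it turns
  \<open>Df - \<xi>\<close> into the factor \<open>lam - \<xi>\<close>, and the parabola into \<open>\<plusminus>\<gamma> s\<^sup>2 / 2\<close>, while \<open>l w = s\<close>. So the two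
  speeds differ from \<open>\<xi>\<close> by about \<open>\<plusminus>\<gamma> s / 2\<close>.
\<close>

lemma characteristic_speed_at_shock:
  assumes "X \<in> P" "Y \<in> P" "\<bar>\<xi> - lbar\<bar> \<le> \<kappa>" and RH: "f Y - f X = \<xi> *\<^sub>R (Y - X)"
    and \<theta>: "\<theta> \<in> {0, 1}" and pos: "0 < l (Y - X)"
  shows "\<gamma> / 12 * norm (Y - X) \<le> (2 * \<theta> - 1) * (lam (X + \<theta> *\<^sub>R (Y - X)) - \<xi>)"
proof -
  define w where "w = Y - X"
  define s where "s = l w"
  define Z where "Z = X + \<theta> *\<^sub>R w"
  define D where "D = Df Z w - \<xi> *\<^sub>R w"
  define N where "N = (norm w)\<^sup>2"
  define \<epsilon> where "\<epsilon> = 2 * \<theta> - 1"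
  have \<epsilon>: "\<epsilon> * \<epsilon> = 1" "\<bar>\<epsilon>\<bar> = 1" "\<theta> - 1 / 2 = \<epsilon> / 2" using \<theta> by (auto simp: \<epsilon>_def)
  have Z: "Z \<in> P" using assms(1,2) \<theta> by (auto simp: Z_def w_def)
  note dir = shock_direction[OF assms(1-4), folded w_def, folded s_def]
  have s: "0 < s" using pos by (simp add: s_def w_def)
  have "\<theta> \<in> {0..1}" using \<theta> by auto
  note prof = shock_profile[OF assms(1,2) RH this, folded w_def, folded Z_def, folded D_def, folded N_def]
  have ellD: "(lam Z - \<xi>) * ell Z w = ell Z D"
    using left_eigen[OF Z, of w] linear_ell[OF Z] by (simp add: D_def linear_diff linear_cmul algebra_simps)
  have "\<bar>ell Z D - l D\<bar> \<le> \<kappa> * norm D" by (rule ell_close[OF Z])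
  also have "\<dots> \<le> \<kappa> * (M * N)" using prof(2) \<kappa>_pos by (intro mult_left_mono) auto
  finally have 1: "\<bar>ell Z D - l D\<bar> \<le> M * \<kappa> * N" by (simp add: algebra_simps)
  have "\<bar>l (D - (\<epsilon> / 2) *\<^sub>R H w w)\<bar> \<le> M * (2 * \<kappa> * N)"
    using l_bound[of "D - (\<epsilon> / 2) *\<^sub>R H w w"] prof(1) M_ge_1 unfolding \<epsilon>(3)
    by (meson mult_left_mono order_trans zero_le_one)
  then have 2: "\<bar>l D - \<epsilon> / 2 * l (H w w)\<bar> \<le> 2 * (M * \<kappa> * N)"
    using linear_l by (simp add: linear_diff linear_cmul algebra_simps)
  have "\<bar>l (H w w) - \<gamma> * s\<^sup>2\<bar> \<le> 3 * M\<^sup>2 * \<sigma> * N"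
    using shock_curvature[OF assms(1-4)] by (simp add: N_def s_def w_def)
  moreover have "\<bar>\<epsilon> / 2 * (l (H w w) - \<gamma> * s\<^sup>2)\<bar> = 1 / 2 * \<bar>l (H w w) - \<gamma> * s\<^sup>2\<bar>"
    by (simp add: abs_mult \<epsilon>(2))
  ultimately have 3: "\<bar>\<epsilon> / 2 * l (H w w) - \<epsilon> / 2 * (\<gamma> * s\<^sup>2)\<bar> \<le> 3 / 2 * M\<^sup>2 * \<sigma> * N"
    unfolding right_diff_distrib[symmetric] by simp
  have N: "0 \<le> N" "N \<le> 4 * s\<^sup>2"
    using power_mono[OF dir(2) norm_ge_zero, of 2] by (auto simp: N_def power_mult_distrib)
  have "3 * (M * \<kappa>) \<le> 3 / 2 * M\<^sup>2 * \<sigma>"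
  proof -
    have "M * \<kappa> \<le> M * (\<sigma> / 2)" using \<kappa>_le M_ge_1 by (intro mult_left_mono) auto
    also have "\<dots> \<le> M * M * (\<sigma> / 2)" using M_ge_1 \<sigma>_pos by (intro mult_right_mono) auto
    finally show ?thesis by (simp add: power2_eq_square)
  qed
  then have "3 * (M * \<kappa> * N) \<le> 3 / 2 * M\<^sup>2 * \<sigma> * N"
    using mult_right_mono[of "3 * (M * \<kappa>)" "3 / 2 * M\<^sup>2 * \<sigma>" N] N(1)
    by (simp only: mult.assoc)
  then have "\<bar>ell Z D - \<epsilon> / 2 * (\<gamma> * s\<^sup>2)\<bar> \<le> 3 * M\<^sup>2 * \<sigma> * N"
    using 1 2 3 by linarith
  also have "\<dots> \<le> 3 * M\<^sup>2 * \<sigma> * (4 * s\<^sup>2)"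
    using N \<sigma>_pos by (intro mult_left_mono) auto
  also have "\<dots> \<le> \<gamma> / 4 * s\<^sup>2"
    using mult_right_mono[OF small(2), of "s\<^sup>2"] by simp
  finally have "\<bar>\<epsilon> * (ell Z D - \<epsilon> / 2 * (\<gamma> * s\<^sup>2))\<bar> \<le> \<gamma> / 4 * s\<^sup>2"
    using \<epsilon>(2) by (simp add: abs_mult)
  moreover have "\<epsilon> * (ell Z D - \<epsilon> / 2 * (\<gamma> * s\<^sup>2)) = \<epsilon> * (lam Z - \<xi>) * ell Z w - \<gamma> / 2 * s\<^sup>2"
    using \<epsilon>(1) ellD by (simp add: algebra_simps)
  ultimately have lower: "\<gamma> / 4 * s\<^sup>2 \<le> \<epsilon> * (lam Z - \<xi>) * ell Z w" by linarith
  have "\<kappa> * norm w \<le> \<kappa> * (2 * s)" using dir(2) s \<kappa>_pos by (intro mult_left_mono) auto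
  also have "\<dots> \<le> \<sigma> * s" using \<kappa>_le s by simp
  also have "\<dots> \<le> 1 / 4 * s" using small(1) s by (intro mult_right_mono) auto
  finally have "\<bar>ell Z w - s\<bar> \<le> 1 / 4 * s" using ell_close[OF Z, of w] by (simp add: s_def)
  then have ell_w: "0 < ell Z w" "ell Z w \<le> 3 / 2 * s" using s by linarith+
  have "0 < \<gamma> / 4 * s\<^sup>2" using \<gamma>_pos s by simp
  with lower ell_w(1) have "0 < \<epsilon> * (lam Z - \<xi>)"
    by (metis less_le_trans zero_less_mult_pos2)
  then have "\<epsilon> * (lam Z - \<xi>) * ell Z w \<le> \<epsilon> * (lam Z - \<xi>) * (3 / 2 * s)"
    using ell_w by (intro mult_left_mono) auto
  with lower have "(\<gamma> / 6 * s) * s \<le> (\<epsilon> * (lam Z - \<xi>)) * s"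
    by (simp add: power2_eq_square algebra_simps)
  then have "\<gamma> / 6 * s \<le> \<epsilon> * (lam Z - \<xi>)" using s by (simp only: mult_le_cancel_right_pos)
  moreover have "\<gamma> / 12 * norm w \<le> \<gamma> / 12 * (2 * s)"
    using dir(2) s \<gamma>_pos by (intro mult_left_mono) auto
  ultimately show ?thesis by (simp add: \<epsilon>_def Z_def w_def)
qed

text \<open>
  Since \<open>f - \<xi>\<close> takes equal values at \<open>X\<close> and \<open>Y\<close>, subtracting the fixed linear functional \<open>De X\<close> of
  it does not change the entropy production. The derivative along the segment then is
  \<open>De (V \<theta>) - De X\<close> applied to the vector estimated in \<open>shock_profile\<close>, hence about \<open>\<theta> (\<theta> - 1 / 2) B (H w w) w\<close>, and the integral of
  \<open>\<theta> (\<theta> - 1 / 2)\<close> over the unit interval is \<open>1 / 12\<close>.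
\<close>

lemma entropy_production:
  assumes "X \<in> P" "Y \<in> P" "\<bar>\<xi> - lbar\<bar> \<le> \<kappa>" and RH: "f Y - f X = \<xi> *\<^sub>R (Y - X)"
  defines "w \<equiv> Y - X"
  shows "\<bar>(q Y - q X - \<xi> * (e Y - e X)) - \<beta> * \<gamma> / 12 * (l w) ^ 3\<bar> \<le> 2 * M ^ 3 * \<sigma> * (norm w) ^ 3"
proof -
  interpret B: bounded_bilinear B by (rule bilinear_B)
  define s where "s = l w"
  define p where "p = w - s *\<^sub>R r"
  define V where "V = (\<lambda>\<theta>. X + \<theta> *\<^sub>R w)"
  define D where "D = (\<lambda>\<theta>. Df (V \<theta>) w - \<xi> *\<^sub>R w)"
  define N where "N = norm w"
  note dir = shock_direction[OF assms(1-4), folded w_def, folded s_def, folded p_def]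
  have V: "V t \<in> P" if "t \<in> {0..1}" for t
    using segment_in_P[OF assms(1,2) that] by (simp add: V_def w_def)
  have D: "norm (D t - (t - 1 / 2) *\<^sub>R H w w) \<le> 2 * \<kappa> * N\<^sup>2" "norm (D t) \<le> M * N\<^sup>2"
    if "t \<in> {0..1}" for t
    using shock_profile[OF assms(1,2) RH that] by (simp_all add: D_def V_def w_def N_def)
  have linear_De: "linear (De Z)" if "Z \<in> P" for Z
    using e_deriv[OF that] has_derivative_linear by blast
  have N: "0 \<le> N" by (simp add: N_def)
  define b where "b = B (H w w) w"
  \<comment> \<open>The last term subtracts the leading part, an antiderivative of \<open>(t\<^sup>2 - t / 2) b\<close> with value \<open>b / 12\<close> at \<open>1\<close>.\<close>
  let ?\<phi> = "\<lambda>t. q (V t) - \<xi> * e (V t) - De X (f (V t) - \<xi> *\<^sub>R V t) - (t ^ 3 / 3 - t\<^sup>2 / 4) * b"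
  let ?\<phi>' = "\<lambda>t. De (V t) (Df (V t) w) - \<xi> * De (V t) w - De X (D t) - (t\<^sup>2 - t / 2) * b"
  have "norm (?\<phi> 1 - ?\<phi> 0 - 1 *\<^sub>R 0) \<le> 1 * (3 * M * \<kappa> * N ^ 3)"
  proof (rule increment_near_constant_derivative)
    fix t :: real assume t: "t \<in> {0..1}"
    have Vt: "X + t *\<^sub>R (Y - X) \<in> P" using segment_in_P[OF assms(1,2) t] .
    have dq: "((\<lambda>t. q (V t)) has_vector_derivative De (V t) (Df (V t) w)) (at t within {0..1})"
      using deriv_along_segment[OF assms(1,2) t q_deriv[OF Vt]] by (simp add: V_def w_def)
    have de: "((\<lambda>t. e (V t)) has_vector_derivative De (V t) w) (at t within {0..1})"
      using deriv_along_segment[OF assms(1,2) t e_deriv[OF Vt]] by (simp add: V_def w_def)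
    have df: "((\<lambda>t. f (V t)) has_vector_derivative Df (V t) w) (at t within {0..1})"
      using deriv_along_segment[OF assms(1,2) t f_deriv[OF Vt]] by (simp add: V_def w_def)
    have "(V has_vector_derivative w) (at t within {0..1})"
      unfolding V_def by (auto intro!: derivative_eq_intros simp: has_vector_derivative_def)
    then have "((\<lambda>t. f (V t) - \<xi> *\<^sub>R V t) has_vector_derivative D t) (at t within {0..1})"
      unfolding D_def using has_vector_derivative_diff[OF df bounded_linear.has_vector_derivative[OF bounded_linear_scaleR_right]]
      by blast
    moreover have "bounded_linear (De X)" using e_deriv[OF assms(1)] has_derivative_bounded_linear by blast
    ultimately have dDe: "((\<lambda>t. De X (f (V t) - \<xi> *\<^sub>R V t)) has_vector_derivative De X (D t)) (at t within {0..1})"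
      by (metis bounded_linear.has_vector_derivative)
    have "((\<lambda>t. t ^ 3 / 3 - t\<^sup>2 / 4) has_real_derivative t\<^sup>2 - t / 2) (at t within {0..1})"
      by (auto intro!: derivative_eq_intros simp: power2_eq_square)
    then have db: "((\<lambda>t. (t ^ 3 / 3 - t\<^sup>2 / 4) * b) has_vector_derivative (t\<^sup>2 - t / 2) * b) (at t within {0..1})"
      using DERIV_cmult_right has_real_derivative_iff_has_vector_derivative by blast
    show "(?\<phi> has_vector_derivative ?\<phi>' t) (at t within {0..1})"
      by (intro has_vector_derivative_diff dq db dDe has_vector_derivative_mult_right de)
    have "?\<phi>' t = De (V t) (D t) - De X (D t) - (t\<^sup>2 - t / 2) * b"
      using linear_De[OF V[OF t]] by (simp add: D_def linear_diff linear_cmul)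
    also have "\<dots> = (De (V t) (D t) - De X (D t) - B (D t) (V t - X))
        + t * B (D t - (t - 1 / 2) *\<^sub>R H w w) w"
      by (simp add: V_def b_def B.scaleR_right B.diff_left[of _ "_ *\<^sub>R _"] B.scaleR_left
          power2_eq_square right_diff_distrib left_diff_distrib)
    finally have split: "?\<phi>' t = \<dots>" .
    have "\<bar>De (V t) (D t) - De X (D t) - B (D t) (V t - X)\<bar> \<le> \<kappa> * (norm (V t - X) * norm (D t))"
      by (rule De_expand[OF assms(1) V[OF t]])
    also have "\<dots> \<le> \<kappa> * (N * (M * N\<^sup>2))"
    proof -
      have "norm (V t - X) \<le> N" using t by (simp add: V_def N_def mult_left_le_one_le)
      then show ?thesis using D(2)[OF t] \<kappa>_pos N by (intro mult_left_mono mult_mono) auto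
    qed
    finally have 1: "\<bar>De (V t) (D t) - De X (D t) - B (D t) (V t - X)\<bar> \<le> M * \<kappa> * N ^ 3"
      by (simp add: power2_eq_square power3_eq_cube algebra_simps)
    have "\<bar>t * B (D t - (t - 1 / 2) *\<^sub>R H w w) w\<bar> \<le> 1 * (M * ((2 * \<kappa> * N\<^sup>2) * N))"
      unfolding abs_mult
    proof (rule mult_mono)
      show "\<bar>B (D t - (t - 1 / 2) *\<^sub>R H w w) w\<bar> \<le> M * ((2 * \<kappa> * N\<^sup>2) * N)"
        using D(1)[OF t] M_ge_1 \<kappa>_pos
        by (intro order_trans[OF B_bound] mult_left_mono mult_mono) (auto simp: N_def)
    qed (use t in auto)
    then have "\<bar>t * B (D t - (t - 1 / 2) *\<^sub>R H w w) w\<bar> \<le> 2 * (M * \<kappa> * N ^ 3)"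
      by (simp add: power2_eq_square power3_eq_cube algebra_simps)
    with 1 show "norm (?\<phi>' t - 0) \<le> 3 * M * \<kappa> * N ^ 3"
      unfolding split by (simp add: abs_le_iff)
  qed simp
  moreover have "f Y - \<xi> *\<^sub>R Y = f X - \<xi> *\<^sub>R X" using RH by (simp add: algebra_simps)
  ultimately have G1: "\<bar>(q Y - q X - \<xi> * (e Y - e X)) - b / 12\<bar> \<le> 3 * M * \<kappa> * N ^ 3"
    by (simp add: V_def w_def algebra_simps)
  have \<beta>: "\<bar>\<beta>\<bar> \<le> M" using B_bound[of r r] B_r[of r] by (simp add: norm_r l_r)
  have "w = s *\<^sub>R r + p" by (simp add: p_def)
  then have "b = s * (\<beta> * l (H w w)) + B (H w w) p"
    unfolding b_def by (metis B.add_right B.scaleR_right B_r real_scaleR_def)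
  then have b: "b - \<beta> * \<gamma> * s ^ 3 = s * \<beta> * (l (H w w) - \<gamma> * s\<^sup>2) + B (H w w) p"
    by (simp add: power2_eq_square power3_eq_cube algebra_simps)
  have "\<bar>s * \<beta> * (l (H w w) - \<gamma> * s\<^sup>2)\<bar> \<le> (3 / 2 * N) * M * (3 * M\<^sup>2 * \<sigma> * N\<^sup>2)"
    using dir(3) \<beta> shock_curvature[OF assms(1-4)] N unfolding abs_mult
    by (intro mult_mono) (auto simp: N_def s_def w_def)
  then have 1: "\<bar>s * \<beta> * (l (H w w) - \<gamma> * s\<^sup>2)\<bar> \<le> 9 / 2 * (M ^ 3 * \<sigma> * N ^ 3)"
    by (simp add: power2_eq_square power3_eq_cube algebra_simps)
  have "\<bar>B (H w w) p\<bar> \<le> M * ((M * (N * N)) * (\<sigma> * N))"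
    using H_bound[of w w] dir(1) M_ge_1 N
    by (intro order_trans[OF B_bound] mult_left_mono mult_mono) (auto simp: N_def)
  also have "\<dots> = M\<^sup>2 * (\<sigma> * N ^ 3)" by (simp add: power2_eq_square power3_eq_cube algebra_simps)
  also have "\<dots> \<le> M ^ 3 * (\<sigma> * N ^ 3)"
    using M_ge_1 \<sigma>_pos N by (intro mult_right_mono power_increasing) auto
  finally have 2: "\<bar>B (H w w) p\<bar> \<le> M ^ 3 * \<sigma> * N ^ 3" by simp
  have "M * \<kappa> * N ^ 3 \<le> M * (\<sigma> / 2) * N ^ 3"
    using \<kappa>_le M_ge_1 N by (intro mult_right_mono mult_left_mono) auto
  also have "\<dots> \<le> M ^ 3 * (\<sigma> / 2) * N ^ 3"
    using M_ge_1 \<sigma>_pos N power_increasing[of 1 3 M] by (intro mult_right_mono) auto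
  finally have 3: "3 * M * \<kappa> * N ^ 3 \<le> 3 / 2 * (M ^ 3 * \<sigma> * N ^ 3)" by (simp add: algebra_simps)
  have "\<bar>b - \<beta> * \<gamma> * s ^ 3\<bar> \<le> 6 * (M ^ 3 * \<sigma> * N ^ 3)"
  proof -
    have "0 \<le> M ^ 3 * \<sigma> * N ^ 3" using \<sigma>_pos N M_ge_1 by simp
    then show ?thesis unfolding b using 1 2 by linarith
  qed
  then have "\<bar>(q Y - q X - \<xi> * (e Y - e X)) - \<beta> * \<gamma> * s ^ 3 / 12\<bar> \<le> 2 * (M ^ 3 * \<sigma> * N ^ 3)"
    using G1 3 by linarith
  then show ?thesis by (simp add: s_def N_def)
qed

text \<open>
  The cubic leading term of the entropy production has the sign of \<open>\<beta> s\<close>. The assumption on \<open>\<tau>\<close> and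
  the entropy inequality therefore leave only \<open>s > 0\<close>.
\<close>

theorem backward_shock_expansive:
  assumes "X \<in> P" "Y \<in> P" "\<bar>\<xi> - lbar\<bar> \<le> \<kappa>" and RH: "f Y - f X = \<xi> *\<^sub>R (Y - X)" and "X \<noteq> Y"
    and \<tau>: "\<tau> * \<beta> < 0" and entropy: "\<tau> * (q Y - q X - \<xi> * (e Y - e X)) \<le> 0"
  shows "\<gamma> / 12 * norm (Y - X) \<le> \<xi> - lam X" and "\<gamma> / 12 * norm (Y - X) \<le> lam Y - \<xi>"
proof -
  define s where "s = l (Y - X)"
  note dir = shock_direction[OF assms(1-4), folded s_def]
  have "0 < s"
  proof (rule ccontr)
    assume "\<not> 0 < s"
    moreover have "s \<noteq> 0" using dir(2) \<open>X \<noteq> Y\<close> by auto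
    ultimately have s: "0 < - s" by simp
    have "\<bar>(q Y - q X - \<xi> * (e Y - e X)) - \<beta> * \<gamma> / 12 * s ^ 3\<bar> \<le> 2 * M ^ 3 * \<sigma> * (norm (Y - X)) ^ 3"
      using entropy_production[OF assms(1-4)] by (simp add: s_def)
    also have "\<dots> \<le> 2 * M ^ 3 * \<sigma> * (2 * \<bar>s\<bar>) ^ 3"
      using dir(2) M_ge_1 \<sigma>_pos by (intro mult_left_mono power_mono) auto
    also have "\<dots> = 384 * M ^ 3 * \<sigma> * \<bar>s\<bar> ^ 3 / 24" by (simp add: power_mult_distrib)
    also have "\<dots> \<le> \<bar>\<beta>\<bar> * \<gamma> * \<bar>s\<bar> ^ 3 / 24"
      by (intro divide_right_mono mult_right_mono small(3)) auto
    finally have "\<bar>\<tau>\<bar> * \<bar>(q Y - q X - \<xi> * (e Y - e X)) - \<beta> * \<gamma> / 12 * s ^ 3\<bar>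
        \<le> \<bar>\<tau>\<bar> * (\<bar>\<beta>\<bar> * \<gamma> * \<bar>s\<bar> ^ 3 / 24)"
      by (rule mult_left_mono) simp
    then have "\<bar>\<tau> * (q Y - q X - \<xi> * (e Y - e X)) - \<tau> * \<beta> * \<gamma> / 12 * s ^ 3\<bar>
        \<le> \<bar>\<tau> * \<beta>\<bar> * \<gamma> * \<bar>s\<bar> ^ 3 / 24"
      by (simp only: abs_mult[symmetric]) (simp add: abs_mult algebra_simps)
    moreover have "\<bar>\<tau> * \<beta>\<bar> * \<gamma> * \<bar>s\<bar> ^ 3 = \<tau> * \<beta> * \<gamma> * s ^ 3"
      using \<tau> s by (simp add: abs_if power3_eq_cube)
    moreover have "0 < \<tau> * \<beta> * \<gamma> * s ^ 3"
    proof -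
      have "0 < (- (\<tau> * \<beta>)) * \<gamma> * (- s) ^ 3" using \<tau> s \<gamma>_pos by (intro mult_pos_pos) auto
      then show ?thesis by simp
    qed
    moreover have "\<tau> * \<beta> * \<gamma> / 12 * s ^ 3 = (\<tau> * \<beta> * \<gamma> * s ^ 3) / 12" by simp
    ultimately show False using entropy by linarith
  qed
  then show "\<gamma> / 12 * norm (Y - X) \<le> \<xi> - lam X" "\<gamma> / 12 * norm (Y - X) \<le> lam Y - \<xi>"
    using characteristic_speed_at_shock[OF assms(1-4), of 0]
      characteristic_speed_at_shock[OF assms(1-4), of 1] by (auto simp: s_def)
qed

end

section \<open>Cluster values, sums of gaps and saltus functions\<close>

lemma frequently_cluster_point:
  fixes V :: "'b \<Rightarrow> 'a::metric_space"
  assumes "compact P" and "\<And>s. V s \<in> P" and "F \<noteq> bot"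
  shows "\<exists>X\<in>P. \<forall>d>0. \<exists>\<^sub>F s in F. dist (V s) X < d"
proof -
  have "filtermap V F \<noteq> bot" "eventually (\<lambda>x. x \<in> P) (filtermap V F)"
    using assms by (auto simp: filtermap_bot_iff eventually_filtermap)
  then obtain X where X: "X \<in> P" "inf (nhds X) (filtermap V F) \<noteq> bot"
    using assms(1) unfolding compact_filter by blast
  have "\<exists>\<^sub>F s in F. dist (V s) X < d" if "d > 0" for d
  proof (rule ccontr)
    assume "\<not> (\<exists>\<^sub>F s in F. dist (V s) X < d)"
    then have "\<forall>\<^sub>F Y in filtermap V F. \<not> dist Y X < d"
      by (simp add: frequently_def eventually_filtermap)
    moreover have "\<forall>\<^sub>F Y in nhds X. dist Y X < d"
      using that eventually_nhds_metric by blast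
    ultimately have "\<forall>\<^sub>F Y in inf (nhds X) (filtermap V F). False"
      unfolding eventually_inf by (metis (mono_tags, lifting))
    with X(2) show False by (simp add: trivial_limit_def)
  qed
  with X(1) show ?thesis by blast
qed

text \<open>
  If \<open>V\<close> stayed away from one of its cluster points on a frequent set, then it would have another one
  along that set, by compactness.
\<close>

lemma unique_cluster_point_imp_tendsto:
  fixes V :: "'b \<Rightarrow> 'a::metric_space"
  assumes "compact P" and "\<And>s. V s \<in> P" and "F \<noteq> bot"
    and unique: "\<And>X Y. X \<in> P \<Longrightarrow> Y \<in> P \<Longrightarrow> (\<And>d. d > 0 \<Longrightarrow> \<exists>\<^sub>F s in F. dist (V s) X < d) \<Longrightarrow>
      (\<And>d. d > 0 \<Longrightarrow> \<exists>\<^sub>F s in F. dist (V s) Y < d) \<Longrightarrow> X = Y"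
  shows "\<exists>X\<in>P. (V \<longlongrightarrow> X) F"
proof -
  from frequently_cluster_point[OF assms(1-3)]
  obtain X where X: "X \<in> P" "\<forall>d>0. \<exists>\<^sub>F s in F. dist (V s) X < d" by (rule bexE)
  have "\<forall>\<^sub>F s in F. dist (V s) X < d" if "d > 0" for d
  proof (rule ccontr)
    assume "\<not> (\<forall>\<^sub>F s in F. dist (V s) X < d)"
    then have freq: "\<exists>\<^sub>F s in F. \<not> dist (V s) X < d" by (simp add: frequently_def)
    define F' where "F' = inf F (principal {s. \<not> dist (V s) X < d})"
    have "F' \<noteq> bot"
      using freq unfolding F'_def frequently_def trivial_limit_def eventually_inf_principal by simp
    from frequently_cluster_point[OF assms(1,2) this]
    obtain Y where Y: "Y \<in> P" "\<forall>d>0. \<exists>\<^sub>F s in F'. dist (V s) Y < d" by (rule bexE)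
    have Y': "\<exists>\<^sub>F s in F. dist (V s) Y < d' \<and> \<not> dist (V s) X < d" if "d' > 0" for d'
    proof -
      have "\<exists>\<^sub>F s in F'. dist (V s) Y < d'" using Y(2) that by simp
      then show ?thesis
        unfolding F'_def frequently_def eventually_inf_principal
        by (rule contrapos_nn) (auto elim: eventually_mono)
    qed
    have "\<exists>\<^sub>F s in F. dist (V s) Y < d'" if "d' > 0" for d'
      using Y'[OF that] by (rule frequently_elim1) simp
    moreover have "\<exists>\<^sub>F s in F. dist (V s) X < d'" if "d' > 0" for d' using X(2) that by simp
    ultimately have "X = Y" using X(1) Y(1) by (intro unique)
    then show False using Y'[OF \<open>d > 0\<close>] by (auto dest: frequently_ex)
  qed
  then show ?thesis using X(1) by (auto simp: tendsto_iff)
qed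

lemma LIMSEQ_if_dist_less_inverse_Suc:
  fixes z :: "'a::metric_space"
  assumes "\<And>n. dist (u n) z < inverse (real (Suc n))"
  shows "u \<longlonglongrightarrow> z"
proof (rule iffD2[OF tendsto_dist_iff])
  show "(\<lambda>n. dist (u n) z) \<longlonglongrightarrow> 0"
    by (rule tendsto_sandwich[OF _ _ tendsto_const LIMSEQ_inverse_real_of_nat])
      (use less_imp_le[OF assms] in auto)
qed

text \<open>
  A function that is not integrable has the integral \<open>0\<close>, so it obeys the bound as well. In this
  generality the bound applies to \<open>e \<circ> V\<close> directly.
\<close>

lemma norm_integral_le:
  fixes g :: "real \<Rightarrow> 'a::euclidean_space"
  assumes "x \<le> y" and "\<And>s. s \<in> {x..y} \<Longrightarrow> norm (g s) \<le> N" and "0 \<le> N"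
  shows "norm (integral {x..y} g) \<le> (y - x) * N"
proof (cases "g integrable_on {x..y}")
  case True
  from has_integral_bound_real[OF assms(3) finite.emptyI integrable_integral[OF True]] assms(1,2)
  show ?thesis by (simp add: mult.commute)
next
  case False
  then show ?thesis using assms by (simp add: not_integrable_integral)
qed

text \<open>
  Disjoint intervals that start at the points of \<open>F\<close>, with lengths \<open>d\<close>, fit between \<open>x\<close> and \<open>y\<close>.
\<close>

lemma sum_gaps_le:
  fixes d :: "real \<Rightarrow> real"
  assumes "finite F" and "\<And>z. z \<in> F \<Longrightarrow> x \<le> z \<and> z + d z \<le> y" and "x \<le> y"
    and "\<And>z z'. z \<in> F \<Longrightarrow> z' \<in> F \<Longrightarrow> z < z' \<Longrightarrow> z + d z \<le> z'"
  shows "sum d F \<le> y - x"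
  using assms
proof (induction F arbitrary: y rule: finite_linorder_max_induct)
  case empty
  then show ?case by simp
next
  case (insert m F)
  have "sum d F \<le> m - x"
    using insert.prems insert.hyps by (intro insert.IH) auto
  moreover have "d m \<le> y - m" using insert.prems(1)[of m] by simp
  ultimately show ?case using insert.hyps by (subst sum.insert) auto
qed

lemma continuous_locally_constant_endpoints:
  fixes \<Phi> :: "real \<Rightarrow> 'a::real_inner"
  assumes "x \<le> y" and "continuous_on {x..y} \<Phi>"
    and "\<And>t. t \<in> {x<..<y} \<Longrightarrow> \<exists>d>0. \<forall>s\<in>{x..y}. \<bar>s - t\<bar> < d \<longrightarrow> \<Phi> s = \<Phi> t"
  shows "\<Phi> x = \<Phi> y"
proof (cases "x = y")
  case False
  then have "x < y" using assms(1) by simp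
  have "(\<Phi> has_derivative (\<lambda>_. 0)) (at t)" if t: "x < t" "t < y" for t
  proof -
    have "t \<in> {x<..<y}" using t by simp
    then obtain d where d: "d > 0" "\<And>s. s \<in> {x..y} \<Longrightarrow> \<bar>s - t\<bar> < d \<Longrightarrow> \<Phi> s = \<Phi> t"
      using assms(3) by blast
    show ?thesis
    proof (rule has_derivative_transform_within_open[where f = "\<lambda>_. \<Phi> t" and s = "{x<..<y} \<inter> ball t d"])
      show "\<Phi> t = \<Phi> s" if "s \<in> {x<..<y} \<inter> ball t d" for s
        using that d(2)[of s] by (auto simp: dist_real_def abs_minus_commute)
    qed (use t d(1) in auto)
  qed
  then obtain z where "norm (\<Phi> y - \<Phi> x) \<le> norm (0::'a)"
    using mvt_general[OF \<open>x < y\<close> assms(2), of "\<lambda>_ _. 0"] by blast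
  then show ?thesis by simp
qed simp

text \<open>
  The Lipschitz bound passes to the closure of \<open>K\<close> by continuity. Between two points, \<open>\<Phi>\<close> is constant up to
  the first point and after the last point of this closure.
\<close>

lemma lipschitz_on_if_locally_constant_off:
  fixes \<Phi> :: "real \<Rightarrow> 'a::real_inner"
  assumes cont: "continuous_on {a..b} \<Phi>" and K: "K \<subseteq> {a..b}" and lip: "L-lipschitz_on K \<Phi>"
    and off: "\<And>t. t \<in> {a..b} - K \<Longrightarrow> \<exists>d>0. \<forall>s\<in>{a..b}. \<bar>s - t\<bar> < d \<longrightarrow> \<Phi> s = \<Phi> t"
  shows "L-lipschitz_on {a..b} \<Phi>"
proof -
  define K' where "K' = closure K"
  have K'_sub: "K' \<subseteq> {a..b}" unfolding K'_def using K by (simp add: closure_minimal)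
  have lip': "L-lipschitz_on K' \<Phi>"
    unfolding K'_def using lip continuous_on_subset[OF cont] K'_sub
    by (intro lipschitz_on_closure) (auto simp: K'_def)
  have L: "0 \<le> L" using lip lipschitz_on_nonneg by blast
  have const: "\<Phi> x = \<Phi> y" if "a \<le> x" "x \<le> y" "y \<le> b" "K' \<inter> {x<..<y} = {}" for x y
  proof (rule continuous_locally_constant_endpoints)
    show "continuous_on {x..y} \<Phi>" using that by (intro continuous_on_subset[OF cont]) auto
    fix t assume t: "t \<in> {x<..<y}"
    have "t \<notin> K" using that(4) t closure_subset[of K] by (auto simp: K'_def)
    then have "t \<in> {a..b} - K" using that t by simp
    from off[OF this] obtain d where d: "d > 0" "\<forall>s\<in>{a..b}. \<bar>s - t\<bar> < d \<longrightarrow> \<Phi> s = \<Phi> t" by blast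
    show "\<exists>d>0. \<forall>s\<in>{x..y}. \<bar>s - t\<bar> < d \<longrightarrow> \<Phi> s = \<Phi> t"
    proof (intro exI[of _ d] conjI ballI d(1))
      show "\<bar>s - t\<bar> < d \<longrightarrow> \<Phi> s = \<Phi> t" if "s \<in> {x..y}" for s
        using d(2) that \<open>a \<le> x\<close> \<open>y \<le> b\<close> by simp
    qed
  qed (use that in auto)
  have "dist (\<Phi> x) (\<Phi> y) \<le> L * dist x y" if xy: "a \<le> x" "x \<le> y" "y \<le> b" for x y
  proof (cases "K' \<inter> {x..y} = {}")
    case True
    then have "\<Phi> x = \<Phi> y" using xy by (intro const) auto
    then show ?thesis using L by simp
  next
    case False
    define C where "C = K' \<inter> {x..y}"
    have C: "closed C" "C \<noteq> {}" "bdd_below C" "bdd_above C"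
      using False by (auto simp: C_def K'_def intro!: closed_Int bdd_belowI[of _ x] bdd_aboveI[of _ y])
    have inC: "Inf C \<in> C" "Sup C \<in> C"
      using closed_contains_Inf[OF C(2,3,1)] closed_contains_Sup[OF C(2,4,1)] by auto
    have "Inf C \<le> z" "z \<le> Sup C" if "z \<in> C" for z
      using that C cInf_lower cSup_upper by blast+
    then have "\<Phi> x = \<Phi> (Inf C)" "\<Phi> (Sup C) = \<Phi> y"
      using xy inC by (intro const; force simp: C_def)+
    moreover have "dist (\<Phi> (Inf C)) (\<Phi> (Sup C)) \<le> L * dist (Inf C) (Sup C)"
      using inC by (intro lipschitz_onD[OF lip']) (auto simp: C_def)
    moreover have "dist (Inf C) (Sup C) \<le> dist x y"
      using inC \<open>\<And>z. z \<in> C \<Longrightarrow> Inf C \<le> z\<close> by (auto simp: C_def dist_real_def)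
    ultimately show ?thesis using L by (metis mult_left_mono order_trans)
  qed
  then show ?thesis
    using L by (intro lipschitz_onI) (metis atLeastAtMost_iff dist_commute linear)
qed

lemma saltus_increment:
  fixes V :: "real \<Rightarrow> 'a::banach"
  assumes "(\<lambda>\<xi>. norm (jump V \<xi>)) summable_on S" and "x \<le> y"
  shows "saltus V S y - saltus V S x = infsum (jump V) (S \<inter> {x<..y})"
    and "norm (saltus V S y - saltus V S x) \<le> infsum (\<lambda>\<xi>. norm (jump V \<xi>)) (S \<inter> {x<..y})"
proof -
  have abs: "(\<lambda>\<xi>. norm (jump V \<xi>)) summable_on A" if "A \<subseteq> S" for A
    using assms(1) that summable_on_subset_banach by blast
  then have sum: "jump V summable_on A" if "A \<subseteq> S" for A
    using that abs_summable_summable by blast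
  have "{z \<in> S. z \<le> y} = {z \<in> S. z \<le> x} \<union> S \<inter> {x<..y}" using assms(2) by auto
  then have "saltus V S y = saltus V S x + infsum (jump V) (S \<inter> {x<..y})"
    unfolding saltus_def by (simp, subst infsum_Un_disjoint) (auto intro!: sum)
  then show eq: "saltus V S y - saltus V S x = infsum (jump V) (S \<inter> {x<..y})" by simp
  show "norm (saltus V S y - saltus V S x) \<le> infsum (\<lambda>\<xi>. norm (jump V \<xi>)) (S \<inter> {x<..y})"
    unfolding eq by (rule norm_infsum_bound[OF abs]) auto
qed

text \<open>
  Up to \<open>\<epsilon>\<close> the absolute sum of the jumps is taken on a finite set, and \<open>t\<close> has a neighbourhood free of
  that set.
\<close>

lemma saltus_continuous_off:
  fixes V :: "real \<Rightarrow> 'a::banach"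
  assumes sum: "(\<lambda>\<xi>. norm (jump V \<xi>)) summable_on S" and "t \<notin> S"
  shows "isCont (saltus V S) t"
proof -
  let ?J = "\<lambda>\<xi>. norm (jump V \<xi>)"
  have sub: "?J summable_on A" if "A \<subseteq> S" for A
    using sum that summable_on_subset_banach by blast
  have "\<exists>d>0. \<forall>s. dist s t < d \<longrightarrow> dist (saltus V S s) (saltus V S t) < \<epsilon>" if "\<epsilon> > 0" for \<epsilon>
  proof -
    have "(?J has_sum infsum ?J S) S" using sum by (rule has_sum_infsum)
    then have "\<forall>\<^sub>F F in finite_subsets_at_top S. dist (sum ?J F) (infsum ?J S) < \<epsilon>"
      unfolding has_sum_def using tendstoD that by blast
    then obtain F where F: "finite F" "F \<subseteq> S" "dist (sum ?J F) (infsum ?J S) < \<epsilon>"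
      unfolding eventually_finite_subsets_at_top by blast
    have "infsum ?J (F \<union> (S - F)) = infsum ?J F + infsum ?J (S - F)"
      by (rule infsum_Un_disjoint) (auto intro!: sub F(2))
    moreover have "F \<union> (S - F) = S" using F(2) by auto
    ultimately have tail: "infsum ?J (S - F) < \<epsilon>"
      using F by (simp add: dist_real_def)
    obtain d where d: "d > 0" "\<And>z. z \<in> F \<Longrightarrow> d \<le> dist t z"
      using finite_set_avoid[OF F(1), of t] F(2) assms(2) by (metis subset_iff)
    have "norm (saltus V S y - saltus V S x) < \<epsilon>"
      if "x \<le> y" "\<And>z. z \<in> {x<..y} \<Longrightarrow> dist t z < d" for x y
    proof -
      have "infsum ?J (S \<inter> {x<..y}) \<le> infsum ?J (S - F)"
      proof (intro infsum_mono2 sub)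
        show "S \<inter> {x<..y} \<subseteq> S - F"
        proof
          fix z assume z: "z \<in> S \<inter> {x<..y}"
          then have "dist t z < d" by (intro that(2)) simp
          then have "z \<notin> F" using d(2)[of z] by auto
          then show "z \<in> S - F" using z by simp
        qed
      qed auto
      then show ?thesis using saltus_increment(2)[OF sum that(1)] tail by linarith
    qed
    note close = this
    have "dist (saltus V S s) (saltus V S t) < \<epsilon>" if "dist s t < d" for s
      using that close[of s t] close[of t s]
      by (cases "s \<le> t") (auto simp: dist_norm norm_minus_commute dist_real_def)
    then show ?thesis using d(1) by blast
  qed
  then show ?thesis unfolding continuous_at_eps_delta by (auto simp: dist_commute)
qed

section \<open>Solutions in a compressive sector\<close>

text \<open>
  All that the structure of a solution \<open>V\<close> in the sector \<open>{a<..<b}\<close> depends on. Condition \<open>shock\<close> is the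
  compressive character of backward sectors: in the direction of increasing \<open>\<xi>\<close> the speed \<open>lam\<close> jumps
  from below \<open>\<xi>\<close> to above it, by an amount comparable to the jump of \<open>V\<close>. The constants \<open>c\<close>, \<open>C\<close> and \<open>D\<close> do not refer to \<open>V\<close>, hence
  the bounds derived from them are uniform.
\<close>

locale compressive_sector =
  fixes f :: "'a::euclidean_space \<Rightarrow> 'a" and e q lam :: "'a \<Rightarrow> real" and P :: "'a set"
    and a b c C D \<tau> :: real and V :: "real \<Rightarrow> 'a"
  assumes compact_P: "compact P" and cont_f: "continuous_on P f" and cont_e: "continuous_on P e"
    and cont_q: "continuous_on P q"
    and lam_range: "X \<in> P \<Longrightarrow> a < lam X \<and> lam X < b"
    and shock: "X \<in> P \<Longrightarrow> Y \<in> P \<Longrightarrow> \<xi> \<in> {a..b} \<Longrightarrow> f Y - f X = \<xi> *\<^sub>R (Y - X) \<Longrightarrow>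
      \<tau> * (q Y - q X - \<xi> * (e Y - e X)) \<le> 0 \<Longrightarrow> X \<noteq> Y \<Longrightarrow>
      c * norm (Y - X) \<le> \<xi> - lam X \<and> c * norm (Y - X) \<le> lam Y - \<xi>"
    and noncharacteristic: "X \<in> P \<Longrightarrow> \<xi> \<in> {a..b} \<Longrightarrow> lam X \<noteq> \<xi> \<Longrightarrow>
      \<exists>d>0. \<exists>\<kappa>>0. \<forall>Y\<in>P \<inter> ball X d. \<forall>Z\<in>P \<inter> ball X d. \<forall>\<zeta>\<in>ball \<xi> d.
        \<kappa> * norm (Z - Y) \<le> norm (f Z - f Y - \<zeta> *\<^sub>R (Z - Y))"
    and secant: "X \<in> P \<Longrightarrow> Y \<in> P \<Longrightarrow> \<xi> \<in> {a..b} \<Longrightarrow>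
      norm (Y - X) \<le> C * (\<bar>lam Y - lam X\<bar> + norm (f Y - f X - \<xi> *\<^sub>R (Y - X)))"
    and c_pos: "0 < c" and C_nonneg: "0 \<le> C"
    and diam_P: "X \<in> P \<Longrightarrow> Y \<in> P \<Longrightarrow> norm (Y - X) \<le> D"
    and V_in_P: "V \<xi> \<in> P" and V_measurable: "V \<in> borel_measurable lebesgue"
    and weak: "x \<le> y \<Longrightarrow> f (V y) - y *\<^sub>R V y - f (V x) + x *\<^sub>R V x = - integral {x..y} V"
    and entropy: "x < y \<Longrightarrow> \<tau> * ((q (V y) - y * e (V y)) - (q (V x) - x * e (V x)))
      \<le> - \<tau> * integral {x..y} (\<lambda>\<xi>. e (V \<xi>))"
begin

lemma D_nonneg: "0 \<le> D"
  using diam_P[OF V_in_P V_in_P] norm_ge_zero order_trans by blast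

lemma V_integrable: "V integrable_on {x..y}"
proof -
  obtain N where "\<And>X. X \<in> P \<Longrightarrow> norm X \<le> N"
    using compact_imp_bounded[OF compact_P] unfolding bounded_iff by blast
  then have "norm (V s) \<le> N" for s using V_in_P by blast
  moreover have "V \<in> borel_measurable (lebesgue_on {x..y})"
    using V_measurable by (rule measurable_restrict_space1)
  ultimately show ?thesis
    using measurable_bounded_by_integrable_imp_integrable[of V "{x..y}" "\<lambda>_. N"] integrable_const_ivl[of N x y]
    by simp
qed

text \<open>
  The weak formulation between \<open>x\<close> and \<open>y\<close>, solved for the secant: the defect equals the integral of
  \<open>V y - V s\<close> over \<open>s\<close>.
\<close>

lemma secant_defect_le:
  assumes "x \<le> y" and "\<And>s. s \<in> {x..y} \<Longrightarrow> norm (V y - V s) \<le> N"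
  shows "norm (f (V y) - f (V x) - x *\<^sub>R (V y - V x)) \<le> (y - x) * N"
proof -
  have "integral {x..y} (\<lambda>s. V y - V s) = (y - x) *\<^sub>R V y - integral {x..y} V"
    using integral_diff[OF integrable_const_ivl[of "V y" x y] V_integrable[of x y]] assms(1) by simp
  also have "\<dots> = f (V y) - f (V x) - x *\<^sub>R (V y - V x)"
    using weak[OF assms(1)] by (simp add: algebra_simps)
  finally show ?thesis
    using norm_integral_le[of x y "\<lambda>s. V y - V s" N] assms order_trans[OF norm_ge_zero assms(2)[of x]]
    by simp
qed

lemma short_integral_tendsto_0:
  fixes g :: "'a \<Rightarrow> 'b::euclidean_space"
  assumes "continuous_on P g" and "\<And>n. s n < t n" and s: "s \<longlonglongrightarrow> \<xi>" and t: "t \<longlonglongrightarrow> \<xi>"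
  shows "(\<lambda>n. integral {s n..t n} (\<lambda>x. g (V x))) \<longlonglongrightarrow> 0"
proof -
  obtain N where N: "\<And>Z. Z \<in> P \<Longrightarrow> norm (g Z) \<le> N"
    using compact_imp_bounded[OF compact_continuous_image[OF assms(1) compact_P]]
    by (auto simp: bounded_iff)
  have gV: "norm (g (V x)) \<le> N" for x using N V_in_P by blast
  then have "0 \<le> N" using norm_ge_zero order_trans by blast
  then have le: "norm (integral {s n..t n} (\<lambda>x. g (V x))) \<le> (t n - s n) * N" for n
    using assms(2)[of n] gV by (intro norm_integral_le) auto
  have lim: "(\<lambda>n. (t n - s n) * N) \<longlonglongrightarrow> 0"
    using tendsto_mult_right[OF tendsto_diff[OF t s], of N] by simp
  show ?thesis by (rule Lim_null_comparison[OF _ lim]) (use le in simp)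
qed

text \<open>
  The conclusion of \<open>shock\<close>, with trivial jumps included so that it is available for any two limits
  of \<open>V\<close> at \<open>\<xi>\<close>.
\<close>

abbreviation "expansive \<xi> X Y \<equiv>
  X = Y \<or> c * norm (Y - X) \<le> \<xi> - lam X \<and> c * norm (Y - X) \<le> lam Y - \<xi>"

text \<open>
  Values approached along points \<open>s < t\<close> that tend to \<open>\<xi>\<close> satisfy the jump condition and the entropy
  inequality in the limit, as the integrals over the shrinking intervals vanish. They form a jump at
  \<open>\<xi>\<close>, whether or not \<open>V\<close> has limits there.
\<close>

lemma limit_states:
  assumes "X \<in> P" "Y \<in> P" "\<xi> \<in> {a..b}"
    and approx: "\<And>d. d > 0 \<Longrightarrow> \<exists>s t. s < t \<and> \<bar>s - \<xi>\<bar> < d \<and> \<bar>t - \<xi>\<bar> < d \<and>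
      dist (V s) X < d \<and> dist (V t) Y < d"
  shows "expansive \<xi> X Y"
proof -
  have "\<exists>s t. s < t \<and> \<bar>s - \<xi>\<bar> < inverse (Suc n) \<and> \<bar>t - \<xi>\<bar> < inverse (Suc n) \<and>
      dist (V s) X < inverse (Suc n) \<and> dist (V t) Y < inverse (Suc n)" for n
    by (rule approx) simp
  then obtain s t where st: "\<And>n. s n < t n" "\<And>n. \<bar>s n - \<xi>\<bar> < inverse (Suc n)"
      "\<And>n. \<bar>t n - \<xi>\<bar> < inverse (Suc n)" "\<And>n. dist (V (s n)) X < inverse (Suc n)"
      "\<And>n. dist (V (t n)) Y < inverse (Suc n)"
    by metis
  have s: "s \<longlonglongrightarrow> \<xi>" and t: "t \<longlonglongrightarrow> \<xi>" and Vs: "(\<lambda>n. V (s n)) \<longlonglongrightarrow> X" and Vt: "(\<lambda>n. V (t n)) \<longlonglongrightarrow> Y"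
    by (rule LIMSEQ_if_dist_less_inverse_Suc, use st in \<open>simp add: dist_real_def\<close>)+
  have comp_s: "(\<lambda>n. g (V (s n))) \<longlonglongrightarrow> g X" if "continuous_on P g" for g :: "'a \<Rightarrow> real"
    using continuous_on_tendsto_compose[OF that Vs assms(1)] V_in_P by simp
  have comp_t: "(\<lambda>n. g (V (t n))) \<longlonglongrightarrow> g Y" if "continuous_on P g" for g :: "'a \<Rightarrow> real"
    using continuous_on_tendsto_compose[OF that Vt assms(2)] V_in_P by simp
  have fs: "(\<lambda>n. f (V (s n))) \<longlonglongrightarrow> f X"
    using continuous_on_tendsto_compose[OF cont_f Vs assms(1)] V_in_P by simp
  have ft: "(\<lambda>n. f (V (t n))) \<longlonglongrightarrow> f Y"
    using continuous_on_tendsto_compose[OF cont_f Vt assms(2)] V_in_P by simp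
  note int = short_integral_tendsto_0[OF _ st(1) s t]
  have "(\<lambda>n. f (V (t n)) - t n *\<^sub>R V (t n) - f (V (s n)) + s n *\<^sub>R V (s n))
      \<longlonglongrightarrow> f Y - \<xi> *\<^sub>R Y - f X + \<xi> *\<^sub>R X"
    by (intro tendsto_intros fs ft s t Vs Vt)
  moreover have "(\<lambda>n. f (V (t n)) - t n *\<^sub>R V (t n) - f (V (s n)) + s n *\<^sub>R V (s n)) \<longlonglongrightarrow> 0"
    using tendsto_minus[OF int[OF continuous_on_id]] weak[OF less_imp_le[OF st(1)]] by simp
  ultimately have "f Y - \<xi> *\<^sub>R Y - f X + \<xi> *\<^sub>R X = 0" by (rule LIMSEQ_unique)
  then have RH: "f Y - f X = \<xi> *\<^sub>R (Y - X)" by (simp add: algebra_simps)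
  have "(\<lambda>n. \<tau> * ((q (V (t n)) - t n * e (V (t n))) - (q (V (s n)) - s n * e (V (s n)))))
      \<longlonglongrightarrow> \<tau> * ((q Y - \<xi> * e Y) - (q X - \<xi> * e X))"
    by (intro tendsto_intros comp_s comp_t cont_q cont_e s t)
  moreover have "(\<lambda>n. - \<tau> * integral {s n..t n} (\<lambda>x. e (V x))) \<longlonglongrightarrow> - \<tau> * 0"
    by (intro tendsto_intros int cont_e)
  ultimately have "\<tau> * ((q Y - \<xi> * e Y) - (q X - \<xi> * e X)) \<le> - \<tau> * 0"
    by (rule LIMSEQ_le) (use entropy[OF st(1)] in auto)
  then have "\<tau> * (q Y - q X - \<xi> * (e Y - e X)) \<le> 0" by (simp add: algebra_simps)
  then show ?thesis using shock[OF assms(1-3) RH] by blast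
qed

text \<open>
  Two consecutive jumps at one point are impossible: the speed at \<open>Y\<close> would have to lie both above and
  below \<open>\<xi>\<close>.
\<close>

lemma limit_states_antisym:
  assumes "X \<in> P" "Y \<in> P" "\<xi> \<in> {a..b}"
    and "expansive \<xi> X Y"
    and "expansive \<xi> Y Z"
  shows "X = Y \<or> Y = Z"
proof (rule ccontr)
  assume "\<not> (X = Y \<or> Y = Z)"
  then have "0 < c * norm (Y - X)" "0 < c * norm (Z - Y)" using c_pos by auto
  then show False using assms(4,5) \<open>\<not> _\<close> by auto
qed

text \<open>
  Two cluster values at the left of \<open>\<xi>\<close> are approached alternately, so either one can be taken as the
  earlier state in \<open>limit_states\<close>.
\<close>

lemma left_limit_exists:
  assumes "\<xi> \<in> {a..b}"
  shows "\<exists>X\<in>P. (V \<longlongrightarrow> X) (at_left \<xi>)"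
proof (rule unique_cluster_point_imp_tendsto[OF compact_P V_in_P trivial_limit_at_left_real])
  have pair: "expansive \<xi> X Y"
    if "X \<in> P" "Y \<in> P" and X: "\<And>d. d > 0 \<Longrightarrow> \<exists>\<^sub>F s in at_left \<xi>. dist (V s) X < d"
      and Y: "\<And>d. d > 0 \<Longrightarrow> \<exists>\<^sub>F s in at_left \<xi>. dist (V s) Y < d" for X Y
  proof (rule limit_states[OF that(1,2) assms])
    have later: "\<exists>s. z < s \<and> s < \<xi> \<and> dist (V s) Z < d"
      if "\<exists>\<^sub>F s in at_left \<xi>. dist (V s) Z < d" "z < \<xi>" for z Z d
      using frequently_eventually_frequently[OF that(1) eventually_at_left_real[OF that(2)]]
      by (auto dest: frequently_ex)
    fix d :: real assume "d > 0"
    then obtain s where s: "\<xi> - d < s" "s < \<xi>" "dist (V s) X < d"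
      using later[OF X, of d "\<xi> - d"] by auto
    then obtain t where "s < t" "t < \<xi>" "dist (V t) Y < d"
      using later[OF Y[OF \<open>d > 0\<close>], of s] by auto
    with s show "\<exists>s t. s < t \<and> \<bar>s - \<xi>\<bar> < d \<and> \<bar>t - \<xi>\<bar> < d \<and> dist (V s) X < d \<and> dist (V t) Y < d"
      by (intro exI[of _ s] exI[of _ t]) auto
  qed
  fix X Y assume "X \<in> P" "Y \<in> P" "\<And>d. d > 0 \<Longrightarrow> \<exists>\<^sub>F s in at_left \<xi>. dist (V s) X < d"
    "\<And>d. d > 0 \<Longrightarrow> \<exists>\<^sub>F s in at_left \<xi>. dist (V s) Y < d"
  then show "X = Y" using limit_states_antisym[OF _ _ assms pair pair, of X Y X] by blast
qed

text \<open>
  As for the left limit, except that now the later point has to be chosen first.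
\<close>

lemma right_limit_exists:
  assumes "\<xi> \<in> {a..b}"
  shows "\<exists>X\<in>P. (V \<longlongrightarrow> X) (at_right \<xi>)"
proof (rule unique_cluster_point_imp_tendsto[OF compact_P V_in_P trivial_limit_at_right_real])
  have pair: "expansive \<xi> X Y"
    if "X \<in> P" "Y \<in> P" and X: "\<And>d. d > 0 \<Longrightarrow> \<exists>\<^sub>F s in at_right \<xi>. dist (V s) X < d"
      and Y: "\<And>d. d > 0 \<Longrightarrow> \<exists>\<^sub>F s in at_right \<xi>. dist (V s) Y < d" for X Y
  proof (rule limit_states[OF that(1,2) assms])
    have earlier: "\<exists>s. \<xi> < s \<and> s < z \<and> dist (V s) Z < d"
      if "\<exists>\<^sub>F s in at_right \<xi>. dist (V s) Z < d" "\<xi> < z" for z Z d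
      using frequently_eventually_frequently[OF that(1) eventually_at_right_real[OF that(2)]]
      by (auto dest: frequently_ex)
    fix d :: real assume "d > 0"
    then obtain t where t: "\<xi> < t" "t < \<xi> + d" "dist (V t) Y < d"
      using earlier[OF Y, of d "\<xi> + d"] by auto
    then obtain s where "\<xi> < s" "s < t" "dist (V s) X < d"
      using earlier[OF X[OF \<open>d > 0\<close>], of t] by auto
    with t show "\<exists>s t. s < t \<and> \<bar>s - \<xi>\<bar> < d \<and> \<bar>t - \<xi>\<bar> < d \<and> dist (V s) X < d \<and> dist (V t) Y < d"
      by (intro exI[of _ s] exI[of _ t]) auto
  qed
  fix X Y assume "X \<in> P" "Y \<in> P" "\<And>d. d > 0 \<Longrightarrow> \<exists>\<^sub>F s in at_right \<xi>. dist (V s) X < d"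
    "\<And>d. d > 0 \<Longrightarrow> \<exists>\<^sub>F s in at_right \<xi>. dist (V s) Y < d"
  then show "X = Y" using limit_states_antisym[OF _ _ assms pair pair, of X Y X] by blast
qed

abbreviation "Vm \<xi> \<equiv> Lim (at_left \<xi>) V"
abbreviation "Vp \<xi> \<equiv> Lim (at_right \<xi>) V"

lemma one_sided_limits:
  assumes "\<xi> \<in> {a..b}"
  shows "(V \<longlongrightarrow> Vm \<xi>) (at_left \<xi>)" "(V \<longlongrightarrow> Vp \<xi>) (at_right \<xi>)" "Vm \<xi> \<in> P" "Vp \<xi> \<in> P"
proof -
  obtain X where X: "X \<in> P" "(V \<longlongrightarrow> X) (at_left \<xi>)" using left_limit_exists[OF assms] by (rule bexE)
  obtain Y where Y: "Y \<in> P" "(V \<longlongrightarrow> Y) (at_right \<xi>)" using right_limit_exists[OF assms] by (rule bexE)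
  have "Vm \<xi> = X" "Vp \<xi> = Y"
    using tendsto_Lim[OF trivial_limit_at_left_real X(2)] tendsto_Lim[OF trivial_limit_at_right_real Y(2)] .
  then show "(V \<longlongrightarrow> Vm \<xi>) (at_left \<xi>)" "(V \<longlongrightarrow> Vp \<xi>) (at_right \<xi>)" "Vm \<xi> \<in> P" "Vp \<xi> \<in> P"
    using X Y by simp_all
qed

lemma near_left_limit:
  assumes "\<xi> \<in> {a..b}" "d > 0"
  shows "\<exists>s. \<xi> - d < s \<and> s < \<xi> \<and> dist (V s) (Vm \<xi>) < d"
proof -
  have "\<forall>\<^sub>F s in at_left \<xi>. dist (V s) (Vm \<xi>) < d \<and> s \<in> {\<xi> - d<..<\<xi>}"
    using tendstoD[OF one_sided_limits(1)[OF assms(1)] assms(2)] eventually_at_left_real[of "\<xi> - d" \<xi>] assms(2)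
    by (intro eventually_conj) auto
  then show ?thesis using eventually_happens'[OF trivial_limit_at_left_real] by fastforce
qed

lemma near_right_limit:
  assumes "\<xi> \<in> {a..b}" "d > 0"
  shows "\<exists>s. \<xi> < s \<and> s < \<xi> + d \<and> dist (V s) (Vp \<xi>) < d"
proof -
  have "\<forall>\<^sub>F s in at_right \<xi>. dist (V s) (Vp \<xi>) < d \<and> s \<in> {\<xi><..<\<xi> + d}"
    using tendstoD[OF one_sided_limits(2)[OF assms(1)] assms(2)] eventually_at_right_real[of \<xi> "\<xi> + d"] assms(2)
    by (intro eventually_conj) auto
  then show ?thesis using eventually_happens'[OF trivial_limit_at_right_real] by fastforce
qed

text \<open>
  The value at \<open>\<xi>\<close> itself is constrained as well: it cannot be the intermediate state of two jumps.
\<close>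

lemma jump_speeds:
  assumes \<xi>: "\<xi> \<in> {a..b}"
  shows "expansive \<xi> (Vm \<xi>) (Vp \<xi>)"
    and "V \<xi> = Vm \<xi> \<or> V \<xi> = Vp \<xi>"
proof -
  note lims = one_sided_limits[OF \<xi>]
  show "expansive \<xi> (Vm \<xi>) (Vp \<xi>)"
  proof (rule limit_states[OF lims(3,4) \<xi>])
    fix d :: real assume d: "d > 0"
    obtain s where "\<xi> - d < s" "s < \<xi>" "dist (V s) (Vm \<xi>) < d" using near_left_limit[OF \<xi> d] by auto
    moreover obtain t where "\<xi> < t" "t < \<xi> + d" "dist (V t) (Vp \<xi>) < d" using near_right_limit[OF \<xi> d] by auto
    ultimately show "\<exists>s t. s < t \<and> \<bar>s - \<xi>\<bar> < d \<and> \<bar>t - \<xi>\<bar> < d \<and> dist (V s) (Vm \<xi>) < d \<and> dist (V t) (Vp \<xi>) < d"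
      by (intro exI[of _ s] exI[of _ t]) auto
  qed
  have "expansive \<xi> (Vm \<xi>) (V \<xi>)"
  proof (rule limit_states[OF lims(3) V_in_P \<xi>])
    fix d :: real assume d: "d > 0"
    obtain s where "\<xi> - d < s" "s < \<xi>" "dist (V s) (Vm \<xi>) < d" using near_left_limit[OF \<xi> d] by auto
    then show "\<exists>s t. s < t \<and> \<bar>s - \<xi>\<bar> < d \<and> \<bar>t - \<xi>\<bar> < d \<and> dist (V s) (Vm \<xi>) < d \<and> dist (V t) (V \<xi>) < d"
      using d by (intro exI[of _ s] exI[of _ \<xi>]) auto
  qed
  moreover have "expansive \<xi> (V \<xi>) (Vp \<xi>)"
  proof (rule limit_states[OF V_in_P lims(4) \<xi>])
    fix d :: real assume d: "d > 0"
    obtain t where "\<xi> < t" "t < \<xi> + d" "dist (V t) (Vp \<xi>) < d" using near_right_limit[OF \<xi> d] by auto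
    then show "\<exists>s t. s < t \<and> \<bar>s - \<xi>\<bar> < d \<and> \<bar>t - \<xi>\<bar> < d \<and> dist (V s) (V \<xi>) < d \<and> dist (V t) (Vp \<xi>) < d"
      using d by (intro exI[of _ \<xi>] exI[of _ t]) auto
  qed
  ultimately show "V \<xi> = Vm \<xi> \<or> V \<xi> = Vp \<xi>"
    using limit_states_antisym[OF lims(3) V_in_P \<xi>] by metis
qed

lemma isCont_iff_no_jump:
  assumes "\<xi> \<in> {a..b}"
  shows "isCont V \<xi> \<longleftrightarrow> Vm \<xi> = Vp \<xi>"
proof
  assume "isCont V \<xi>"
  then have "(V \<longlongrightarrow> V \<xi>) (at_left \<xi>)" "(V \<longlongrightarrow> V \<xi>) (at_right \<xi>)"
    by (simp_all add: isCont_def filterlim_at_split)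
  then show "Vm \<xi> = Vp \<xi>"
    using tendsto_Lim[OF trivial_limit_at_left_real] tendsto_Lim[OF trivial_limit_at_right_real] by metis
next
  assume "Vm \<xi> = Vp \<xi>"
  then show "isCont V \<xi>"
    using jump_speeds(2)[OF assms] one_sided_limits[OF assms] by (auto simp: isCont_def filterlim_at_split)
qed

lemma discontinuity_speeds:
  assumes "\<xi> \<in> {a..b}" "\<not> isCont V \<xi>"
  shows "c * norm (jump V \<xi>) \<le> \<xi> - lam (Vm \<xi>)" "c * norm (jump V \<xi>) \<le> lam (Vp \<xi>) - \<xi>"
    and "0 < norm (jump V \<xi>)" "lam (Vm \<xi>) < \<xi>" "\<xi> < lam (Vp \<xi>)" "\<xi> \<in> {a<..<b}"
proof -
  have ne: "Vm \<xi> \<noteq> Vp \<xi>" using assms isCont_iff_no_jump by simp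
  then show le: "c * norm (jump V \<xi>) \<le> \<xi> - lam (Vm \<xi>)" "c * norm (jump V \<xi>) \<le> lam (Vp \<xi>) - \<xi>"
    using jump_speeds(1)[OF assms(1)] by (auto simp: jump_def)
  show "0 < norm (jump V \<xi>)" using ne by (simp add: jump_def)
  then have "0 < c * norm (jump V \<xi>)" using c_pos by simp
  with le show "lam (Vm \<xi>) < \<xi>" "\<xi> < lam (Vp \<xi>)" by linarith+
  then show "\<xi> \<in> {a<..<b}"
    using lam_range[OF one_sided_limits(3)[OF assms(1)]] lam_range[OF one_sided_limits(4)[OF assms(1)]] by auto
qed

text \<open>
  Near a noncharacteristic state the secant defect bounds the increment of \<open>V\<close> from above, and it is
  at most the length of the interval times the oscillation of \<open>V\<close>. On a short interval the oscillation is therefore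
  at most half of itself.
\<close>

lemma constant_where_noncharacteristic:
  assumes "X \<in> P" "\<xi> \<in> {a..b}" "lam X \<noteq> \<xi>"
  shows "\<exists>d>0. \<forall>x y. x \<le> y \<longrightarrow> {x..y} \<subseteq> ball \<xi> d \<longrightarrow> V ` {x..y} \<subseteq> ball X d \<longrightarrow> V x = V y"
proof -
  obtain d \<kappa> where d: "d > 0" and \<kappa>: "\<kappa> > 0"
    and lower: "\<And>Y Z \<zeta>. Y \<in> P \<inter> ball X d \<Longrightarrow> Z \<in> P \<inter> ball X d \<Longrightarrow> \<zeta> \<in> ball \<xi> d \<Longrightarrow>
      \<kappa> * norm (Z - Y) \<le> norm (f Z - f Y - \<zeta> *\<^sub>R (Z - Y))"
    using noncharacteristic[OF assms] by blast
  \<comment> \<open>The interval then is no longer than \<open>\<kappa> / 2\<close>, which gives the contraction factor \<open>1 / 2\<close>.\<close>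
  define d' where "d' = min d (\<kappa> / 4)"
  have "V x = V y" if xy: "x \<le> y" "{x..y} \<subseteq> ball \<xi> d'" "V ` {x..y} \<subseteq> ball X d'" for x y
  proof -
    have len: "y - x \<le> \<kappa> / 2"
    proof -
      have "dist \<xi> x < \<kappa> / 4" "dist \<xi> y < \<kappa> / 4"
        using xy by (auto simp: subset_iff d'_def)
      then show ?thesis by (simp add: dist_real_def abs_if split: if_splits)
    qed
    \<comment> \<open>Iterating the contraction avoids a supremum; \<open>D\<close> bounds the oscillation at the start.\<close>
    have decay: "norm (V t - V s) \<le> D * (1 / 2) ^ n" if "s \<in> {x..y}" "t \<in> {x..y}" "s \<le> t" for n s t
      using that
    proof (induction n arbitrary: s t)
      case 0
      then show ?case using diam_P V_in_P by simp
    next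
      case (Suc n)
      have "\<kappa> * norm (V t - V s) \<le> norm (f (V t) - f (V s) - s *\<^sub>R (V t - V s))"
        using Suc.prems xy V_in_P by (intro lower) (auto simp: subset_iff d'_def)
      also have "\<dots> \<le> (t - s) * (D * (1 / 2) ^ n)"
        using Suc.prems by (intro secant_defect_le Suc.IH) auto
      also have "\<dots> \<le> \<kappa> / 2 * (D * (1 / 2) ^ n)"
        using Suc.prems len D_nonneg by (intro mult_right_mono) auto
      finally have "\<kappa> * norm (V t - V s) \<le> \<kappa> * (D * (1 / 2) ^ Suc n)" by simp
      then show ?case using \<kappa> by (simp only: mult_le_cancel_left_pos)
    qed
    have "(\<lambda>n. D * (1 / 2) ^ n) \<longlonglongrightarrow> D * 0" by (intro tendsto_mult_left LIMSEQ_power_zero) simp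
    then have "norm (V y - V x) \<le> D * 0"
      by (rule LIMSEQ_le_const) (use decay[of x y] xy in auto)
    then show ?thesis by simp
  qed
  moreover have "d' > 0" using d \<kappa> by (simp add: d'_def)
  ultimately show ?thesis by blast
qed

lemma constant_right_nearby:
  assumes \<xi>: "\<xi> \<in> {a..b}" and "lam (Vp \<xi>) \<noteq> \<xi>"
  shows "\<exists>h>0. \<forall>x\<in>{\<xi><..<\<xi> + h}. V x = Vp \<xi>"
proof -
  note lims = one_sided_limits[OF \<xi>]
  obtain d where d: "d > 0" "\<And>x y. x \<le> y \<Longrightarrow> {x..y} \<subseteq> ball \<xi> d \<Longrightarrow> V ` {x..y} \<subseteq> ball (Vp \<xi>) d \<Longrightarrow> V x = V y"
    using constant_where_noncharacteristic[OF lims(4) \<xi> assms(2)] by blast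
  have "\<forall>\<^sub>F s in at_right \<xi>. dist (V s) (Vp \<xi>) < d" using tendstoD[OF lims(2) d(1)] .
  then obtain h' where h': "h' > \<xi>" "\<And>s. \<xi> < s \<Longrightarrow> s < h' \<Longrightarrow> dist (V s) (Vp \<xi>) < d"
    unfolding eventually_at_right_field by blast
  define h where "h = min d (h' - \<xi>)"
  have eq: "V x = V y" if "x \<le> y" "\<xi> < x" "y < \<xi> + h" for x y
    using that h' by (intro d(2)) (auto simp: h_def dist_real_def dist_commute[of "Vp \<xi>"])
  have h: "h > 0" using d h' by (simp add: h_def)
  have "V x = Vp \<xi>" if x: "x \<in> {\<xi><..<\<xi> + h}" for x
  proof -
    have "\<forall>\<^sub>F s in at_right \<xi>. V s = V x"
      using eventually_at_right_real[of \<xi> x] x by (auto elim!: eventually_mono intro: eq)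
    then have "(V \<longlongrightarrow> V x) (at_right \<xi>)" by (rule tendsto_eventually)
    then show ?thesis using lims(2) tendsto_unique trivial_limit_at_right_real by blast
  qed
  with h show ?thesis by blast
qed

lemma constant_left_nearby:
  assumes \<xi>: "\<xi> \<in> {a..b}" and "lam (Vm \<xi>) \<noteq> \<xi>"
  shows "\<exists>h>0. \<forall>x\<in>{\<xi> - h<..<\<xi>}. V x = Vm \<xi>"
proof -
  note lims = one_sided_limits[OF \<xi>]
  obtain d where d: "d > 0" "\<And>x y. x \<le> y \<Longrightarrow> {x..y} \<subseteq> ball \<xi> d \<Longrightarrow> V ` {x..y} \<subseteq> ball (Vm \<xi>) d \<Longrightarrow> V x = V y"
    using constant_where_noncharacteristic[OF lims(3) \<xi> assms(2)] by blast
  have "\<forall>\<^sub>F s in at_left \<xi>. dist (V s) (Vm \<xi>) < d" using tendstoD[OF lims(1) d(1)] .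
  then obtain h' where h': "h' < \<xi>" "\<And>s. h' < s \<Longrightarrow> s < \<xi> \<Longrightarrow> dist (V s) (Vm \<xi>) < d"
    unfolding eventually_at_left_field by blast
  define h where "h = min d (\<xi> - h')"
  have eq: "V x = V y" if "x \<le> y" "\<xi> - h < x" "y < \<xi>" for x y
    using that h' by (intro d(2)) (auto simp: h_def dist_real_def dist_commute[of "Vm \<xi>"])
  have h: "h > 0" using d h' by (simp add: h_def)
  have "V x = Vm \<xi>" if x: "x \<in> {\<xi> - h<..<\<xi>}" for x
  proof -
    have "\<forall>\<^sub>F s in at_left \<xi>. V s = V x"
      using eventually_at_left_real[of x \<xi>] x by (auto elim!: eventually_mono intro: eq[symmetric])
    then have "(V \<longlongrightarrow> V x) (at_left \<xi>)" by (rule tendsto_eventually)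
    then show ?thesis using lims(1) tendsto_unique trivial_limit_at_left_real by blast
  qed
  with h show ?thesis by blast
qed

text \<open>
  Let \<open>\<zeta>\<close> be the end of the interval of constancy. As long as \<open>\<zeta>\<close> is below the speed of the constant
  state, a jump at \<open>\<zeta>\<close> would start from a speed that is too high. So \<open>V\<close> is continuous and noncharacteristic
  at \<open>\<zeta>\<close>, and the constancy continues.
\<close>

lemma constant_right_of_jump:
  assumes \<xi>: "\<xi> \<in> {a..b}" and fast: "\<xi> < lam (Vp \<xi>)" and x: "\<xi> < x" "x < lam (Vp \<xi>)"
  shows "V x = Vp \<xi>"
proof -
  define Y where "Y = Vp \<xi>"
  have Y: "Y \<in> P" "lam Y < b" using one_sided_limits(4)[OF \<xi>] lam_range by (auto simp: Y_def)
  define T where "T = {z. \<xi> < z \<and> z \<le> lam Y \<and> (\<forall>x\<in>{\<xi><..<z}. V x = Y)}"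
  obtain h where h: "h > 0" "\<forall>x\<in>{\<xi><..<\<xi> + h}. V x = Y"
    using constant_right_nearby[OF \<xi>] fast by (auto simp: Y_def)
  have T0: "min (\<xi> + h) (lam Y) \<in> T" using h fast by (auto simp: T_def Y_def)
  have bdd: "bdd_above T" by (rule bdd_aboveI[of _ "lam Y"]) (simp add: T_def)
  define \<zeta> where "\<zeta> = Sup T"
  have \<zeta>: "\<xi> < \<zeta>" "\<zeta> \<le> lam Y"
  proof -
    have "min (\<xi> + h) (lam Y) \<le> \<zeta>" unfolding \<zeta>_def using T0 bdd by (rule cSup_upper)
    then show "\<xi> < \<zeta>" using h(1) fast by (auto simp: Y_def)
    have "T \<noteq> {}" using T0 by blast
    then show "\<zeta> \<le> lam Y" unfolding \<zeta>_def by (rule cSup_least) (simp add: T_def)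
  qed
  have below: "V x = Y" if x: "\<xi> < x" "x < \<zeta>" for x
  proof -
    have "T \<noteq> {}" using T0 by blast
    then obtain z where "z \<in> T" "x < z" using x(2) less_cSup_iff[OF _ bdd] by (auto simp: \<zeta>_def)
    then show ?thesis using x(1) by (simp add: T_def)
  qed
  have "\<not> \<zeta> < lam Y"
  proof
    assume lt: "\<zeta> < lam Y"
    have \<zeta>_in: "\<zeta> \<in> {a..b}" using \<xi> \<zeta> Y by auto
    have "\<forall>\<^sub>F s in at_left \<zeta>. V s = Y"
      using eventually_at_left_real[OF \<zeta>(1)] by (auto elim!: eventually_mono intro: below)
    then have "(V \<longlongrightarrow> Y) (at_left \<zeta>)" by (rule tendsto_eventually)
    then have Vm: "Vm \<zeta> = Y" by (rule tendsto_Lim[OF trivial_limit_at_left_real])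
    have cont: "isCont V \<zeta>"
      using discontinuity_speeds(4)[OF \<zeta>_in] lt Vm by force
    then have Vp: "Vp \<zeta> = Y" using isCont_iff_no_jump[OF \<zeta>_in] Vm by simp
    then have "V \<zeta> = Y" using jump_speeds(2)[OF \<zeta>_in] Vm by auto
    obtain h where h: "h > 0" "\<forall>x\<in>{\<zeta><..<\<zeta> + h}. V x = Y"
      using constant_right_nearby[OF \<zeta>_in] lt Vp by auto
    have "min (\<zeta> + h) (lam Y) \<in> T"
      unfolding T_def
    proof (intro CollectI conjI ballI)
      show "V x = Y" if "x \<in> {\<xi><..<min (\<zeta> + h) (lam Y)}" for x
        using that below h(2) \<open>V \<zeta> = Y\<close> by (cases x \<zeta> rule: linorder_cases) auto
    qed (use \<zeta> lt h in auto)
    then have "min (\<zeta> + h) (lam Y) \<le> \<zeta>" unfolding \<zeta>_def using bdd by (rule cSup_upper)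
    then show False using lt h(1) by auto
  qed
  then show ?thesis using below[of x] x \<zeta>(2) by (simp add: Y_def)
qed

definition "S = jump_set V {a<..<b}"

lemma S_iff: "z \<in> S \<longleftrightarrow> z \<in> {a..b} \<and> \<not> isCont V z"
  using discontinuity_speeds(6) by (auto simp: S_def jump_set_def)

lemma isCont_if_constant_nearby:
  assumes "\<And>y. x < y \<Longrightarrow> y < z \<Longrightarrow> V y = Y" and "x < y" "y < z"
  shows "isCont V y"
proof -
  have "\<forall>\<^sub>F s in at y. V s = Y"
    using assms by (auto simp: eventually_at_topological intro!: exI[of _ "{x<..<z}"])
  then have "(V \<longlongrightarrow> Y) (at y)" by (rule tendsto_eventually)
  then show ?thesis using assms by (simp add: isCont_def)
qed

text \<open>
  The interval of constancy after a jump contains neither a jump nor a point where the speed equals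
  \<open>\<xi>\<close>, and it ends before \<open>b\<close>. Its length is the excess of the speed over \<open>\<xi>\<close>, which is at least \<open>c\<close> times
  the jump.
\<close>

lemma jumps_separated:
  assumes "z \<in> S" "z < z'" "z' \<in> S \<or> lam (V z') = z' \<and> z' \<le> b \<or> z' = b"
  shows "z + c * norm (jump V z) \<le> z'"
proof -
  have z: "z \<in> {a..b}" "\<not> isCont V z" using assms(1) by (simp_all add: S_iff)
  note speeds = discontinuity_speeds[OF z]
  have "lam (Vp z) \<le> z'"
  proof (rule ccontr)
    assume "\<not> lam (Vp z) \<le> z'"
    then have lt: "z' < lam (Vp z)" by simp
    have const: "V y = Vp z" if "z < y" "y < lam (Vp z)" for y
      using constant_right_of_jump[OF z(1) speeds(5) that] .
    have "isCont V z'" using isCont_if_constant_nearby[OF const assms(2) lt] by blast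
    then have "z' \<notin> S" by (simp add: S_iff)
    moreover have "lam (V z') \<noteq> z'" using const[OF assms(2) lt] lt by simp
    moreover have "z' \<noteq> b" using lt lam_range[OF one_sided_limits(4)[OF z(1)]] by simp
    ultimately show False using assms(3) by blast
  qed
  then show ?thesis using speeds(2) by linarith
qed

text \<open>
  The condition on \<open>y\<close> makes the interval of constancy after every jump end no later than \<open>y\<close>.
\<close>

lemma sum_jumps_le:
  assumes "finite F" "F \<subseteq> S \<inter> {x<..y}" "x \<le> y" "y \<notin> S" "lam (V y) = y \<and> y \<le> b \<or> y = b"
  shows "(\<Sum>z\<in>F. norm (jump V z)) \<le> (y - x) / c"
proof -
  have "(\<Sum>z\<in>F. c * norm (jump V z)) \<le> y - x"
  proof (rule sum_gaps_le[OF assms(1)])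
    fix z assume z: "z \<in> F"
    then have "z \<in> S" "x < z" "z < y" using assms(2,4) by (auto simp: order_less_le)
    then show "x \<le> z \<and> z + c * norm (jump V z) \<le> y" using jumps_separated[of z y] assms(5) by auto
  qed (use assms jumps_separated in auto)
  then have "c * (\<Sum>z\<in>F. norm (jump V z)) \<le> y - x" by (simp add: sum_distrib_left)
  then show ?thesis using c_pos by (simp add: field_simps)
qed

lemma b_notin_S: "b \<notin> S" and S_in: "S \<subseteq> {a<..<b}"
  by (auto simp: S_def jump_set_def)

lemma jumps_summable: "(\<lambda>z. norm (jump V z)) summable_on S"
  and total_jump_le: "a \<le> b \<Longrightarrow> infsum (\<lambda>z. norm (jump V z)) S \<le> (b - a) / c"
proof -
  have bound: "(\<Sum>z\<in>F. norm (jump V z)) \<le> (b - a) / c" if "finite F" "F \<subseteq> S" "a \<le> b" for F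
    using sum_jumps_le[of F a b] that S_in b_notin_S by fastforce
  have ab: "a \<le> b" using lam_range[OF V_in_P] by (metis less_imp_le less_trans)
  show summable: "(\<lambda>z. norm (jump V z)) summable_on S"
    using bound ab by (intro nonneg_bdd_above_summable_on bdd_aboveI[of _ "(b - a) / c"]) auto
  show "infsum (\<lambda>z. norm (jump V z)) S \<le> (b - a) / c" if "a \<le> b"
    using bound that by (intro infsum_le_finite_sums[OF summable])
qed

lemma jump_isolated:
  assumes "z \<in> S"
  obtains h where "h > 0" "\<And>x. z - h < x \<Longrightarrow> x < z \<Longrightarrow> V x = Vm z"
    "\<And>x. z < x \<Longrightarrow> x < z + h \<Longrightarrow> V x = Vp z" "\<And>x. x \<in> S \<Longrightarrow> \<bar>x - z\<bar> < h \<Longrightarrow> x = z"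
proof -
  have z: "z \<in> {a..b}" "\<not> isCont V z" using assms by (simp_all add: S_iff)
  note speeds = discontinuity_speeds[OF z]
  obtain h1 where h1: "h1 > 0" "\<forall>x\<in>{z<..<z + h1}. V x = Vp z"
    using constant_right_nearby[OF z(1)] speeds(5) by auto
  obtain h2 where h2: "h2 > 0" "\<forall>x\<in>{z - h2<..<z}. V x = Vm z"
    using constant_left_nearby[OF z(1)] speeds(4) by auto
  define h where "h = min h1 h2"
  have left: "V x = Vm z" if "z - h < x" "x < z" for x using that h2 by (simp add: h_def)
  have right: "V x = Vp z" if "z < x" "x < z + h" for x using that h1 by (simp add: h_def)
  have "x = z" if "x \<in> S" "\<bar>x - z\<bar> < h" for x
  proof (cases x z rule: linorder_cases)
    case less
    then have "isCont V x" using that by (intro isCont_if_constant_nearby[of "z - h" z "Vm z" x] left) auto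
    then show ?thesis using that by (simp add: S_iff)
  next
    case greater
    then have "isCont V x" using that by (intro isCont_if_constant_nearby[of z "z + h" "Vp z" x] right) auto
    then show ?thesis using that by (simp add: S_iff)
  qed
  moreover have "h > 0" using h1 h2 by (simp add: h_def)
  ultimately show ?thesis using that left right by blast
qed

theorem saltus_part_well_defined: "saltus_well_defined V S"
  unfolding saltus_well_defined_def
proof (intro conjI ballI jumps_summable)
  show "discrete S"
    unfolding discrete_def isolated_in_dist_Ex_iff
    by (metis abs_minus_commute dist_real_def jump_isolated)
  show "\<exists>l. (V \<longlongrightarrow> l) (at_right \<xi>)" "\<exists>l. (V \<longlongrightarrow> l) (at_left \<xi>)" if "\<xi> \<in> S" for \<xi>
    using one_sided_limits[of \<xi>] that by (auto simp: S_iff)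
qed

text \<open>
  The part \<open>V\<^sub>L\<close> of the decomposition.
\<close>

definition "\<Phi> \<xi> = right_modification V S \<xi> - saltus V S \<xi>"

lemma constant_at_noncharacteristic_continuity:
  assumes t: "t \<in> {a..b}" "t \<notin> S" "lam (V t) \<noteq> t"
  obtains h where "h > 0" "\<And>x. \<bar>x - t\<bar> < h \<Longrightarrow> V x = V t" "\<And>x. \<bar>x - t\<bar> < h \<Longrightarrow> x \<notin> S"
proof -
  have cont: "isCont V t" using t by (simp add: S_iff)
  then have eq: "Vm t = V t" "Vp t = V t"
    using isCont_iff_no_jump[OF t(1)] jump_speeds(2)[OF t(1)] by auto
  obtain h1 where h1: "h1 > 0" "\<forall>x\<in>{t<..<t + h1}. V x = V t"
    using constant_right_nearby[OF t(1)] t(3) eq by auto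
  obtain h2 where h2: "h2 > 0" "\<forall>x\<in>{t - h2<..<t}. V x = V t"
    using constant_left_nearby[OF t(1)] t(3) eq by auto
  define h where "h = min h1 h2"
  have const: "V x = V t" if "t - h < x" "x < t + h" for x
    using that h1 h2 by (cases x t rule: linorder_cases) (auto simp: h_def)
  have "isCont V x" if "\<bar>x - t\<bar> < h" for x
    using that by (intro isCont_if_constant_nearby[of "t - h" "t + h" "V t" x] const) auto
  then have "x \<notin> S" if "\<bar>x - t\<bar> < h" for x using that by (simp add: S_iff)
  moreover have "h > 0" using h1 h2 by (simp add: h_def)
  moreover have "V x = V t" if "\<bar>x - t\<bar> < h" for x using that by (intro const) auto
  ultimately show ?thesis using that by blast
qed

lemma saltus_eq_if_no_jump_between:
  assumes "x \<le> y" "S \<inter> {x<..y} = {}"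
  shows "saltus V S x = saltus V S y"
  using saltus_increment(1)[OF jumps_summable assms(1)] assms(2) by simp

text \<open>
  \<open>V\<close> is constant on both sides of a jump, and the jump itself is cancelled by the saltus function. At
  the other points considered here \<open>V\<close> is constant nearby.
\<close>

lemma \<Phi>_locally_constant:
  assumes t: "t \<in> {a..b}" "\<not> (t \<notin> S \<and> lam (V t) = t)"
  shows "\<exists>d>0. \<forall>s\<in>{a..b}. \<bar>s - t\<bar> < d \<longrightarrow> \<Phi> s = \<Phi> t"
proof (cases "t \<in> S")
  case True
  obtain h where h: "h > 0" "\<And>x. t - h < x \<Longrightarrow> x < t \<Longrightarrow> V x = Vm t"
    "\<And>x. t < x \<Longrightarrow> x < t + h \<Longrightarrow> V x = Vp t" "\<And>x. x \<in> S \<Longrightarrow> \<bar>x - t\<bar> < h \<Longrightarrow> x = t"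
    using jump_isolated[OF True] by blast
  have "\<Phi> s = \<Phi> t" if s: "\<bar>s - t\<bar> < h" for s
  proof (cases s t rule: linorder_cases)
    case less
    have "S \<inter> {s<..t} = {t}" using less s h(4) True by fastforce
    then have "saltus V S t = saltus V S s + (Vp t - Vm t)"
      using saltus_increment(1)[OF jumps_summable, of s t] less by (simp add: jump_def algebra_simps)
    moreover have "s \<notin> S" using h(4)[of s] less s by auto
    ultimately show ?thesis
      using h(2)[of s] less s True by (simp add: \<Phi>_def right_modification_def)
  next
    case greater
    have "S \<inter> {t<..s} = {}" using greater s h(4) by fastforce
    then have "saltus V S t = saltus V S s" using greater by (intro saltus_eq_if_no_jump_between) auto
    moreover have "s \<notin> S" using h(4)[of s] greater s by auto
    ultimately show ?thesis
      using h(3)[of s] greater s True by (simp add: \<Phi>_def right_modification_def)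
  qed simp
  then show ?thesis using h(1) by blast
next
  case False
  then obtain h where h: "h > 0" "\<And>x. \<bar>x - t\<bar> < h \<Longrightarrow> V x = V t" "\<And>x. \<bar>x - t\<bar> < h \<Longrightarrow> x \<notin> S"
    using constant_at_noncharacteristic_continuity t by metis
  have "\<Phi> s = \<Phi> t" if s: "\<bar>s - t\<bar> < h" for s
  proof -
    have "z \<notin> S" if "min s t < z" "z \<le> max s t" for z
    proof (rule h(3))
      show "\<bar>z - t\<bar> < h" using that s by linarith
    qed
    then have "S \<inter> {min s t<..max s t} = {}" by fastforce
    then have "saltus V S (min s t) = saltus V S (max s t)"
      by (rule saltus_eq_if_no_jump_between[rotated]) simp
    then have "saltus V S s = saltus V S t"
      by (cases "s \<le> t") (simp_all add: min_def max_def split: if_splits)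
    then show ?thesis
      using h(2)[OF s] h(3)[OF s] False by (simp add: \<Phi>_def right_modification_def)
  qed
  then show ?thesis using h(1) by blast
qed

lemma right_modification_continuous_off:
  assumes t: "t \<in> {a..b}" "t \<notin> S"
  shows "isCont (right_modification V S) t"
  unfolding continuous_at_eps_delta
proof (intro allI impI)
  fix \<epsilon> :: real assume "\<epsilon> > 0"
  have "isCont V t" using t by (simp add: S_iff)
  then obtain d where d: "d > 0" "\<And>s. dist s t < d \<Longrightarrow> dist (V s) (V t) < \<epsilon> / 2"
    unfolding continuous_at_eps_delta using \<open>\<epsilon> > 0\<close> by (metis dist_commute half_gt_zero)
  have "dist (right_modification V S s) (V t) \<le> \<epsilon> / 2" if s: "dist s t < d" for s
  proof (cases "s \<in> S")
    case True
    have "(V \<longlongrightarrow> Vp s) (at_right s)" using True one_sided_limits(2)[of s] by (simp add: S_iff)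
    then have "((\<lambda>x. dist (V x) (V t)) \<longlongrightarrow> dist (Vp s) (V t)) (at_right s)"
      by (intro tendsto_intros)
    moreover have "\<forall>\<^sub>F x in at_right s. x \<in> {s<..<t + d}"
      using s by (intro eventually_at_right_real) (auto simp: dist_real_def)
    then have "\<forall>\<^sub>F x in at_right s. dist (V x) (V t) \<le> \<epsilon> / 2"
      by eventually_elim (use s d(2) in \<open>force simp: dist_real_def intro: less_imp_le\<close>)
    ultimately have "dist (Vp s) (V t) \<le> \<epsilon> / 2"
      by (rule tendsto_upperbound) simp
    then show ?thesis using True by (simp add: right_modification_def)
  next
    case False
    then show ?thesis using d(2)[OF s] by (simp add: right_modification_def)
  qed
  moreover have "right_modification V S t = V t" using t(2) by (simp add: right_modification_def)
  ultimately show "\<exists>d>0. \<forall>s. dist s t < d \<longrightarrow>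
      dist (right_modification V S s) (right_modification V S t) < \<epsilon>"
    using d(1) \<open>\<epsilon> > 0\<close> by (intro exI[of _ d]) fastforce
qed

lemma \<Phi>_continuous: "continuous_on {a..b} \<Phi>"
proof (rule continuous_at_imp_continuous_on, rule ballI)
  fix t assume t: "t \<in> {a..b}"
  show "isCont \<Phi> t"
  proof (cases "t \<in> S")
    case True
    then have "\<exists>d>0. \<forall>s\<in>{a..b}. \<bar>s - t\<bar> < d \<longrightarrow> \<Phi> s = \<Phi> t"
      using t by (intro \<Phi>_locally_constant) auto
    then obtain d where d: "d > 0" "\<And>s. s \<in> {a..b} \<Longrightarrow> \<bar>s - t\<bar> < d \<Longrightarrow> \<Phi> s = \<Phi> t" by blast
    have "\<forall>\<^sub>F s in at t. \<Phi> s = \<Phi> t"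
      unfolding eventually_at_topological using True S_in d
      by (intro exI[of _ "{a<..<b} \<inter> ball t d"]) (auto simp: dist_real_def abs_minus_commute)
    then show ?thesis unfolding isCont_def by (rule tendsto_eventually)
  next
    case False
    then show ?thesis
      unfolding \<Phi>_def using t
      by (intro continuous_diff right_modification_continuous_off saltus_continuous_off jumps_summable)
  qed
qed

text \<open>
  On the points of continuity with \<open>lam (V t) = t\<close> the increments of \<open>V\<close> are bounded by \<open>secant\<close>, in
  which the increment of the speed is just \<open>y - x\<close>, and those of the saltus function by \<open>sum_jumps_le\<close>.
\<close>

theorem remainder_lipschitz: "(C * (1 + D) + 1 / c)-lipschitz_on {a..b} \<Phi>"
proof (rule lipschitz_on_if_locally_constant_off[OF \<Phi>_continuous,
      where K = "{t \<in> {a..b}. t \<notin> S \<and> lam (V t) = t}"])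
  let ?K = "{t \<in> {a..b}. t \<notin> S \<and> lam (V t) = t}"
  have le: "norm (\<Phi> y - \<Phi> x) \<le> (C * (1 + D) + 1 / c) * (y - x)" if K: "x \<in> ?K" "y \<in> ?K" "x \<le> y" for x y
  proof -
    have "norm (V y - V x) \<le> C * (\<bar>lam (V y) - lam (V x)\<bar> + norm (f (V y) - f (V x) - x *\<^sub>R (V y - V x)))"
      using K by (intro secant V_in_P) auto
    also have "\<dots> \<le> C * ((y - x) + (y - x) * D)"
      using K C_nonneg diam_P V_in_P by (intro mult_left_mono add_mono secant_defect_le) auto
    finally have 1: "norm (V y - V x) \<le> C * (1 + D) * (y - x)" by (simp add: algebra_simps)
    have "infsum (\<lambda>z. norm (jump V z)) (S \<inter> {x<..y}) \<le> (y - x) / c"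
      using K by (intro infsum_le_finite_sums[OF summable_on_subset_banach[OF jumps_summable]] sum_jumps_le) auto
    then have 2: "norm (saltus V S y - saltus V S x) \<le> (y - x) / c"
      using saltus_increment(2)[OF jumps_summable K(3)] by linarith
    have "\<Phi> y - \<Phi> x = (V y - V x) - (saltus V S y - saltus V S x)"
      using K by (simp add: \<Phi>_def right_modification_def)
    then have "norm (\<Phi> y - \<Phi> x) \<le> norm (V y - V x) + norm (saltus V S y - saltus V S x)"
      by (metis norm_triangle_ineq4)
    with 1 2 show ?thesis by (simp add: algebra_simps)
  qed
  show "(C * (1 + D) + 1 / c)-lipschitz_on ?K \<Phi>"
  proof (rule lipschitz_onI)
    fix x y assume xy: "x \<in> ?K" "y \<in> ?K"
    show "dist (\<Phi> x) (\<Phi> y) \<le> (C * (1 + D) + 1 / c) * dist x y"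
      using le[OF xy] le[OF xy(2,1)] by (cases "x \<le> y") (simp_all add: dist_norm norm_minus_commute)
  qed (use C_nonneg D_nonneg c_pos in auto)
qed (use \<Phi>_locally_constant in auto)

end

section \<open>Characteristic fields of smooth systems\<close>

text \<open>
  Product rule for the derivative of \<open>g\<close> applied to a vector field \<open>v\<close>.
\<close>

lemma has_derivative_derivative_along:
  fixes g :: "'a::euclidean_space \<Rightarrow> 'b::real_normed_vector"
  assumes "open S" and "smooth_on S g" and "smooth_on S v" and "x \<in> S"
  shows "((\<lambda>X. frechet_derivative g (at X) (v X)) has_derivative
    (\<lambda>w. frechet_derivative (\<lambda>X. frechet_derivative g (at X) (v x)) (at x) w
      + frechet_derivative g (at x) (frechet_derivative v (at x) w))) (at x)"
proof -
  let ?D = "\<lambda>X. frechet_derivative g (at X)"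
  let ?v' = "frechet_derivative v (at x)"
  have lin: "linear (?D X)" if "X \<in> S" for X
    using that assms(2) smooth_on_imp_differentiable linear_frechet_derivative by blast
  have dD: "((\<lambda>X. ?D X b) has_derivative frechet_derivative (\<lambda>X. ?D X b) (at x)) (at x)" for b
    using assms smooth_on_directional_derivative smooth_on_has_derivative by blast
  have dv: "(v has_derivative ?v') (at x)" using assms smooth_on_has_derivative by blast
  have sum: "((\<lambda>X. \<Sum>b\<in>Basis. (v X \<bullet> b) *\<^sub>R ?D X b) has_derivative
      (\<lambda>w. \<Sum>b\<in>Basis. (v x \<bullet> b) *\<^sub>R frechet_derivative (\<lambda>X. ?D X b) (at x) w + (?v' w \<bullet> b) *\<^sub>R ?D x b)) (at x)"
    by (intro has_derivative_sum has_derivative_scaleR dD has_derivative_inner_left dv)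
  have fixed: "((\<lambda>X. \<Sum>b\<in>Basis. (v x \<bullet> b) *\<^sub>R ?D X b) has_derivative
      (\<lambda>w. \<Sum>b\<in>Basis. (v x \<bullet> b) *\<^sub>R frechet_derivative (\<lambda>X. ?D X b) (at x) w)) (at x)"
    by (intro has_derivative_sum has_derivative_scaleR_right dD)
  have "((\<lambda>X. ?D X (v x)) has_derivative
      (\<lambda>w. \<Sum>b\<in>Basis. (v x \<bullet> b) *\<^sub>R frechet_derivative (\<lambda>X. ?D X b) (at x) w)) (at x)"
    using fixed assms(1,4)
    by (rule has_derivative_transform_within_open) (metis lin linear_euclidean_representation)
  then have eq: "frechet_derivative (\<lambda>X. ?D X (v x)) (at x)
      = (\<lambda>w. \<Sum>b\<in>Basis. (v x \<bullet> b) *\<^sub>R frechet_derivative (\<lambda>X. ?D X b) (at x) w)"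
    by (rule frechet_derivative_at[symmetric])
  have "((\<lambda>X. ?D X (v X)) has_derivative
      (\<lambda>w. \<Sum>b\<in>Basis. (v x \<bullet> b) *\<^sub>R frechet_derivative (\<lambda>X. ?D X b) (at x) w + (?v' w \<bullet> b) *\<^sub>R ?D x b)) (at x)"
    using sum assms(1,4)
    by (rule has_derivative_transform_within_open) (metis lin linear_euclidean_representation)
  then show ?thesis
    unfolding eq
    by (simp add: sum.distrib linear_euclidean_representation[OF lin[OF assms(4)], symmetric])
qed

text \<open>
  Strict differentiability of the derivative, uniformly in the direction \<open>u\<close>. The symmetry of the
  second derivative is what makes the error term linear in \<open>u\<close>.
\<close>

lemma second_order_expansion:
  fixes g :: "'a::euclidean_space \<Rightarrow> 'b::real_normed_vector"
  assumes "open S" and "smooth_on S g" and "x0 \<in> S" and "\<kappa> > 0"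
  shows "\<forall>\<^sub>F \<epsilon> in at_right 0. \<forall>x\<in>cball x0 \<epsilon>. \<forall>y\<in>cball x0 \<epsilon>. \<forall>u.
    norm (frechet_derivative g (at y) u - frechet_derivative g (at x) u
        - frechet_derivative (\<lambda>X. frechet_derivative g (at X) u) (at x0) (y - x))
      \<le> \<kappa> * (norm (y - x) * norm u)"
proof -
  let ?D = "\<lambda>X. frechet_derivative g (at X)"
  let ?D2 = "\<lambda>u. frechet_derivative (\<lambda>X. ?D X u) (at x0)"
  define \<kappa>' where "\<kappa>' = \<kappa> / DIM('a)"
  have \<kappa>': "\<kappa>' > 0" using assms(4) by (simp add: \<kappa>'_def)
  have "\<forall>\<^sub>F \<epsilon> in at_right 0. \<forall>x\<in>cball x0 \<epsilon>. \<forall>y\<in>cball x0 \<epsilon>.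
      norm (?D y b - ?D x b - ?D2 b (y - x)) \<le> \<kappa>' * norm (y - x)" for b
    by (rule strictly_differentiable[OF assms(1) smooth_on_directional_derivative[OF assms(2)] assms(3) \<kappa>'])
  then have "\<forall>\<^sub>F \<epsilon> in at_right 0. \<forall>b\<in>Basis. \<forall>x\<in>cball x0 \<epsilon>. \<forall>y\<in>cball x0 \<epsilon>.
      norm (?D y b - ?D x b - ?D2 b (y - x)) \<le> \<kappa>' * norm (y - x)"
    by (intro eventually_ball_finite) auto
  moreover have "\<forall>\<^sub>F \<epsilon> in at_right 0. \<forall>x\<in>cball x0 \<epsilon>. x \<in> S"
    using assms by (intro eventually_nhds_imp_eventually_cball) (simp add: eventually_nhds_in_open)
  ultimately show ?thesis
  proof eventually_elim
    case (elim \<epsilon>)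
    show ?case
    proof (intro ballI allI)
      fix x y u assume xy: "x \<in> cball x0 \<epsilon>" "y \<in> cball x0 \<epsilon>"
      have lin: "linear (?D X)" if "X \<in> S" for X
        using that assms(2) smooth_on_imp_differentiable linear_frechet_derivative by blast
      have "linear (\<lambda>u. ?D2 u (y - x))"
      proof -
        have "linear (?D2 (y - x))"
          using assms smooth_on_directional_derivative smooth_on_imp_differentiable
            linear_frechet_derivative by blast
        then show ?thesis
          by (simp only: second_derivative_symmetric[OF assms(1-3), of _ "y - x"])
      qed
      then have "linear (\<lambda>u. ?D y u - ?D x u - ?D2 u (y - x))"
        using elim xy lin by (intro linear_compose_sub) auto
      from linear_euclidean_representation[OF this, of u]
      have "norm (?D y u - ?D x u - ?D2 u (y - x))
          = norm (\<Sum>b\<in>Basis. (u \<bullet> b) *\<^sub>R (?D y b - ?D x b - ?D2 b (y - x)))" by simp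
      also have "\<dots> \<le> (\<Sum>b\<in>(Basis::'a set). norm u * (\<kappa>' * norm (y - x)))"
      proof (rule sum_norm_le)
        fix b :: 'a assume b: "b \<in> Basis"
        have "norm (?D y b - ?D x b - ?D2 b (y - x)) \<le> \<kappa>' * norm (y - x)"
          using elim(1) b xy by blast
        then show "norm ((u \<bullet> b) *\<^sub>R (?D y b - ?D x b - ?D2 b (y - x))) \<le> norm u * (\<kappa>' * norm (y - x))"
          unfolding norm_scaleR using Basis_le_norm[OF b, of u] by (intro mult_mono) auto
      qed
      also have "\<dots> = \<kappa> * (norm (y - x) * norm u)" by (simp add: \<kappa>'_def)
      finally show "norm (?D y u - ?D x u - ?D2 u (y - x)) \<le> \<kappa> * (norm (y - x) * norm u)" .
    qed
  qed
qed

text \<open>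
  Applying \<open>A - \<nu>\<close> removes the component for \<open>\<nu>\<close> and multiplies the others by nonzero factors.
\<close>

lemma sum_eigenvectors_eq_0:
  fixes A :: "'a::real_vector \<Rightarrow> 'a"
  assumes "finite M" and lin: "linear A" and "\<And>\<mu>. \<mu> \<in> M \<Longrightarrow> A (x \<mu>) = \<mu> *\<^sub>R x \<mu>"
    and "(\<Sum>\<mu>\<in>M. x \<mu>) = 0"
  shows "\<forall>\<mu>\<in>M. x \<mu> = 0"
  using assms(1,3,4)
proof (induction M arbitrary: x)
  case (insert \<nu> M)
  have "(\<Sum>\<mu>\<in>M. (\<mu> - \<nu>) *\<^sub>R x \<mu>) = (\<Sum>\<mu>\<in>insert \<nu> M. A (x \<mu>) - \<nu> *\<^sub>R x \<mu>)"
    using insert.hyps insert.prems(1) by (simp add: algebra_simps)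
  also have "\<dots> = A (\<Sum>\<mu>\<in>insert \<nu> M. x \<mu>) - \<nu> *\<^sub>R (\<Sum>\<mu>\<in>insert \<nu> M. x \<mu>)"
    using linear_sum[OF lin, of x "insert \<nu> M"] by (simp only: sum_subtractf scaleR_sum_right)
  also have "\<dots> = 0" using insert.prems(2) linear_0[OF lin] by simp
  finally have "\<forall>\<mu>\<in>M. (\<mu> - \<nu>) *\<^sub>R x \<mu> = 0"
    using insert.prems(1) lin by (intro insert.IH) (simp_all add: linear_cmul)
  then have "\<forall>\<mu>\<in>M. x \<mu> = 0" using insert.hyps by auto
  then show ?case using insert.prems(2) insert.hyps by (simp add: sum.neutral)
qed simp

lemma simple_eigenspace:
  fixes A :: "real^'m^'m"
  assumes card: "card (real_eigenvalues A) = CARD('m)"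
    and r: "A *v r = \<nu> *\<^sub>R r" "r \<noteq> 0" and w: "A *v w = \<nu> *\<^sub>R w"
  shows "\<exists>t. w = t *\<^sub>R r"
proof -
  define M where "M = real_eigenvalues A"
  have lin: "linear ((*v) A)" by simp
  have fin: "finite M" using card by (metis M_def card.infinite zero_less_card_finite less_irrefl)
  have "\<forall>\<mu>\<in>M. \<exists>v. v \<noteq> 0 \<and> A *v v = \<mu> *\<^sub>R v" by (simp add: M_def real_eigenvalues_def)
  then obtain v0 where v0: "\<And>\<mu>. \<mu> \<in> M \<Longrightarrow> v0 \<mu> \<noteq> 0 \<and> A *v v0 \<mu> = \<mu> *\<^sub>R v0 \<mu>" by metis
  define v where "v = v0(\<nu> := r)"
  have v: "v \<mu> \<noteq> 0" "A *v v \<mu> = \<mu> *\<^sub>R v \<mu>" if "\<mu> \<in> M" for \<mu>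
    using v0[OF that] r by (auto simp: v_def)
  have inj: "inj_on v M"
    by (rule inj_onI) (metis scaleR_right_imp_eq v)
  have indep: "independent (v ` M)"
    unfolding independent_explicit
  proof (intro conjI allI impI ballI)
    fix u y assume sum: "(\<Sum>y\<in>v ` M. u y *\<^sub>R y) = 0" and "y \<in> v ` M"
    have "\<forall>\<mu>\<in>M. u (v \<mu>) *\<^sub>R v \<mu> = 0"
      using sum v inj linear_cmul[OF lin]
      by (intro sum_eigenvectors_eq_0[OF fin lin]) (simp_all add: sum.reindex)
    then show "u y = 0" using v(1) \<open>y \<in> v ` M\<close> by auto
  qed (use fin in simp)
  have "span (v ` M) = UNIV"
    using card_ge_dim_independent[of "v ` M" UNIV] indep card card_image[OF inj]
    by (auto simp: M_def)
  then have "w \<in> span (v ` M)" by simp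
  then obtain u where "w = (\<Sum>y\<in>v ` M. u y *\<^sub>R y)" using fin by (auto simp: span_finite)
  then have w_sum: "w = (\<Sum>\<mu>\<in>M. u (v \<mu>) *\<^sub>R v \<mu>)" using inj by (simp add: sum.reindex)
  have "\<nu> \<in> M" using r by (auto simp: M_def real_eigenvalues_def)
  \<comment> \<open>Expand \<open>w\<close> in the eigenbasis and move it to the eigenvector for its own eigenvalue.\<close>
  have "\<forall>\<mu>\<in>M. u (v \<mu>) *\<^sub>R v \<mu> - (if \<mu> = \<nu> then w else 0) = 0"
  proof (rule sum_eigenvectors_eq_0[OF fin lin])
    show "A *v (u (v \<mu>) *\<^sub>R v \<mu> - (if \<mu> = \<nu> then w else 0))
        = \<mu> *\<^sub>R (u (v \<mu>) *\<^sub>R v \<mu> - (if \<mu> = \<nu> then w else 0))" if "\<mu> \<in> M" for \<mu>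
      using v(2)[OF that] w linear_cmul[OF lin, of "u (v \<mu>)" "v \<mu>"]
      by (simp add: matrix_vector_mult_diff_distrib scaleR_diff_right)
    show "(\<Sum>\<mu>\<in>M. u (v \<mu>) *\<^sub>R v \<mu> - (if \<mu> = \<nu> then w else 0)) = 0"
      using fin \<open>\<nu> \<in> M\<close> w_sum by (simp add: sum_subtractf sum.delta)
  qed
  then have "u (v \<nu>) *\<^sub>R v \<nu> = w" using \<open>\<nu> \<in> M\<close> by simp
  then show ?thesis by (auto simp: v_def)
qed

text \<open>
  Differentiating \<open>q\<^sub>V = e\<^sub>V f\<^sub>V\<close> shows that \<open>e\<^sub>V\<^sub>V f\<^sub>V\<close> differs from the second derivative of \<open>q\<close> by
  \<open>e\<^sub>V\<close> applied to the second derivative of \<open>f\<close>, and is therefore symmetric.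
\<close>

lemma hessian_left_eigenvector:
  fixes f :: "'a::euclidean_space \<Rightarrow> 'a" and e q :: "'a \<Rightarrow> real"
  assumes "open N" and f: "smooth_on N f" and e: "smooth_on N e" and q: "smooth_on N q"
    and compat: "\<And>X v. X \<in> N \<Longrightarrow>
      frechet_derivative q (at X) v = frechet_derivative e (at X) (frechet_derivative f (at X) v)"
    and X: "X \<in> N" and r: "frechet_derivative f (at X) r = \<nu> *\<^sub>R r"
  shows "hessian e X r (frechet_derivative f (at X) w) = \<nu> * hessian e X r w"
proof -
  let ?Df = "\<lambda>X. frechet_derivative f (at X)" and ?De = "\<lambda>X. frechet_derivative e (at X)"
    and ?Dq = "\<lambda>X. frechet_derivative q (at X)"
  have sym: "hessian e X u v = hessian e X v u" for u v
    unfolding hessian_def by (rule second_derivative_symmetric[OF assms(1) e X])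
  have lin: "linear (hessian e X u)" for u
    unfolding hessian_def using smooth_on_directional_derivative[OF e] X smooth_on_imp_differentiable
      linear_frechet_derivative by blast
  have second: "frechet_derivative (\<lambda>X. ?Dq X v) (at X) w
      = hessian e X (?Df X v) w + ?De X (frechet_derivative (\<lambda>X. ?Df X v) (at X) w)" for v w
  proof -
    have "((\<lambda>X. ?De X (?Df X v)) has_derivative (\<lambda>w. hessian e X (?Df X v) w
        + ?De X (frechet_derivative (\<lambda>X. ?Df X v) (at X) w))) (at X)"
      unfolding hessian_def
      by (rule has_derivative_derivative_along[OF assms(1) e smooth_on_directional_derivative[OF f] X])
    then have "((\<lambda>X. ?Dq X v) has_derivative (\<lambda>w. hessian e X (?Df X v) w
        + ?De X (frechet_derivative (\<lambda>X. ?Df X v) (at X) w))) (at X)"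
      using assms(1) X by (rule has_derivative_transform_within_open) (simp add: compat)
    then show ?thesis by (simp add: frechet_derivative_at[symmetric])
  qed
  have "hessian e X (?Df X r) w = hessian e X (?Df X w) r"
    using second[of r w] second[of w r] second_derivative_symmetric[OF assms(1) q X, of r w]
      second_derivative_symmetric[OF assms(1) f X, of r w] by simp
  then have "hessian e X r (?Df X w) = hessian e X (\<nu> *\<^sub>R r) w" using sym r by simp
  also have "\<dots> = \<nu> * hessian e X r w"
    using linear_cmul[OF lin, of w \<nu> r] by (simp add: sym[of _ w])
  finally show ?thesis .
qed

text \<open>
  Differentiate \<open>f\<^sub>V R = lam R\<close>. The terms that contain the derivative of \<open>R\<close> cancel under the left
  eigenvector \<open>l\<close>.
\<close>

lemma nonlinearity_through_flux:
  fixes f :: "'a::euclidean_space \<Rightarrow> 'a"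
  assumes "open N" and f: "smooth_on N f" and R: "smooth_on N R" and lam: "smooth_on N lam"
    and eig: "\<And>X. X \<in> N \<Longrightarrow> frechet_derivative f (at X) (R X) = lam X *\<^sub>R R X" and X: "X \<in> N"
    and l: "linear l" "\<And>w. l (frechet_derivative f (at X) w) = lam X * l w" "l (R X) = 1"
  shows "l (frechet_derivative (\<lambda>Y. frechet_derivative f (at Y) (R X)) (at X) w)
    = frechet_derivative lam (at X) w"
proof -
  let ?Df = "\<lambda>X. frechet_derivative f (at X)"
  let ?R' = "frechet_derivative R (at X)"
  have "((\<lambda>X. ?Df X (R X)) has_derivative
      (\<lambda>w. frechet_derivative (\<lambda>Y. ?Df Y (R X)) (at X) w + ?Df X (?R' w))) (at X)"
    by (rule has_derivative_derivative_along[OF assms(1) f R X])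
  then have "((\<lambda>X. lam X *\<^sub>R R X) has_derivative
      (\<lambda>w. frechet_derivative (\<lambda>Y. ?Df Y (R X)) (at X) w + ?Df X (?R' w))) (at X)"
    using assms(1) X by (rule has_derivative_transform_within_open) (simp add: eig)
  moreover have "((\<lambda>X. lam X *\<^sub>R R X) has_derivative
      (\<lambda>w. lam X *\<^sub>R ?R' w + frechet_derivative lam (at X) w *\<^sub>R R X)) (at X)"
    by (intro has_derivative_scaleR smooth_on_has_derivative[OF lam X] smooth_on_has_derivative[OF R X])
  ultimately have "frechet_derivative (\<lambda>Y. ?Df Y (R X)) (at X) w + ?Df X (?R' w)
      = lam X *\<^sub>R ?R' w + frechet_derivative lam (at X) w *\<^sub>R R X"
    by (rule has_derivative_unique[THEN fun_cong])
  then have "l (frechet_derivative (\<lambda>Y. ?Df Y (R X)) (at X) w + ?Df X (?R' w))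
      = l (lam X *\<^sub>R ?R' w + frechet_derivative lam (at X) w *\<^sub>R R X)" by simp
  then show ?thesis using l by (simp add: linear_add linear_cmul)
qed

text \<open>
  All error terms in the locale are differences of continuous expressions from their values at \<open>Vbar\<close>.
  So \<open>\<kappa>\<close> can be chosen first, from the data at \<open>Vbar\<close>, and then holds on all sufficiently small balls.
\<close>

lemma characteristic_field_near:
  fixes f :: "'a::euclidean_space \<Rightarrow> 'a" and e q lam :: "'a \<Rightarrow> real" and R :: "'a \<Rightarrow> 'a"
  assumes "open N" and V: "Vbar \<in> N"
    and f: "smooth_on N f" and e: "smooth_on N e" and q: "smooth_on N q"
    and compat: "\<And>X v. X \<in> N \<Longrightarrow>
      frechet_derivative q (at X) v = frechet_derivative e (at X) (frechet_derivative f (at X) v)"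
    and R: "smooth_on N R" and lam: "smooth_on N lam"
    and eig: "\<And>X. X \<in> N \<Longrightarrow> frechet_derivative f (at X) (R X) = lam X *\<^sub>R R X"
    and norm_R: "norm (R Vbar) = 1"
    and simple: "\<And>w. frechet_derivative f (at Vbar) w = lam Vbar *\<^sub>R w \<Longrightarrow> \<exists>t. w = t *\<^sub>R R Vbar"
    and \<beta>: "\<beta> = hessian e Vbar (R Vbar) (R Vbar)" "\<beta> \<noteq> 0"
    and \<gamma>: "\<gamma> = frechet_derivative lam (at Vbar) (R Vbar)" "0 < \<gamma>"
  shows "\<exists>ell A H B l r G M k \<sigma> \<kappa>. 0 < \<kappa> \<and> (\<forall>\<^sub>F \<epsilon> in at_right 0.
    nonlinear_characteristic_field f (\<lambda>X. frechet_derivative f (at X)) e q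
      (\<lambda>X. frechet_derivative e (at X)) ell lam (cball Vbar \<epsilon>) A H B l r G (lam Vbar) \<beta> \<gamma> M k \<sigma> \<kappa>)"
proof -
  let ?Df = "\<lambda>X. frechet_derivative f (at X)" and ?De = "\<lambda>X. frechet_derivative e (at X)"
  define r where "r = R Vbar"
  define A where "A = ?Df Vbar"
  define H where "H = (\<lambda>d u. frechet_derivative (\<lambda>X. ?Df X u) (at Vbar) d)"
  define B where "B = hessian e Vbar"
  define l where "l = (\<lambda>w. B r w / \<beta>)"
  define ell where "ell = (\<lambda>X w. hessian e X (R X) w / \<beta>)"
  define G where "G = frechet_derivative lam (at Vbar)"
  have linear_Df: "linear (?Df X)" if "X \<in> N" for X
    using that f smooth_on_imp_differentiable linear_frechet_derivative by blast
  have linear_hess: "linear (hessian e X u)" if "X \<in> N" for X u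
    unfolding hessian_def using smooth_on_directional_derivative[OF e] that smooth_on_imp_differentiable
      linear_frechet_derivative by blast
  have sym_hess: "hessian e X u v = hessian e X v u" if "X \<in> N" for X u v
    unfolding hessian_def by (rule second_derivative_symmetric[OF assms(1) e that])
  have linear_H: "linear (\<lambda>d. H d u)" for u
    unfolding H_def using smooth_on_directional_derivative[OF f] V smooth_on_imp_differentiable
      linear_frechet_derivative by blast
  have sym_H: "H u v = H v u" for u v
    unfolding H_def by (rule second_derivative_symmetric[OF assms(1) f V])
  have linear_H2: "linear (H d)" for d
  proof -
    have "H d = (\<lambda>u. H u d)" by (rule ext) (rule sym_H)
    then show ?thesis by (rule ssubst) (rule linear_H)
  qed
  have "bilinear H" using linear_H linear_H2 by (simp add: bilinear_def)
  then have bilin_H: "bounded_bilinear H" by (simp add: bilinear_conv_bounded_bilinear)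
  have "linear (\<lambda>u. B u v)" for v
    unfolding B_def using linear_hess[OF V, of v] by (simp only: sym_hess[OF V, of _ v])
  then have "bilinear B" using linear_hess[OF V] by (simp add: bilinear_def B_def)
  then have bilin_B: "bounded_bilinear B" by (simp add: bilinear_conv_bounded_bilinear)
  have linear_l: "linear l"
    unfolding l_def B_def using linear_compose_scale_right[OF linear_hess[OF V], of "1 / \<beta>" r]
    by (simp add: divide_inverse mult.commute)
  have linear_G: "linear G"
    unfolding G_def using lam V smooth_on_imp_differentiable linear_frechet_derivative by blast
  have linear_A: "linear A" unfolding A_def by (rule linear_Df[OF V])
  have l_r: "l r = 1" using \<beta> by (simp add: l_def B_def r_def)
  have A_r: "A r = lam Vbar *\<^sub>R r" using eig[OF V] by (simp add: A_def r_def)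
  have l_A: "l (A w) = lam Vbar * l w" for w
    unfolding l_def B_def A_def r_def
    using hessian_left_eigenvector[OF assms(1) f e q compat V eig[OF V], of w] by simp
  have l_H: "l (H r r) = \<gamma>"
    using nonlinearity_through_flux[OF assms(1) f R lam eig V linear_l l_A[unfolded A_def], of r] l_r \<gamma>(1)
    by (simp add: H_def r_def)
  obtain k0 where k0: "k0 > 0" "\<And>w. l w = 0 \<Longrightarrow> k0 * norm w \<le> norm (A w - lam Vbar *\<^sub>R w)"
  proof -
    have bl: "bounded_linear l" using linear_l by (simp add: linear_conv_bounded_linear)
    have "linear (\<lambda>w. A w - lam Vbar *\<^sub>R w)"
      by (intro linear_compose_sub linear_A linear_compose_scale_right linear_ident)
    then have "bounded_linear (\<lambda>w. A w - lam Vbar *\<^sub>R w)" by (simp add: linear_conv_bounded_linear)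
    moreover have "subspace {w. l w = 0}" using linear_l by (rule linear_subspace_kernel)
    moreover have "closed {w. l w = 0}"
      by (intro closed_Collect_eq linear_continuous_on bl continuous_on_const)
    moreover have "w = 0" if w: "l w = 0" "A w - lam Vbar *\<^sub>R w = 0" for w
    proof -
      obtain t where t: "w = t *\<^sub>R r" using simple[of w] w(2) by (auto simp: A_def r_def)
      then have "l w = t" using linear_l l_r by (simp add: linear_cmul)
      then show "w = 0" using w(1) t by simp
    qed
    ultimately obtain k0 where "k0 > 0" "\<forall>w\<in>{w. l w = 0}. k0 * norm w \<le> norm (A w - lam Vbar *\<^sub>R w)"
      using injective_imp_isometric[of "{w. l w = 0}" "\<lambda>w. A w - lam Vbar *\<^sub>R w"]
      by (auto simp: mult.commute)
    then show ?thesis using that by auto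
  qed
  define k where "k = min 1 k0"
  obtain M1 where M1: "\<And>w. \<bar>l w\<bar> \<le> norm w * M1"
    using bounded_linear.bounded[of l] linear_l by (auto simp: linear_conv_bounded_linear)
  obtain M2 where M2: "\<And>w. \<bar>G w\<bar> \<le> norm w * M2"
    using bounded_linear.bounded[of G] linear_G by (auto simp: linear_conv_bounded_linear)
  obtain M3 where M3: "\<And>u v. norm (H u v) \<le> norm u * norm v * M3"
    using bounded_bilinear.bounded[OF bilin_H] by blast
  obtain M4 where M4: "\<And>u v. \<bar>B u v\<bar> \<le> norm u * norm v * M4"
    using bounded_bilinear.bounded[OF bilin_B] by auto
  define M where "M = Max {1, M1, M2, M3, M4}"
  have M: "1 \<le> M" "M1 \<le> M" "M2 \<le> M" "M3 \<le> M" "M4 \<le> M" by (simp_all add: M_def)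
  have up: "n * m \<le> M * n" if "m \<le> M" "0 \<le> n" for n m :: real
    using mult_left_mono[OF that] by (simp add: mult.commute)
  \<comment> \<open>The largest value that satisfies the three smallness conditions of the locale.\<close>
  define \<sigma> where "\<sigma> = Min {1 / 4, \<gamma> / (48 * M\<^sup>2), \<bar>\<beta>\<bar> * \<gamma> / (384 * M ^ 3)}"
  define \<kappa> where "\<kappa> = \<sigma> * k / 2"
  have k: "0 < k" "k \<le> 1" using k0(1) by (simp_all add: k_def)
  have "0 < \<sigma>" using \<gamma>(2) \<beta>(2) M(1) by (simp add: \<sigma>_def)
  then have \<kappa>: "0 < \<kappa>" using k by (simp add: \<kappa>_def)
  have \<sigma>: "\<sigma> \<le> 1 / 4" "48 * M\<^sup>2 * \<sigma> \<le> \<gamma>" "384 * M ^ 3 * \<sigma> \<le> \<bar>\<beta>\<bar> * \<gamma>"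
  proof -
    have "\<sigma> \<le> \<gamma> / (48 * M\<^sup>2)" "\<sigma> \<le> \<bar>\<beta>\<bar> * \<gamma> / (384 * M ^ 3)" by (simp_all add: \<sigma>_def)
    then show "48 * M\<^sup>2 * \<sigma> \<le> \<gamma>" "384 * M ^ 3 * \<sigma> \<le> \<bar>\<beta>\<bar> * \<gamma>"
      using M(1) by (simp_all add: field_simps)
  qed (simp add: \<sigma>_def)
  have inN: "\<forall>\<^sub>F \<epsilon> in at_right 0. \<forall>X\<in>cball Vbar \<epsilon>. X \<in> N"
    using assms by (intro eventually_nhds_imp_eventually_cball) (simp add: eventually_nhds_in_open)
  have Df_close: "\<forall>\<^sub>F \<epsilon> in at_right 0. \<forall>X\<in>cball Vbar \<epsilon>. \<forall>u. norm (?Df X u - A u) \<le> \<kappa> * norm u"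
    unfolding A_def
    by (intro eventually_nhds_imp_eventually_cball linear_family_continuous[OF assms(1) V _ _ \<kappa>] linear_Df
        smooth_on_continuous_on[OF smooth_on_directional_derivative[OF f]])
  note Df_expand = second_order_expansion[OF assms(1) f V \<kappa>]
  note De_expand = second_order_expansion[OF assms(1) e V \<kappa>]
  have ell_close: "\<forall>\<^sub>F \<epsilon> in at_right 0. \<forall>X\<in>cball Vbar \<epsilon>. \<forall>u. norm (hessian e X (R X) u - hessian e Vbar (R Vbar) u)
      \<le> (\<kappa> * \<bar>\<beta>\<bar>) * norm u"
  proof (intro eventually_nhds_imp_eventually_cball linear_family_continuous[OF assms(1) V _ _])
    show "continuous_on N (\<lambda>X. hessian e X (R X) b)" for b
    proof (rule continuous_on_eq)
      show "continuous_on N (\<lambda>X. hessian e X b (R X))"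
        unfolding hessian_def
        by (intro smooth_on_continuous_on smooth_on_derivative_along assms(1) R smooth_on_directional_derivative e)
    qed (rule sym_hess)
  qed (use linear_hess \<kappa> \<beta>(2) in auto)
  have lam_expand: "\<forall>\<^sub>F \<epsilon> in at_right 0. \<forall>X\<in>cball Vbar \<epsilon>. \<forall>Y\<in>cball Vbar \<epsilon>.
      norm (lam Y - lam X - G (Y - X)) \<le> \<kappa> * norm (Y - X)"
    unfolding G_def by (rule strictly_differentiable[OF assms(1) lam V \<kappa>])
  have "\<forall>\<^sub>F \<epsilon> in at_right 0.
    nonlinear_characteristic_field f ?Df e q ?De ell lam (cball Vbar \<epsilon>) A H B l r G (lam Vbar) \<beta> \<gamma> M k \<sigma> \<kappa>"
    using inN Df_close Df_expand De_expand ell_close lam_expand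
  proof eventually_elim
    case (elim \<epsilon>)
    let ?P = "cball Vbar \<epsilon>"
    note inN = elim(1)[rule_format]
    show ?case
    proof (rule nonlinear_characteristic_field.intro)
      show "(f has_derivative ?Df X) (at X within ?P)" if "X \<in> ?P" for X
        by (rule has_derivative_at_withinI[OF smooth_on_has_derivative[OF f inN[OF that]]])
      show "(e has_derivative ?De X) (at X within ?P)" if "X \<in> ?P" for X
        by (rule has_derivative_at_withinI[OF smooth_on_has_derivative[OF e inN[OF that]]])
      show "(q has_derivative (\<lambda>v. ?De X (?Df X v))) (at X within ?P)" if "X \<in> ?P" for X
      proof -
        have "frechet_derivative q (at X) = (\<lambda>v. ?De X (?Df X v))"
          using compat[OF inN[OF that]] by (rule ext)
        then show ?thesis
          using has_derivative_at_withinI[OF smooth_on_has_derivative[OF q inN[OF that]]] by metis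
      qed
      show "linear (ell X)" if "X \<in> ?P" for X
        unfolding ell_def using linear_compose_scale_right[OF linear_hess[OF inN[OF that]], of "1 / \<beta>" "R X"]
        by (simp add: divide_inverse mult.commute)
      show "ell X (?Df X w) = lam X * ell X w" if "X \<in> ?P" for X w
        unfolding ell_def
        using hessian_left_eigenvector[OF assms(1) f e q compat inN[OF that] eig[OF inN[OF that]]] by simp
      show "\<bar>l w\<bar> \<le> M * norm w" "\<bar>G w\<bar> \<le> M * norm w" for w
        using order_trans[OF M1 up[OF M(2)]] order_trans[OF M2 up[OF M(3)]] by simp_all
      show "norm (H u v) \<le> M * (norm u * norm v)" "\<bar>B u v\<bar> \<le> M * (norm u * norm v)" for u v
        using order_trans[OF M3 up[OF M(4)]] order_trans[OF M4 up[OF M(5)]] by simp_all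
      show "k * norm w \<le> norm (A w - lam Vbar *\<^sub>R w)" if "l w = 0" for w
        using k0(2)[OF that] mult_right_mono[of k k0 "norm w"] by (simp add: k_def)
      show "B u r = \<beta> * l u" for u using \<beta>(2) sym_hess[OF V] by (simp add: l_def B_def)
      show "norm (?Df X u - A u) \<le> \<kappa> * norm u" if "X \<in> ?P" for X u using elim(2) that by blast
      show "norm (?Df Y u - ?Df X u - H (Y - X) u) \<le> \<kappa> * (norm (Y - X) * norm u)"
        if "X \<in> ?P" "Y \<in> ?P" for X Y u
        using elim(3) that unfolding H_def by blast
      show "\<bar>?De Y u - ?De X u - B u (Y - X)\<bar> \<le> \<kappa> * (norm (Y - X) * norm u)"
        if "X \<in> ?P" "Y \<in> ?P" for X Y u
        using elim(4) that unfolding B_def hessian_def real_norm_def by blast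
      show "\<bar>ell X w - l w\<bar> \<le> \<kappa> * norm w" if "X \<in> ?P" for X w
      proof -
        have "\<bar>hessian e X (R X) w - hessian e Vbar (R Vbar) w\<bar> \<le> (\<kappa> * norm w) * \<bar>\<beta>\<bar>"
          using elim(5)[rule_format, OF that, of w] by (simp add: mult_ac)
        then have "\<bar>hessian e X (R X) w - hessian e Vbar (R Vbar) w\<bar> / \<bar>\<beta>\<bar> \<le> \<kappa> * norm w"
          using \<beta>(2) by (simp add: pos_divide_le_eq)
        then show ?thesis
          by (simp add: ell_def l_def B_def r_def diff_divide_distrib[symmetric])
      qed
      show "\<bar>lam Y - lam X - G (Y - X)\<bar> \<le> \<kappa> * norm (Y - X)" if "X \<in> ?P" "Y \<in> ?P" for X Y
        using elim(6) that by simp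
    qed (use linear_A linear_l linear_G bilin_H bilin_B norm_R A_r l_r M k l_H \<gamma> \<kappa> \<sigma> in
        \<open>simp_all add: r_def G_def \<kappa>_def\<close>)
  qed
  with \<kappa> show ?thesis by blast
qed

section \<open>From characteristic fields to the whole line\<close>

lemma (in nonlinear_characteristic_field) compressive_sectorI:
  assumes P: "P = cball Vbar \<epsilon>" and "open N" and N: "P \<subseteq> N" and f: "smooth_on N f"
    and Df: "Df = (\<lambda>X. frechet_derivative f (at X))"
    and cont_e: "continuous_on P e" and cont_q: "continuous_on P q"
    and near: "\<And>\<xi>. \<xi> \<in> {a..b} \<Longrightarrow> \<bar>\<xi> - lbar\<bar> \<le> \<kappa>"
    and range: "\<And>X. X \<in> P \<Longrightarrow> a < lam X \<and> lam X < b" and \<tau>: "\<tau> * \<beta> < 0"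
    and V: "\<And>\<xi>. V \<xi> \<in> P" "V \<in> borel_measurable lebesgue"
    and weak: "\<And>x y. x \<le> y \<Longrightarrow> f (V y) - y *\<^sub>R V y - f (V x) + x *\<^sub>R V x = - integral {x..y} V"
    and entropy: "\<And>x y. x < y \<Longrightarrow> \<tau> * ((q (V y) - y * e (V y)) - (q (V x) - x * e (V x)))
      \<le> - \<tau> * integral {x..y} (\<lambda>\<xi>. e (V \<xi>))"
  shows "compressive_sector f e q lam P a b (\<gamma> / 12) (2 / \<gamma> + 2 * (M / \<gamma> + 1) / k) (2 * \<epsilon>) \<tau> V"
proof
  show "compact P" by (simp add: P)
  show "continuous_on P f" using smooth_on_continuous_on[OF f] N by (rule continuous_on_subset)
  show "\<gamma> / 12 * norm (Y - X) \<le> \<xi> - lam X \<and> \<gamma> / 12 * norm (Y - X) \<le> lam Y - \<xi>"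
    if "X \<in> P" "Y \<in> P" "\<xi> \<in> {a..b}" "f Y - f X = \<xi> *\<^sub>R (Y - X)"
      "\<tau> * (q Y - q X - \<xi> * (e Y - e X)) \<le> 0" "X \<noteq> Y" for X Y \<xi>
    using backward_shock_expansive[OF that(1,2) near[OF that(3)] that(4,6) \<tau> that(5)] by simp
  show "\<exists>d>0. \<exists>\<kappa>>0. \<forall>Y\<in>P \<inter> ball X d. \<forall>Z\<in>P \<inter> ball X d. \<forall>\<zeta>\<in>ball \<xi> d.
      \<kappa> * norm (Z - Y) \<le> norm (f Z - f Y - \<zeta> *\<^sub>R (Z - Y))"
    if X: "X \<in> P" and \<xi>: "\<xi> \<in> {a..b}" and ne: "lam X \<noteq> \<xi>" for X \<xi>
  proof -
    have XN: "X \<in> N" using X N by blast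
    have "linear (Df X)" using has_derivative_linear[OF f_deriv[OF X]] .
    then have lin: "linear (\<lambda>w. Df X w - \<xi> *\<^sub>R w)"
      by (intro linear_compose_sub linear_compose_scale_right linear_ident)
    have "inj (\<lambda>w. Df X w - \<xi> *\<^sub>R w)"
      unfolding linear_injective_0[OF lin]
      using noncharacteristic_injective[OF X near[OF \<xi>] ne] by simp
    then obtain m where m: "m > 0" "\<And>w. m * norm w \<le> norm (Df X w - \<xi> *\<^sub>R w)"
      using linear_inj_bounded_below_pos[OF lin] by blast
    have "m / 4 > 0" using m by simp
    from strictly_differentiable[OF assms(2) f XN this]
    obtain d1 where d1: "d1 > 0" "\<And>\<epsilon>. 0 < \<epsilon> \<Longrightarrow> \<epsilon> < d1 \<Longrightarrow> \<forall>x\<in>cball X \<epsilon>. \<forall>y\<in>cball X \<epsilon>.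
        norm (f y - f x - Df X (y - x)) \<le> m / 4 * norm (y - x)"
      unfolding eventually_at_right_field Df by auto
    define d where "d = min (d1 / 2) (m / 4)"
    have d: "d > 0" "d < d1" using d1 m by (simp_all add: d_def)
    have "m / 2 * norm (Z - Y) \<le> norm (f Z - f Y - \<zeta> *\<^sub>R (Z - Y))"
      if "Y \<in> ball X d" "Z \<in> ball X d" "\<zeta> \<in> ball \<xi> d" for Y Z \<zeta>
    proof -
      let ?w = "Z - Y"
      have 1: "norm (f Z - f Y - Df X ?w) \<le> m / 4 * norm ?w"
        using d1(2)[OF d] that(1,2) by auto
      have "\<bar>\<zeta> - \<xi>\<bar> \<le> m / 4" using that(3) by (auto simp: d_def dist_real_def abs_minus_commute)
      then have 2: "norm ((\<zeta> - \<xi>) *\<^sub>R ?w) \<le> m / 4 * norm ?w"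
        unfolding norm_scaleR by (rule mult_right_mono) simp
      have "Df X ?w - \<xi> *\<^sub>R ?w
          = (f Z - f Y - \<zeta> *\<^sub>R ?w) - (f Z - f Y - Df X ?w) + (\<zeta> - \<xi>) *\<^sub>R ?w"
        by (simp add: algebra_simps)
      also have "norm \<dots> \<le> norm (f Z - f Y - \<zeta> *\<^sub>R ?w) + norm (f Z - f Y - Df X ?w)
          + norm ((\<zeta> - \<xi>) *\<^sub>R ?w)"
        by (rule order_trans[OF norm_triangle_ineq add_right_mono[OF norm_triangle_ineq4]])
      finally have "m * norm ?w \<le> norm (f Z - f Y - \<zeta> *\<^sub>R ?w) + m / 4 * norm ?w + m / 4 * norm ?w"
        using m(2)[of ?w] 1 2 by linarith
      then show ?thesis by simp
    qed
    then show ?thesis using d(1) m(1) by (intro exI[of _ d] exI[of _ "m / 2"] conjI) auto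
  qed
  show "norm (Y - X) \<le> (2 / \<gamma> + 2 * (M / \<gamma> + 1) / k)
      * (\<bar>lam Y - lam X\<bar> + norm (f Y - f X - \<xi> *\<^sub>R (Y - X)))"
    if "X \<in> P" "Y \<in> P" "\<xi> \<in> {a..b}" for X Y \<xi>
  proof -
    have pos: "0 \<le> 2 / \<gamma>" "0 \<le> 2 * (M / \<gamma> + 1) / k" using \<gamma>_pos M_ge_1 k by simp_all
    define u where "u = \<bar>lam Y - lam X\<bar>"
    define v where "v = norm (f Y - f X - \<xi> *\<^sub>R (Y - X))"
    define p where "p = 2 * (M / \<gamma> + 1) / k"
    have "norm (Y - X) \<le> 2 / \<gamma> * u + p * v"
      using secant_controlled_by_speed[OF that(1,2) near[OF that(3)]] by (simp only: u_def v_def p_def)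
    also have "\<dots> \<le> (2 / \<gamma> + p) * (u + v)"
    proof -
      have "0 \<le> 2 / \<gamma> * v" "0 \<le> p * u"
        using pos mult_nonneg_nonneg[OF pos(1), of v] mult_nonneg_nonneg[OF pos(2), of u]
        by (simp_all only: u_def v_def p_def abs_ge_zero norm_ge_zero)
      then show ?thesis by (simp only: distrib_left distrib_right)
    qed
    finally show ?thesis by (simp only: u_def v_def p_def)
  qed
  show "norm (Y - X) \<le> 2 * \<epsilon>" if "X \<in> P" "Y \<in> P" for X Y
  proof -
    have "dist Y X \<le> dist Vbar Y + dist Vbar X" by (rule dist_triangle3)
    then show ?thesis using that by (simp add: P dist_norm)
  qed
  show "0 \<le> 2 / \<gamma> + 2 * (M / \<gamma> + 1) / k" using \<gamma>_pos M_ge_1 k by simp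
qed (use assms \<gamma>_pos in auto)

context compressive_sector
begin

lemma a_le_b: "a \<le> b"
  using lam_range[OF V_in_P] by (metis less_imp_le less_trans)

text \<open>
  The variation of the saltus function is dominated by the increments of a bounded monotone function.
\<close>

lemma saltus_increment_le:
  assumes "x \<le> y"
  defines "g \<equiv> \<lambda>x. infsum (\<lambda>z. norm (jump V z)) {z \<in> S. z \<le> x}"
  shows "norm (saltus V S y - saltus V S x) \<le> g y - g x" and "0 \<le> g x" and "g y \<le> (b - a) / c"
proof -
  have sum: "(\<lambda>z. norm (jump V z)) summable_on A" if "A \<subseteq> S" for A
    using jumps_summable that summable_on_subset_banach by blast
  have "{z \<in> S. z \<le> y} = {z \<in> S. z \<le> x} \<union> S \<inter> {x<..y}" using assms(1) by auto
  then have "g y = g x + infsum (\<lambda>z. norm (jump V z)) (S \<inter> {x<..y})"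
    unfolding g_def by (simp, subst infsum_Un_disjoint) (auto intro!: sum)
  then show "norm (saltus V S y - saltus V S x) \<le> g y - g x"
    using saltus_increment(2)[OF jumps_summable assms(1)] by simp
  show "0 \<le> g x" unfolding g_def by (rule infsum_nonneg) simp
  have "g y \<le> infsum (\<lambda>z. norm (jump V z)) S"
    unfolding g_def by (intro infsum_mono2 sum) auto
  then show "g y \<le> (b - a) / c" using total_jump_le[OF a_le_b] by simp
qed

lemma right_modification_in_P: "right_modification V S \<xi> \<in> P"
  using V_in_P one_sided_limits(4)[of \<xi>] by (auto simp: right_modification_def S_iff)

lemma \<Phi>_increment_le:
  assumes "x \<le> y"
  shows "norm (\<Phi> y - \<Phi> x) \<le> D + (b - a) / c"
proof -
  have "\<Phi> y - \<Phi> x = (right_modification V S y - right_modification V S x)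
      - (saltus V S y - saltus V S x)" by (simp add: \<Phi>_def)
  then have "norm (\<Phi> y - \<Phi> x) \<le> norm (right_modification V S y - right_modification V S x)
      + norm (saltus V S y - saltus V S x)"
    by (metis norm_triangle_ineq4)
  moreover have "norm (right_modification V S y - right_modification V S x) \<le> D"
    by (intro diam_P right_modification_in_P)
  moreover have "norm (saltus V S y - saltus V S x) \<le> (b - a) / c"
    using saltus_increment_le[OF assms] by linarith
  ultimately show ?thesis by linarith
qed

lemma \<Phi>_eq_if_V_eq:
  assumes "u \<le> v" "V u = V v" "{u..v} \<inter> {a<..<b} = {}"
  shows "\<Phi> u = \<Phi> v"
proof -
  have "u \<in> {u..v}" "v \<in> {u..v}" using assms(1) by simp_all
  then have "u \<notin> S" "v \<notin> S" using assms(3) S_in by blast+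
  moreover have "{u<..v} \<subseteq> {u..v}" by auto
  then have "S \<inter> {u<..v} = {}" using assms(3) S_in by blast
  ultimately show ?thesis
    using saltus_eq_if_no_jump_between[OF assms(1)] assms(2) by (simp add: \<Phi>_def right_modification_def)
qed

text \<open>
  Two points of \<open>T\<close> either are joined inside \<open>T\<close>, where the bound on \<open>{a..b}\<close> is extended by constancy,
  or are at least \<open>w\<close> apart, where boundedness suffices. For the variation over the unbounded \<open>T\<close>, the points
  beyond \<open>h\<close> and \<open>- h\<close> are first moved to these two points, which changes no value of \<open>\<Phi>\<close>.
\<close>

theorem regularity_off_gaps:
  assumes T: "{a..b} \<subseteq> T"
    and const: "\<And>u v. u \<le> v \<Longrightarrow> {u..v} \<subseteq> T - {a<..<b} \<Longrightarrow> V u = V v"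
    and gap: "0 < w" "\<And>x y. x \<in> T \<Longrightarrow> y \<in> T \<Longrightarrow> x \<le> y \<Longrightarrow> \<not> {x..y} \<subseteq> T \<Longrightarrow> w \<le> y - x"
    and far: "{..- h} \<subseteq> T" "{h..} \<subseteq> T" "- h \<le> a" "b \<le> h"
  defines "L \<equiv> max (C * (1 + D) + 1 / c) ((D + (b - a) / c) / w)"
  shows "L-lipschitz_on T \<Phi>" and "bounded_variation_on T (right_modification V S)"
proof -
  define L0 where "L0 = C * (1 + D) + 1 / c"
  have const': "\<Phi> u = \<Phi> v" if "u \<le> v" "{u..v} \<subseteq> T" "{u..v} \<inter> {a<..<b} = {}" for u v
    using that by (intro \<Phi>_eq_if_V_eq const) blast+
  have L: "0 \<le> L0" "L0 \<le> L" using C_nonneg D_nonneg c_pos by (simp_all add: L0_def L_def)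
  have conn: "norm (\<Phi> y - \<Phi> x) \<le> L0 * (y - x)" if xy: "x \<le> y" "{x..y} \<subseteq> T" for x y
  proof (cases "y \<le> a \<or> b \<le> x")
    case True
    then have "\<Phi> x = \<Phi> y" using xy by (intro const') auto
    then show ?thesis using L(1) xy by simp
  next
    case False
    define x' where "x' = max x a"
    define y' where "y' = min y b"
    have le: "x \<le> x'" "x' \<le> y'" "y' \<le> y" "x' \<in> {a..b}" "y' \<in> {a..b}"
      using False xy a_le_b by (auto simp: x'_def y'_def)
    have "\<Phi> x = \<Phi> x'"
    proof (cases "x \<le> a")
      case True
      then have "x' = a" by (simp add: x'_def)
      then show ?thesis using True le xy by (intro const') auto
    qed (simp add: x'_def)
    moreover have "\<Phi> y' = \<Phi> y"
    proof (cases "b \<le> y")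
      case True
      then have "y' = b" by (simp add: y'_def)
      then show ?thesis using True le xy by (intro const') auto
    qed (simp add: y'_def)
    ultimately have "norm (\<Phi> y - \<Phi> x) = dist (\<Phi> x') (\<Phi> y')" by (simp add: dist_norm norm_minus_commute)
    also have "\<dots> \<le> L0 * dist x' y'"
      unfolding L0_def using le by (intro lipschitz_onD[OF remainder_lipschitz])
    also have "\<dots> \<le> L0 * (y - x)"
      using le L(1) by (intro mult_left_mono) (auto simp: dist_real_def)
    finally show ?thesis .
  qed
  have lip: "norm (\<Phi> y - \<Phi> x) \<le> L * (y - x)" if xy: "x \<in> T" "y \<in> T" "x \<le> y" for x y
  proof (cases "{x..y} \<subseteq> T")
    case True
    have "norm (\<Phi> y - \<Phi> x) \<le> L0 * (y - x)" by (rule conn[OF xy(3) True])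
    also have "\<dots> \<le> L * (y - x)" using L xy by (intro mult_right_mono) auto
    finally show ?thesis .
  next
    case False
    have "norm (\<Phi> y - \<Phi> x) \<le> D + (b - a) / c" by (rule \<Phi>_increment_le[OF xy(3)])
    also have "\<dots> = (D + (b - a) / c) / w * w" using gap(1) by simp
    also have "\<dots> \<le> L * (y - x)"
      using gap(2)[OF xy False] gap(1) L by (intro mult_mono) (auto simp: L_def)
    finally show ?thesis .
  qed
  show "L-lipschitz_on T \<Phi>"
  proof (rule lipschitz_onI)
    fix x y assume "x \<in> T" "y \<in> T"
    then show "dist (\<Phi> x) (\<Phi> y) \<le> L * dist x y"
      using lip[of x y] lip[of y x] by (cases "x \<le> y") (simp_all add: dist_norm norm_minus_commute)
  qed (use L in simp)
  have h: "- h \<le> h" using far(3,4) a_le_b by linarith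
  define cl where "cl = (\<lambda>s. max (- h) (min h s))"
  have cl: "\<Phi> s = \<Phi> (cl s)" "cl s \<in> T" if "s \<in> T" for s
  proof -
    have "\<Phi> s = \<Phi> (cl s) \<and> cl s \<in> T"
    proof (cases "s < - h \<or> h < s")
      case True
      then show ?thesis
      proof
        assume s: "s < - h"
        then have "\<Phi> s = \<Phi> (- h)" using far by (intro const') auto
        then show ?thesis using s h far(1) by (auto simp: cl_def)
      next
        assume s: "h < s"
        then have "\<Phi> h = \<Phi> s" using far by (intro const') auto
        then show ?thesis using s h far(2) by (auto simp: cl_def)
      qed
    next
      case False
      then show ?thesis using that by (simp add: cl_def)
    qed
    then show "\<Phi> s = \<Phi> (cl s)" "cl s \<in> T" by simp_all
  qed
  define g where "g = (\<lambda>x. infsum (\<lambda>z. norm (jump V z)) {z \<in> S. z \<le> x})"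
  show "bounded_variation_on T (right_modification V S)"
    unfolding bounded_variation_on_def
  proof (intro exI[of _ "L * (2 * h) + (b - a) / c"] allI impI)
    fix n :: nat and t :: "nat \<Rightarrow> real" assume t: "(\<forall>i\<le>n. t i \<in> T) \<and> mono_on {..n} t"
    have step: "norm (right_modification V S (t (Suc i)) - right_modification V S (t i))
        \<le> L * (cl (t (Suc i)) - cl (t i)) + (g (t (Suc i)) - g (t i))" if "i < n" for i
    proof -
      have ti: "t i \<in> T" "t (Suc i) \<in> T" "t i \<le> t (Suc i)"
        using t that mono_onD[of "{..n}" t i "Suc i"] by auto
      have "right_modification V S (t (Suc i)) - right_modification V S (t i)
          = (\<Phi> (t (Suc i)) - \<Phi> (t i)) + (saltus V S (t (Suc i)) - saltus V S (t i))"
        by (simp add: \<Phi>_def)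
      then have "norm (right_modification V S (t (Suc i)) - right_modification V S (t i))
          \<le> norm (\<Phi> (t (Suc i)) - \<Phi> (t i)) + norm (saltus V S (t (Suc i)) - saltus V S (t i))"
        by (metis norm_triangle_ineq)
      moreover have "cl (t i) \<le> cl (t (Suc i))" using ti(3) by (auto simp: cl_def)
      then have "norm (\<Phi> (t (Suc i)) - \<Phi> (t i)) \<le> L * (cl (t (Suc i)) - cl (t i))"
        using lip[OF cl(2)[OF ti(1)] cl(2)[OF ti(2)]] cl(1)[OF ti(1)] cl(1)[OF ti(2)] by simp
      moreover have "norm (saltus V S (t (Suc i)) - saltus V S (t i)) \<le> g (t (Suc i)) - g (t i)"
        unfolding g_def by (rule saltus_increment_le(1)[OF ti(3)])
      ultimately show ?thesis by linarith
    qed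
    have "(\<Sum>i<n. norm (right_modification V S (t (Suc i)) - right_modification V S (t i)))
        \<le> (\<Sum>i<n. L * (cl (t (Suc i)) - cl (t i)) + (g (t (Suc i)) - g (t i)))"
      by (rule sum_mono) (use step in simp)
    also have "\<dots> = L * (cl (t n) - cl (t 0)) + (g (t n) - g (t 0))"
      using sum_lessThan_telescope[of "\<lambda>i. cl (t i)" n] sum_lessThan_telescope[of "\<lambda>i. g (t i)" n]
      by (simp add: sum.distrib sum_distrib_left[symmetric])
    also have "\<dots> \<le> L * (2 * h) + (b - a) / c"
    proof (rule add_mono)
      show "L * (cl (t n) - cl (t 0)) \<le> L * (2 * h)"
        using L h by (intro mult_left_mono) (auto simp: cl_def)
      show "g (t n) - g (t 0) \<le> (b - a) / c"
        using saltus_increment_le(2,3)[of "t n" "t n"] saltus_increment_le(2)[of "t 0" "t 0"]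
        by (simp add: g_def)
    qed
    finally show "(\<Sum>i<n. norm (right_modification V S (t (Suc i)) - right_modification V S (t i)))
        \<le> L * (2 * h) + (b - a) / c" .
  qed
qed

end

section \<open>The decomposition for backward sectors\<close>

lemma jacobian_mult_eq_frechet:
  fixes f :: "real^'m \<Rightarrow> real^'n"
  assumes "f differentiable at X"
  shows "jacobian f (at X) *v w = frechet_derivative f (at X) w"
  using assms frechet_derivative_at[of f "\<lambda>w. jacobian f (at X) *v w" X] by (simp add: jacobian_works)

text \<open>
  In the coordinate \<open>V = fx U\<close> one has \<open>e\<^sub>V = \<eta>\<^sub>U\<close>, from which \<open>q\<^sub>V = e\<^sub>V f\<^sub>V\<close> follows.
\<close>

lemma entropy_flux_in_flux_coordinates:
  fixes fx fy :: "real^'m \<Rightarrow> real^'m"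
  assumes "open D" and fx: "smooth_on D fx" and fy: "smooth_on D fy"
    and pair: "entropy_flux_pair D fx fy \<eta> \<psi>x \<psi>y"
    and W: "W \<subseteq> D" "diffeomorphic_on W fx"
  defines "g \<equiv> the_inv_into W fx"
  shows "smooth_on (fx ` W) (fy \<circ> g)" "smooth_on (fx ` W) (\<psi>x \<circ> g)" "smooth_on (fx ` W) (\<psi>y \<circ> g)"
    and "\<And>X v. X \<in> fx ` W \<Longrightarrow> frechet_derivative (\<psi>y \<circ> g) (at X) v
      = frechet_derivative (\<psi>x \<circ> g) (at X) (frechet_derivative (fy \<circ> g) (at X) v)"
proof -
  have W': "open W" "open (fx ` W)" "inj_on fx W" "smooth_on (fx ` W) g"
    using W(2) by (auto simp: diffeomorphic_on_def g_def)
  have gW: "g ` (fx ` W) \<subseteq> D"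
    using W(1) the_inv_into_f_f[OF W'(3)] by (auto simp: g_def)
  have \<psi>: "smooth_on D \<psi>x" "smooth_on D \<psi>y" using pair by (simp_all add: entropy_flux_pair_def)
  show "smooth_on (fx ` W) (fy \<circ> g)" "smooth_on (fx ` W) (\<psi>x \<circ> g)" "smooth_on (fx ` W) (\<psi>y \<circ> g)"
    by (rule smooth_on_compose[OF W'(2) assms(1) gW W'(4)], fact)+
  fix X v assume X: "X \<in> fx ` W"
  then have U: "g X \<in> D" using gW by blast
  let ?U = "g X" and ?g' = "frechet_derivative g (at X)"
  have dg: "(g has_derivative ?g') (at X)" by (rule smooth_on_has_derivative[OF W'(4) X])
  have chain: "frechet_derivative (\<phi> \<circ> g) (at X) w = frechet_derivative \<phi> (at ?U) (?g' w)"
    if "smooth_on D \<phi>" for \<phi> :: "real^'m \<Rightarrow> real" and w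
    using fun_cong[OF frechet_derivative_at[OF diff_chain_at[OF dg smooth_on_has_derivative[OF that U]]], of w]
    by simp
  have chain': "frechet_derivative (\<phi> \<circ> g) (at X) w = frechet_derivative \<phi> (at ?U) (?g' w)"
    if "smooth_on D \<phi>" for \<phi> :: "real^'m \<Rightarrow> real^'m" and w
    using fun_cong[OF frechet_derivative_at[OF diff_chain_at[OF dg smooth_on_has_derivative[OF that U]]], of w]
    by simp
  have inv: "frechet_derivative fx (at ?U) (?g' w) = w" for w
  proof -
    have "((\<lambda>X. X) has_derivative (\<lambda>w. w)) (at X)" by (rule has_derivative_ident)
    then have "(fx \<circ> g has_derivative (\<lambda>w. w)) (at X)"
      using W'(2) X by (rule has_derivative_transform_within_open)
        (simp add: g_def f_the_inv_into_f[OF W'(3)])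
    from fun_cong[OF frechet_derivative_at[OF this], of w] show ?thesis using chain'[OF fx, of w] by simp
  qed
  have comp: "frechet_derivative \<psi>x (at ?U) w = frechet_derivative \<eta> (at ?U) (frechet_derivative fx (at ?U) w)"
    "frechet_derivative \<psi>y (at ?U) w = frechet_derivative \<eta> (at ?U) (frechet_derivative fy (at ?U) w)" for w
    using pair U by (simp_all add: entropy_flux_pair_def)
  show "frechet_derivative (\<psi>y \<circ> g) (at X) v
      = frechet_derivative (\<psi>x \<circ> g) (at X) (frechet_derivative (fy \<circ> g) (at X) v)"
    by (simp only: chain[OF \<psi>(1)] chain[OF \<psi>(2)] chain'[OF fy] comp inv)
qed

text \<open>
  The two hypotheses on the sector hold in particular at the centre, so that they provide \<open>\<gamma> > 0\<close>
  for one orientation of the eigenvector, and \<open>\<tau> \<beta> < 0\<close>. Without these signs at the centre the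
  implication is vacuous. This is why the radius can be fixed before the hypotheses are assumed.
\<close>

lemma backward_sectors_compressive:
  fixes f :: "real^'m \<Rightarrow> real^'m" and e q :: "real^'m \<Rightarrow> real"
  assumes "open N" and VN: "Vbar \<in> N"
    and f: "smooth_on N f" and e: "smooth_on N e" and q: "smooth_on N q"
    and compat: "\<And>X v. X \<in> N \<Longrightarrow>
      frechet_derivative q (at X) v = frechet_derivative e (at X) (frechet_derivative f (at X) v)"
    and hyp: "strictly_hyperbolic_at f Vbar" and fields: "unit_eigenvector_fields f Vbar r"
    and widths: "sector_widths f Vbar \<delta>" and \<alpha>: "\<alpha> \<in> {1..CARD('m)}"
  shows "\<forall>\<^sub>F \<epsilon> in at_right 0. \<forall>\<tau>\<in>{1, -1}.
    genuinely_nonlinear f r Vbar \<epsilon> \<alpha> \<and> backward_sector e r Vbar \<epsilon> \<tau> \<alpha> \<longrightarrow>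
    (\<exists>c C. \<forall>V. admissible f e q Vbar \<epsilon> \<tau> V \<longrightarrow>
      compressive_sector f e q (lambda f \<alpha>) (cball Vbar \<epsilon>)
        (lambda f \<alpha> Vbar - \<delta> \<epsilon> \<alpha>) (lambda f \<alpha> Vbar + \<delta> \<epsilon> \<alpha>) c C (2 * \<epsilon>) \<tau> V)"
proof -
  let ?lam = "lambda f \<alpha>"
  obtain \<rho> where \<rho>: "\<rho> > 0" "smooth_on (ball Vbar \<rho>) (r \<alpha>)"
      "\<And>V. V \<in> ball Vbar \<rho> \<Longrightarrow> norm (r \<alpha> V) = 1"
      "\<And>V. V \<in> ball Vbar \<rho> \<Longrightarrow> jacobian f (at V) *v r \<alpha> V = ?lam V *\<^sub>R r \<alpha> V"
    using fields \<alpha> unfolding unit_eigenvector_fields_def by blast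
  define N' where "N' = N \<inter> ball Vbar \<rho>"
  have N': "open N'" "Vbar \<in> N'" "N' \<subseteq> N" "N' \<subseteq> ball Vbar \<rho>"
    using assms(1,2) \<rho>(1) by (auto simp: N'_def)
  note f' = smooth_on_subset[OF f N'(3)] and e' = smooth_on_subset[OF e N'(3)]
    and q' = smooth_on_subset[OF q N'(3)] and r' = smooth_on_subset[OF \<rho>(2) N'(4)]
  have jac: "jacobian f (at X) *v w = frechet_derivative f (at X) w" if "X \<in> N'" for X w
    using that f' smooth_on_imp_differentiable by (intro jacobian_mult_eq_frechet) blast
  have eig: "frechet_derivative f (at X) (r \<alpha> X) = ?lam X *\<^sub>R r \<alpha> X" if "X \<in> N'" for X
    using \<rho>(4)[of X] jac[OF that] that N'(4) by auto
  have lam: "smooth_on N' ?lam"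
  proof (rule smooth_on_cong_open[OF _ N'(1)])
    show "smooth_on N' (\<lambda>X. r \<alpha> X \<bullet> frechet_derivative f (at X) (r \<alpha> X))"
      by (intro smooth_on_inner smooth_on_derivative_along N'(1) f' r')
    show "r \<alpha> X \<bullet> frechet_derivative f (at X) (r \<alpha> X) = ?lam X" if "X \<in> N'" for X
      using eig[OF that] \<rho>(3)[of X] that N'(4) by (auto simp: dot_square_norm)
  qed
  define G where "G = frechet_derivative ?lam (at Vbar)"
  have linear_G: "linear G"
    unfolding G_def using smooth_on_imp_differentiable[OF lam N'(2)] linear_frechet_derivative by blast
  have pos: "\<forall>\<^sub>F \<epsilon> in at_right (0::real). 0 < \<epsilon>" by (rule eventually_at_right_less)
  show ?thesis
  proof (cases "G (r \<alpha> Vbar) = 0 \<or> hessian e Vbar (r \<alpha> Vbar) (r \<alpha> Vbar) = 0")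
    case True
    show ?thesis
      using pos
    proof eventually_elim
      case (elim \<epsilon>)
      then have Vbar: "Vbar \<in> cball Vbar \<epsilon>" by simp
      have "hessian e Vbar (r \<alpha> Vbar) (r \<alpha> Vbar) \<noteq> 0" if "backward_sector e r Vbar \<epsilon> \<tau> \<alpha>" for \<tau>
        using that Vbar unfolding backward_sector_def by (metis less_irrefl mult_zero_right)
      moreover have "G (r \<alpha> Vbar) \<noteq> 0" if gnl: "genuinely_nonlinear f r Vbar \<epsilon> \<alpha>"
      proof -
        obtain t where "0 < G (t *\<^sub>R r \<alpha> Vbar)"
          using gnl Vbar unfolding genuinely_nonlinear_def G_def by blast
        then show ?thesis using linear_cmul[OF linear_G, of t "r \<alpha> Vbar"] by auto
      qed
      ultimately show ?case using True by blast
    qed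
  next
    case False
    \<comment> \<open>The orientation of the eigenvector along which the speed increases.\<close>
    define s where "s = sgn (G (r \<alpha> Vbar))"
    define R where "R = (\<lambda>X. s *\<^sub>R r \<alpha> X)"
    have s: "s = 1 \<or> s = -1" using False by (auto simp: s_def sgn_if)
    have R: "smooth_on N' R"
      using Ck_on_linear[OF bounded_linear_scaleR_right N'(1)] r' unfolding smooth_on_def R_def by blast
    have eig_R: "frechet_derivative f (at X) (R X) = ?lam X *\<^sub>R R X" if "X \<in> N'" for X
    proof -
      have "linear (frechet_derivative f (at X))"
        using that f' smooth_on_imp_differentiable linear_frechet_derivative by blast
      then show ?thesis using eig[OF that] by (simp add: R_def linear_cmul)
    qed
    have norm_R: "norm (R Vbar) = 1" using s \<rho>(3)[of Vbar] \<rho>(1) by (auto simp: R_def)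
    have simple: "\<exists>t. w = t *\<^sub>R R Vbar" if "frechet_derivative f (at Vbar) w = ?lam Vbar *\<^sub>R w" for w
    proof (rule simple_eigenspace)
      show "card (real_eigenvalues (jacobian f (at Vbar))) = CARD('m)"
        using hyp by (simp add: strictly_hyperbolic_at_def)
    qed (use that eig_R[OF N'(2)] jac[OF N'(2)] norm_R in auto)
    define \<beta> where "\<beta> = hessian e Vbar (R Vbar) (R Vbar)"
    have \<beta>_eq: "\<beta> = hessian e Vbar (r \<alpha> Vbar) (r \<alpha> Vbar)"
    proof -
      have sym: "hessian e Vbar u v = hessian e Vbar v u" for u v
        unfolding hessian_def by (rule second_derivative_symmetric[OF N'(1) e' N'(2)])
      have lin: "linear (hessian e Vbar u)" for u
        unfolding hessian_def using smooth_on_directional_derivative[OF e'] N'(2)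
          smooth_on_imp_differentiable linear_frechet_derivative by blast
      have "\<beta> = s * (s * hessian e Vbar (r \<alpha> Vbar) (r \<alpha> Vbar))"
        unfolding \<beta>_def R_def using linear_cmul[OF lin] sym by (metis real_scaleR_def)
      then show ?thesis using s by auto
    qed
    have "G (R Vbar) = \<bar>G (r \<alpha> Vbar)\<bar>"
      using linear_cmul[OF linear_G, of s] by (simp add: R_def s_def abs_sgn mult.commute)
    then have \<gamma>: "0 < G (R Vbar)" using False by simp
    have "\<exists>ell A H B l r0 G0 M k \<sigma> \<kappa>. 0 < \<kappa> \<and> (\<forall>\<^sub>F \<epsilon> in at_right 0.
        nonlinear_characteristic_field f (\<lambda>X. frechet_derivative f (at X)) e q
          (\<lambda>X. frechet_derivative e (at X)) ell ?lam (cball Vbar \<epsilon>) A H B l r0 G0 (?lam Vbar) \<beta> (G (R Vbar)) M k \<sigma> \<kappa>)"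
    proof (rule characteristic_field_near[OF N'(1,2) f' e' q' _ R lam eig_R norm_R simple \<beta>_def])
      show "\<beta> \<noteq> 0" using False by (simp add: \<beta>_eq)
      show "frechet_derivative q (at X) v = frechet_derivative e (at X) (frechet_derivative f (at X) v)"
        if "X \<in> N'" for X v
        using compat that N'(3) by blast
    qed (use \<gamma> in \<open>simp_all add: G_def\<close>)
    then obtain ell A H B l r0 G0 M k \<sigma> \<kappa> where \<kappa>: "0 < \<kappa>" and field: "\<forall>\<^sub>F \<epsilon> in at_right 0.
        nonlinear_characteristic_field f (\<lambda>X. frechet_derivative f (at X)) e q
          (\<lambda>X. frechet_derivative e (at X)) ell ?lam (cball Vbar \<epsilon>) A H B l r0 G0 (?lam Vbar) \<beta> (G (R Vbar)) M k \<sigma> \<kappa>"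
      by (elim exE conjE)
    have \<delta>0: "((\<lambda>\<epsilon>. \<delta> \<epsilon> \<alpha>) \<longlongrightarrow> 0) (at_right 0)" using widths \<alpha> by (simp add: sector_widths_def)
    have \<delta>: "\<forall>\<^sub>F \<epsilon> in at_right 0. \<delta> \<epsilon> \<alpha> < \<kappa>" by (rule order_tendstoD(2)[OF \<delta>0 \<kappa>])
    obtain \<epsilon>1 where \<epsilon>1: "\<epsilon>1 > 0" "\<And>\<epsilon>. \<epsilon> \<in> {0<..<\<epsilon>1} \<Longrightarrow>
        \<forall>Vp\<in>cball Vbar \<epsilon>. \<forall>Vm\<in>cball Vbar \<epsilon>. lambda_hat f \<alpha> Vp Vm \<in> sector f Vbar \<delta> \<epsilon> \<alpha>"
      using widths \<alpha> unfolding sector_widths_def by blast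
    have "\<forall>\<^sub>F \<epsilon> in at_right 0. \<epsilon> \<in> {0<..<\<epsilon>1}" by (rule eventually_at_right_real[OF \<epsilon>1(1)])
    moreover have "\<forall>\<^sub>F \<epsilon> in at_right 0. \<forall>X\<in>cball Vbar \<epsilon>. X \<in> N'"
      using N' by (intro eventually_nhds_imp_eventually_cball) (simp add: eventually_nhds_in_open)
    ultimately show ?thesis
      using field \<delta>
    proof eventually_elim
      case (elim \<epsilon>)
      interpret nonlinear_characteristic_field f "\<lambda>X. frechet_derivative f (at X)" e q
        "\<lambda>X. frechet_derivative e (at X)" ell ?lam "cball Vbar \<epsilon>" A H B l r0 G0 "?lam Vbar" \<beta> "G (R Vbar)" M k \<sigma> \<kappa>
        by (rule elim(3))
      have P: "cball Vbar \<epsilon> \<subseteq> N'" using elim(2) by blast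
      have "compressive_sector f e q ?lam (cball Vbar \<epsilon>)
          (?lam Vbar - \<delta> \<epsilon> \<alpha>) (?lam Vbar + \<delta> \<epsilon> \<alpha>) (G (R Vbar) / 12)
          (2 / G (R Vbar) + 2 * (M / G (R Vbar) + 1) / k) (2 * \<epsilon>) \<tau> V"
        if "backward_sector e r Vbar \<epsilon> \<tau> \<alpha>" and adm: "admissible f e q Vbar \<epsilon> \<tau> V" for \<tau> V
      proof (rule compressive_sectorI[OF refl N'(1) P f' refl])
        show "continuous_on (cball Vbar \<epsilon>) e" "continuous_on (cball Vbar \<epsilon>) q"
          using smooth_on_continuous_on e' q' P continuous_on_subset by blast+
        show "\<bar>\<xi> - ?lam Vbar\<bar> \<le> \<kappa>" if "\<xi> \<in> {?lam Vbar - \<delta> \<epsilon> \<alpha>..?lam Vbar + \<delta> \<epsilon> \<alpha>}" for \<xi>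
          using that elim(4) by auto
        show "?lam Vbar - \<delta> \<epsilon> \<alpha> < ?lam X \<and> ?lam X < ?lam Vbar + \<delta> \<epsilon> \<alpha>" if "X \<in> cball Vbar \<epsilon>" for X
          using \<epsilon>1(2)[OF elim(1)] that by (auto simp: sector_def lambda_def)
        have "Vbar \<in> cball Vbar \<epsilon>" using elim(1) by simp
        then show "\<tau> * \<beta> < 0"
          using \<open>backward_sector e r Vbar \<epsilon> \<tau> \<alpha>\<close> by (simp add: backward_sector_def \<beta>_eq)
      qed (use adm in \<open>auto simp: admissible_def weak_solution_def\<close>)
      then show ?case by blast
    qed
  qed
qed

theorem theorem7:
  fixes fx fy f :: "real^'m \<Rightarrow> real^'m"
    and \<eta> \<psi>x \<psi>y e q :: "real^'m \<Rightarrow> real"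
    and D W :: "(real^'m) set"
    and Ubar Vbar :: "real^'m"
    and r :: "nat \<Rightarrow> real^'m \<Rightarrow> real^'m"
    and \<delta> :: "real \<Rightarrow> nat \<Rightarrow> real"
  assumes "open D" and "Ubar \<in> D"
    and "smooth_on D fx" and "smooth_on D fy"
    and "invertible (jacobian fx (at Ubar))"
    and "entropy_flux_pair D fx fy \<eta> \<psi>x \<psi>y"
    and "uniformly_convex_on D \<eta>"
    and "W \<subseteq> D" and "Ubar \<in> W" and "diffeomorphic_on W fx"
    and "Vbar = fx Ubar"
    and "f = fy \<circ> the_inv_into W fx"
    and "e = \<psi>x \<circ> the_inv_into W fx"
    and "q = \<psi>y \<circ> the_inv_into W fx"
    and "strictly_hyperbolic_at f Vbar"
    and "unit_eigenvector_fields f Vbar r"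
    and "sector_widths f Vbar \<delta>"
  shows "\<exists>\<epsilon>0>0. \<forall>\<epsilon>\<in>{0<..\<epsilon>0}. \<forall>\<tau>\<in>{1, -1}. \<forall>\<alpha>\<in>{1..CARD('m)}.
    genuinely_nonlinear f r Vbar \<epsilon> \<alpha> \<and> backward_sector e r Vbar \<epsilon> \<tau> \<alpha> \<longrightarrow>
    (\<exists>L. \<forall>V. admissible f e q Vbar \<epsilon> \<tau> V \<longrightarrow>
       (let S = jump_set V (sector f Vbar \<delta> \<epsilon> \<alpha>);
            T = off_other_sectors f Vbar \<delta> \<epsilon> \<alpha>;
            V' = right_modification V S
        in saltus_well_defined V S \<and>
           (\<exists>VL. (\<forall>\<xi>. V' \<xi> = saltus V S \<xi> + VL \<xi>) \<and> L-lipschitz_on T VL) \<and>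
           bounded_variation_on T V'))"
proof -
  have N: "open (fx ` W)" "Vbar \<in> fx ` W"
    using assms(9-11) by (auto simp: diffeomorphic_on_def)
  note flux = entropy_flux_in_flux_coordinates[OF assms(1,3,4,6,8,10), folded assms(12-14)]
  have "\<forall>\<^sub>F \<epsilon> in at_right 0. \<forall>\<alpha>\<in>{1..CARD('m)}. \<forall>\<tau>\<in>{1, -1}.
    genuinely_nonlinear f r Vbar \<epsilon> \<alpha> \<and> backward_sector e r Vbar \<epsilon> \<tau> \<alpha> \<longrightarrow>
    (\<exists>c C. \<forall>V. admissible f e q Vbar \<epsilon> \<tau> V \<longrightarrow>
      compressive_sector f e q (lambda f \<alpha>) (cball Vbar \<epsilon>)
        (lambda f \<alpha> Vbar - \<delta> \<epsilon> \<alpha>) (lambda f \<alpha> Vbar + \<delta> \<epsilon> \<alpha>) c C (2 * \<epsilon>) \<tau> V)"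
    using backward_sectors_compressive[OF N flux assms(15-17)] by (intro eventually_ball_finite) auto
  then obtain \<epsilon>2 where \<epsilon>2: "\<epsilon>2 > 0" "\<And>\<epsilon> \<alpha> \<tau>. 0 < \<epsilon> \<Longrightarrow> \<epsilon> < \<epsilon>2 \<Longrightarrow> \<alpha> \<in> {1..CARD('m)} \<Longrightarrow> \<tau> \<in> {1, -1} \<Longrightarrow>
    genuinely_nonlinear f r Vbar \<epsilon> \<alpha> \<Longrightarrow> backward_sector e r Vbar \<epsilon> \<tau> \<alpha> \<Longrightarrow>
    \<exists>c C. \<forall>V. admissible f e q Vbar \<epsilon> \<tau> V \<longrightarrow>
      compressive_sector f e q (lambda f \<alpha>) (cball Vbar \<epsilon>)
        (lambda f \<alpha> Vbar - \<delta> \<epsilon> \<alpha>) (lambda f \<alpha> Vbar + \<delta> \<epsilon> \<alpha>) c C (2 * \<epsilon>) \<tau> V"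
    unfolding eventually_at_right_field by (metis (no_types, lifting))
  obtain \<epsilon>1 where \<epsilon>1: "\<epsilon>1 > 0"
    "\<And>\<epsilon> \<beta>. \<epsilon> \<in> {0<..<\<epsilon>1} \<Longrightarrow> \<beta> \<in> {1..CARD('m)} \<Longrightarrow> 0 < \<delta> \<epsilon> \<beta>"
    "\<And>\<epsilon>. \<epsilon> \<in> {0<..<\<epsilon>1} \<Longrightarrow>
      disjoint_family_on (\<lambda>\<alpha>. closure (sector f Vbar \<delta> \<epsilon> \<alpha>)) {1..CARD('m)}"
    "\<And>\<epsilon> V C. \<epsilon> \<in> {0<..<\<epsilon>1} \<Longrightarrow> weak_solution f Vbar \<epsilon> V \<Longrightarrow>
      C \<in> components (UNIV - (\<Union>\<alpha>\<in>{1..CARD('m)}. sector f Vbar \<delta> \<epsilon> \<alpha>)) \<Longrightarrow> V constant_on C"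
    using assms(17) unfolding sector_widths_def by blast
  \<comment> \<open>Halved, as the radii below \<open>\<epsilon>1\<close> and \<open>\<epsilon>2\<close> form open intervals.\<close>
  define \<epsilon>0 where "\<epsilon>0 = min \<epsilon>1 \<epsilon>2 / 2"
  have "\<epsilon>0 > 0" using \<epsilon>1(1) \<epsilon>2(1) by (simp add: \<epsilon>0_def)
  moreover have "\<exists>L. \<forall>V. admissible f e q Vbar \<epsilon> \<tau> V \<longrightarrow>
       (let S = jump_set V (sector f Vbar \<delta> \<epsilon> \<alpha>);
            T = off_other_sectors f Vbar \<delta> \<epsilon> \<alpha>;
            V' = right_modification V S
        in saltus_well_defined V S \<and>
           (\<exists>VL. (\<forall>\<xi>. V' \<xi> = saltus V S \<xi> + VL \<xi>) \<and> L-lipschitz_on T VL) \<and>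
           bounded_variation_on T V')"
    if \<epsilon>_in: "\<epsilon> \<in> {0<..\<epsilon>0}" and \<tau>: "\<tau> \<in> {1, -1}" and \<alpha>: "\<alpha> \<in> {1..CARD('m)}"
      and gnl: "genuinely_nonlinear f r Vbar \<epsilon> \<alpha>" and bw: "backward_sector e r Vbar \<epsilon> \<tau> \<alpha>" for \<epsilon> \<tau> \<alpha>
  proof -
    have \<epsilon>: "0 < \<epsilon>" "\<epsilon> < \<epsilon>2" "\<epsilon> \<in> {0<..<\<epsilon>1}" using \<epsilon>_in \<epsilon>1(1) \<epsilon>2(1) by (auto simp: \<epsilon>0_def)
    let ?I = "{1..CARD('m)}" and ?lo = "\<lambda>\<beta>. lambda f \<beta> Vbar - \<delta> \<epsilon> \<beta>" and ?hi = "\<lambda>\<beta>. lambda f \<beta> Vbar + \<delta> \<epsilon> \<beta>"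
    define a where "a = ?lo \<alpha>"
    define b where "b = ?hi \<alpha>"
    define T where "T = off_other_sectors f Vbar \<delta> \<epsilon> \<alpha>"
    note \<delta>_pos = \<epsilon>1(2)[OF \<epsilon>(3)]
    have sector_\<alpha>: "sector f Vbar \<delta> \<epsilon> \<alpha> = {a<..<b}" by (simp add: sector_def a_def b_def)
    have ab: "a < b" using \<delta>_pos[OF \<alpha>] by (simp add: a_def b_def)
    have T_iff: "x \<in> T \<longleftrightarrow> (\<forall>\<beta>\<in>?I - {\<alpha>}. \<not> (?lo \<beta> < x \<and> x < ?hi \<beta>))" for x
      by (auto simp: T_def off_other_sectors_def sector_def)
    have T: "{a..b} \<subseteq> T"
    proof
      fix x assume x: "x \<in> {a..b}"
      then have x\<alpha>: "x \<in> closure (sector f Vbar \<delta> \<epsilon> \<alpha>)" using ab by (simp add: sector_\<alpha>)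
      show "x \<in> T"
        unfolding T_iff
      proof
        fix \<beta> assume \<beta>: "\<beta> \<in> ?I - {\<alpha>}"
        then have "closure (sector f Vbar \<delta> \<epsilon> \<alpha>) \<inter> closure (sector f Vbar \<delta> \<epsilon> \<beta>) = {}"
          using \<epsilon>1(3)[OF \<epsilon>(3)] \<alpha> by (auto simp: disjoint_family_on_def)
        then have "x \<notin> sector f Vbar \<delta> \<epsilon> \<beta>" using x\<alpha> closure_subset by blast
        then show "\<not> (?lo \<beta> < x \<and> x < ?hi \<beta>)" by (simp add: sector_def)
      qed
    qed
    \<comment> \<open>A lower bound for the widths of the other sectors, hence for the gaps of \<open>T\<close>.\<close>
    define w where "w = Min ((\<lambda>\<beta>. 2 * \<delta> \<epsilon> \<beta>) ` ?I)"
    have w_le: "w \<le> 2 * \<delta> \<epsilon> \<beta>" if "\<beta> \<in> ?I" for \<beta> unfolding w_def using that by simp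
    have w: "0 < w" unfolding w_def using \<alpha> \<delta>_pos by (subst Min_gr_iff) auto
    have gap: "w \<le> y - x" if xy: "x \<in> T" "y \<in> T" "x \<le> y" "\<not> {x..y} \<subseteq> T" for x y
    proof -
      obtain z where "z \<in> {x..y}" "z \<notin> T" using xy(4) by blast
      moreover from this obtain \<beta> where "\<beta> \<in> ?I - {\<alpha>}" "?lo \<beta> < z" "z < ?hi \<beta>"
        unfolding T_iff by blast
      ultimately have z: "x \<le> z" "z \<le> y" "\<beta> \<in> ?I - {\<alpha>}" "?lo \<beta> < z" "z < ?hi \<beta>" by simp_all
      then have "x \<le> ?lo \<beta>" "?hi \<beta> \<le> y"
        using xy(1,2) unfolding T_iff by (meson less_le_trans le_less_trans not_le)+
      then show ?thesis using w_le[of \<beta>] z(3) by auto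
    qed
    \<comment> \<open>All sectors lie between \<open>- h\<close> and \<open>h\<close>.\<close>
    define h where "h = (\<Sum>\<beta>\<in>?I. \<bar>lambda f \<beta> Vbar\<bar> + \<delta> \<epsilon> \<beta>)"
    have h: "- h \<le> ?lo \<beta>" "?hi \<beta> \<le> h" if "\<beta> \<in> ?I" for \<beta>
    proof -
      have "\<bar>lambda f \<beta> Vbar\<bar> + \<delta> \<epsilon> \<beta> \<le> h"
        unfolding h_def using that \<delta>_pos by (intro member_le_sum) (auto simp: less_imp_le add_nonneg_nonneg)
      then show "- h \<le> ?lo \<beta>" "?hi \<beta> \<le> h" by linarith+
    qed
    have far: "{..- h} \<subseteq> T" "{h..} \<subseteq> T" "- h \<le> a" "b \<le> h"
      using h h[OF \<alpha>] by (auto simp: T_iff a_def b_def) (meson DiffD1 le_less_trans not_le order_trans)+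
    obtain c C where comp: "\<And>V. admissible f e q Vbar \<epsilon> \<tau> V \<Longrightarrow>
        compressive_sector f e q (lambda f \<alpha>) (cball Vbar \<epsilon>) a b c C (2 * \<epsilon>) \<tau> V"
      using \<epsilon>2(2)[OF \<epsilon>(1,2) \<alpha> \<tau> gnl bw] unfolding a_def b_def by blast
    define L where "L = max (C * (1 + 2 * \<epsilon>) + 1 / c) ((2 * \<epsilon> + (b - a) / c) / w)"
    show ?thesis
    proof (intro exI[of _ L] allI impI)
      fix V assume adm: "admissible f e q Vbar \<epsilon> \<tau> V"
      interpret compressive_sector f e q "lambda f \<alpha>" "cball Vbar \<epsilon>" a b c C "2 * \<epsilon>" \<tau> V
        by (rule comp[OF adm])
      have const: "V u = V v" if uv: "u \<le> v" "{u..v} \<subseteq> T - {a<..<b}" for u v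
      proof -
        have "{u..v} \<subseteq> UNIV - (\<Union>\<beta>\<in>?I. sector f Vbar \<delta> \<epsilon> \<beta>)"
        proof -
          have "x \<notin> sector f Vbar \<delta> \<epsilon> \<beta>" if "x \<in> {u..v}" "\<beta> \<in> ?I" for x \<beta>
            using that uv(2) sector_\<alpha> by (cases "\<beta> = \<alpha>") (auto simp: T_iff sector_def)
          then show ?thesis by blast
        qed
        moreover have "connected {u..v}" "{u..v} \<noteq> {}" using uv(1) by auto
        ultimately obtain K where "K \<in> components (UNIV - (\<Union>\<beta>\<in>?I. sector f Vbar \<delta> \<epsilon> \<beta>))" "{u..v} \<subseteq> K"
          using exists_component_superset[of "{u..v}"] by (metis subset_empty)
        moreover have "weak_solution f Vbar \<epsilon> V" using adm by (simp add: admissible_def)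
        ultimately have "V constant_on {u..v}" using \<epsilon>1(4)[OF \<epsilon>(3)] constant_on_subset by blast
        then show ?thesis using uv(1) unfolding constant_on_def by force
      qed
      note reg = regularity_off_gaps[OF T const w gap far, folded L_def]
      have S: "jump_set V (sector f Vbar \<delta> \<epsilon> \<alpha>) = S" by (simp add: S_def sector_\<alpha>)
      show "let S = jump_set V (sector f Vbar \<delta> \<epsilon> \<alpha>);
            T = off_other_sectors f Vbar \<delta> \<epsilon> \<alpha>;
            V' = right_modification V S
        in saltus_well_defined V S \<and>
           (\<exists>VL. (\<forall>\<xi>. V' \<xi> = saltus V S \<xi> + VL \<xi>) \<and> L-lipschitz_on T VL) \<and>
           bounded_variation_on T V'"
        unfolding Let_def S T_def[symmetric]
        using saltus_part_well_defined reg by (auto intro!: exI[of _ \<Phi>] simp: \<Phi>_def)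
    qed
  qed
  ultimately show ?thesis by blast
qed

end
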